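(* Let $\mu$ be a partition of the integer $k$ with $\ell(\mu)$ parts, and let $(S_1,S_2)$ be a fixed couple of pair-partitions of $[2k]$ of type $\mu$. Then, as functions on the set of all Young diagrams (of any size), $$\Sigma^{(2)}_\mu=\frac{1}{2^{\ell(\mu)}}\sum_{S_0}(-1)^{\mathcal{L}(S_0,S_1)}\,2^{|\mathcal{L}(S_0,S_1)|}\,N^{(1)}_{S_0,S_1,S_2},$$ where the sum runs over all pair-partitions $S_0$ of $[2k]$.
   Context: A pair-partition of $[2k]$ is a set of pairwise disjoint two-element subsets with union $[2k]$, identified with the fixed-point-free involution sending each element to its partner. For pair-partitions $A,B$ of $[2k]$, $\mathcal{L}(A,B)$ is the bipartite graph with a black vertex for each pair of $A$, a white vertex for each pair of $B$, and for each $i\in[2k]$ an edge joining the pair of $A$ containing $i$ to the pair of $B$ containing $i$; it is a disjoint union of loops (viewed also as subsets of $[2k]$ via edge labels) of lengths $2\ell_1\ge2\ell_2\ge\cdots$; $(\ell_1,\ell_2,\dots)$ is the type of $(A,B)$, $|\mathcal{L}(A,B)|$ the number of loops, and $(-1)^{\mathcal{L}(A,B)}=(-1)^{k-|\mathcal{L}(A,B)|}$. For a Young diagram $\lambda$, $N^{(1)}_{S_0,S_1,S_2}(\lambda)$ is the number of functions $f$ from $[2k]$ to the boxes of $\lambda$ such that for every $l\in[2k]$: $f(l)=f(S_0(l))$; $f(l)$ and $f(S_1(l))$ are in the same column; $f(l)$ and $f(S_2(l))$ are in the same row. Zonal characters: write the Jack polynomial (Macdonald's $J$-normalization; for $\alpha=2$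 it is the zonal polynomial $Z_\lambda$) as $J^{(\alpha)}_\lambda=\sum_{|\rho|=|\lambda|}\theta^{(\alpha)}_\rho(\lambda)p_\rho$ in the power-sum basis. For $|\lambda|\ge|\mu|$ set $\Sigma^{(\alpha)}_\mu(\lambda)=\binom{|\lambda|-|\mu|+m_1(\mu)}{m_1(\mu)}\,z_\mu\,\theta^{(\alpha)}_{\mu\cup 1^{|\lambda|-|\mu|}}(\lambda)$, and $\Sigma^{(\alpha)}_\mu(\lambda)=0$ if $|\lambda|<|\mu|$; here $m_i(\mu)$ is the multiplicity of $i$ in $\mu$ and $z_\mu=\prod_i i^{m_i(\mu)}m_i(\mu)!$. *)

theory Defs
  imports Complex_Main "HOL-Library.Multiset" "HOL-Library.FuncSet"
begin

section \<open>Partitions and Young diagrams\<close>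

text \<open>A partition is a weakly decreasing list of positive integers.
  A Young diagram is identified with its partition (row lengths).\<close>

definition is_partition :: "nat list \<Rightarrow> bool" where
  "is_partition \<rho> \<longleftrightarrow> sorted_wrt (\<ge>) \<rho> \<and> 0 \<notin> set \<rho>"

definition partitions_of :: "nat \<Rightarrow> nat list set" where
  "partitions_of n = {\<rho>. is_partition \<rho> \<and> sum_list \<rho> = n}"

text \<open>Boxes (row, column), 0-based.\<close>
definition boxes :: "nat list \<Rightarrow> (nat \<times> nat) set" where
  "boxes la = {(i, j). i < length la \<and> j < la ! i}"

definition conj_part :: "nat list \<Rightarrow> nat \<Rightarrow> nat" where
  "conj_part la j = card {i. i < length la \<and> j < la ! i}"

definition arm :: "nat list \<Rightarrow> nat \<times> nat \<Rightarrow> nat" where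
  "arm la s = la ! fst s - snd s - 1"

definition leg :: "nat list \<Rightarrow> nat \<times> nat \<Rightarrow> nat" where
  "leg la s = conj_part la (snd s) - fst s - 1"

text \<open>multiplicity m_i and z_mu\<close>
definition mult :: "nat list \<Rightarrow> nat \<Rightarrow> nat" where
  "mult \<mu> i = count (mset \<mu>) i"

definition zee :: "nat list \<Rightarrow> real" where
  "zee \<mu> = (\<Prod>i\<in>set \<mu>. real i ^ mult \<mu> i * fact (mult \<mu> i))"

text \<open>Dominance order: \<open>dominated \<mu> la\<close> means \<open>\<mu> \<le> la\<close>.\<close>
definition dominated :: "nat list \<Rightarrow> nat list \<Rightarrow> bool" where
  "dominated \<mu> la \<longleftrightarrow> sum_list \<mu> = sum_list la \<and>
     (\<forall>i. sum_list (take i \<mu>) \<le> sum_list (take i la))"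

section \<open>Symmetric functions of degree n in the power-sum basis\<close>

text \<open>A homogeneous symmetric function of degree n is represented by its coefficient
  function \<open>f\<close> in the power-sum basis (f \<rho> = coefficient of p_\<rho>, \<rho> a partition of n).
  \<open>p_to_m \<rho> \<mu>\<close> is the coefficient of the monomial x^\<mu> in p_\<rho>.\<close>

definition p_to_m :: "nat list \<Rightarrow> nat list \<Rightarrow> nat" where
  "p_to_m \<rho> \<mu> = card {f \<in> {0..<length \<rho>} \<rightarrow>\<^sub>E {0..<length \<mu>}.
       \<forall>j < length \<mu>. (\<Sum>i\<in>{i. i < length \<rho> \<and> f i = j}. \<rho> ! i) = \<mu> ! j}"

definition mcoeff :: "nat \<Rightarrow> (nat list \<Rightarrow> real) \<Rightarrow> nat list \<Rightarrow> real" where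
  "mcoeff n f \<mu> = (\<Sum>\<rho>\<in>partitions_of n. f \<rho> * real (p_to_m \<rho> \<mu>))"

text \<open>The \<alpha>-deformed Hall scalar product: <p_\<rho>, p_\<sigma>> = \<delta> z_\<rho> \<alpha>^{l(\<rho>)}.\<close>
definition jack_scalar :: "real \<Rightarrow> nat \<Rightarrow> (nat list \<Rightarrow> real) \<Rightarrow> (nat list \<Rightarrow> real) \<Rightarrow> real" where
  "jack_scalar \<alpha> n f g = (\<Sum>\<rho>\<in>partitions_of n. f \<rho> * g \<rho> * zee \<rho> * \<alpha> ^ length \<rho>)"

text \<open>Macdonald's characterization of the monic Jack polynomials P_la:
  P_la = m_la + (combination of m_\<mu>, \<mu> < la in dominance), pairwise orthogonal.
  \<open>jack_P_family \<alpha> n la \<rho>\<close> is the coefficient of p_\<rho> in P_la for la \<turnstile> n.\<close>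
definition jack_P_family :: "real \<Rightarrow> nat \<Rightarrow> nat list \<Rightarrow> nat list \<Rightarrow> real" where
  "jack_P_family \<alpha> n = (THE P.
      (\<forall>la\<in>partitions_of n. \<forall>\<mu>\<in>partitions_of n. mcoeff n (P la) \<mu> \<noteq> 0 \<longrightarrow> dominated \<mu> la) \<and>
      (\<forall>la\<in>partitions_of n. mcoeff n (P la) la = 1) \<and>
      (\<forall>la\<in>partitions_of n. \<forall>\<mu>\<in>partitions_of n. la \<noteq> \<mu> \<longrightarrow> jack_scalar \<alpha> n (P la) (P \<mu>) = 0) \<and>
      (\<forall>la. la \<notin> partitions_of n \<longrightarrow> P la = (\<lambda>_. 0)) \<and>
      (\<forall>la \<rho>. \<rho> \<notin> partitions_of n \<longrightarrow> P la \<rho> = 0))"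

text \<open>Normalization constant c_la(\<alpha>) = \<Prod>_s (\<alpha> a(s) + l(s) + 1); J_la = c_la(\<alpha>) P_la.\<close>
definition jack_c :: "real \<Rightarrow> nat list \<Rightarrow> real" where
  "jack_c \<alpha> la = (\<Prod>s\<in>boxes la. \<alpha> * real (arm la s) + real (leg la s) + 1)"

text \<open>\<theta>^{(\<alpha>)}_\<rho>(la): coefficient of p_\<rho> in J^{(\<alpha>)}_la.\<close>
definition theta :: "real \<Rightarrow> nat list \<Rightarrow> nat list \<Rightarrow> real" where
  "theta \<alpha> \<rho> la = jack_c \<alpha> la * jack_P_family \<alpha> (sum_list la) la \<rho>"

definition Sigma_char :: "real \<Rightarrow> nat list \<Rightarrow> nat list \<Rightarrow> real" where
  "Sigma_char \<alpha> \<mu> la =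
     (if sum_list \<mu> \<le> sum_list la then
        real ((sum_list la - sum_list \<mu> + mult \<mu> 1) choose (mult \<mu> 1)) * zee \<mu> *
        theta \<alpha> (\<mu> @ replicate (sum_list la - sum_list \<mu>) 1) la
      else 0)"

section \<open>Pair-partitions and loops\<close>

text \<open>A pair-partition of [2k] = {1..2k}, as a fixed-point-free involution (identity outside).\<close>
definition pair_partition :: "nat \<Rightarrow> (nat \<Rightarrow> nat) \<Rightarrow> bool" where
  "pair_partition k S \<longleftrightarrow>
     (\<forall>i\<in>{1..2*k}. S i \<in> {1..2*k} \<and> S i \<noteq> i \<and> S (S i) = i) \<and>
     (\<forall>i. i \<notin> {1..2*k} \<longrightarrow> S i = i)"

definition pair_partitions :: "nat \<Rightarrow> (nat \<Rightarrow> nat) set" where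
  "pair_partitions k = {S. pair_partition k S}"

text \<open>Edges i and j of L(A,B) are adjacent iff they share a vertex, i.e. j = A i or j = B i.
  The loops (connected components, as sets of edge labels) are the classes of the
  reflexive-transitive closure of this adjacency.\<close>
definition loop_rel :: "nat \<Rightarrow> (nat \<Rightarrow> nat) \<Rightarrow> (nat \<Rightarrow> nat) \<Rightarrow> (nat \<times> nat) set" where
  "loop_rel k A B = {(i, A i) | i. i \<in> {1..2*k}} \<union> {(i, B i) | i. i \<in> {1..2*k}}"

definition loops :: "nat \<Rightarrow> (nat \<Rightarrow> nat) \<Rightarrow> (nat \<Rightarrow> nat) \<Rightarrow> nat set set" where
  "loops k A B = {1..2*k} // ((loop_rel k A B)\<^sup>*)"

definition num_loops :: "nat \<Rightarrow> (nat \<Rightarrow> nat) \<Rightarrow> (nat \<Rightarrow> nat) \<Rightarrow> nat" where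
  "num_loops k A B = card (loops k A B)"

text \<open>Type of (A,B): multiset of half-lengths of loops (a loop of length 2l has 2l edges).\<close>
definition loop_type :: "nat \<Rightarrow> (nat \<Rightarrow> nat) \<Rightarrow> (nat \<Rightarrow> nat) \<Rightarrow> nat multiset" where
  "loop_type k A B = image_mset (\<lambda>C. card C div 2) (mset_set (loops k A B))"

definition loop_sign :: "nat \<Rightarrow> (nat \<Rightarrow> nat) \<Rightarrow> (nat \<Rightarrow> nat) \<Rightarrow> real" where
  "loop_sign k A B = (-1) ^ (k - num_loops k A B)"

section \<open>N^{(1)}\<close>

definition N1 :: "nat \<Rightarrow> (nat \<Rightarrow> nat) \<Rightarrow> (nat \<Rightarrow> nat) \<Rightarrow> (nat \<Rightarrow> nat) \<Rightarrow> nat list \<Rightarrow> nat" where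
  "N1 k S0 S1 S2 la = card {f \<in> {1..2*k} \<rightarrow>\<^sub>E boxes la.
      \<forall>l\<in>{1..2*k}. f l = f (S0 l) \<and> snd (f l) = snd (f (S1 l)) \<and> fst (f l) = fst (f (S2 l))}"

end

theory Submission
  imports Defs "HOL-Combinatorics.Cycles"
begin

text \<open>The coefficients \<open>Z\<^sub>\<lambda>(\<rho>)\<close> of the zonal polynomial are obtained from a signed sum over pairs \<open>(p, A)\<close>,
  where \<open>p\<close> permutes the boxes of \<open>\<lambda>\<close> within columns and \<open>A\<close> is a row-preserving pairing of two
  copies of each box; \<open>p\<close> is read as a pairing of first copies with second copies, and \<open>\<rho>\<close> is
  the type of the two pairings. That this sum satisfies Macdonald's characterization rests on
  sign-reversing involutions: conjugating by a transposition of two boxes of one column kills every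
  monomial whose exponent is not dominated by \<open>\<lambda>\<close>, and, since \<open>z\<^sub>\<rho> 2\<^bsup>l(\<rho>)\<^esup>\<close> counts the isomorphisms between
  two pairs of pairings of type \<open>\<rho>\<close>, also kills the scalar product of \<open>Z\<^sub>\<lambda>\<close> and \<open>Z\<^sub>\<mu>\<close> for \<open>\<lambda> \<noteq> \<mu>\<close>. The leading
  coefficient is evaluated by removing boxes one at a time, from the bottom row upwards and from left to
  right, each removal contributing a factor \<open>2 a(s) + l(s) + 1\<close>.

  Counting embeddings of \<open>(S\<^sub>1, S\<^sub>2)\<close> into the pairs \<open>(p, A)\<close> turns the zonal character into a sum over
  injective maps \<open>\<phi> = (f, \<epsilon>)\<close> from \<open>[2k]\<close> to two copies of \<open>\<lambda>\<close>, and \<open>S\<^sub>0\<close> is the pullback of the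
  pairing of the two copies of each box. The colouring \<open>\<epsilon>\<close> alternates along the loops of \<open>(S\<^sub>0, S\<^sub>1)\<close>,
  which accounts for the factor \<open>2\<close> per loop, and the terms of non-injective \<open>\<phi>\<close> cancel.\<close>

section \<open>Loops of two pairings\<close>

text \<open>\<open>jack_P_family\<close> is a definite description, so an explicit family has to be
  matched with a uniqueness proof, which rests on the positive definiteness of the scalar product.
  The power sum of index \<rho> may be evaluated on any pair of pairings of type \<rho> by counting
  colourings constant on loops; for a fixed colouring the signed sum over \<open>p\<close> can then
  be isolated. In the scalar product the column pairing of one diagram may be matched with the row
  pairing of the other, because the type of two pairings is symmetric; only this makes the sum
  factor into alternating sums. The leading coefficient resists induction over boxes, since a
  prescribed content refers to the whole diagram. For fillings with non-zero alternating sum it is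
  equivalent to bounding each value by the length of its column in \<lambda>, and these bounds stay
  fixed while boxes are removed. The normalization of \<open>Sigma_char\<close> and the prefactor in
  the theorem have one common origin: the number of embeddings of \<open>(S1, S2)\<close> into a
  pair of type \<mu> with \<open>m\<close> ones added is \<open>2 ^ length \<mu> * zee \<mu>\<close>
  times the binomial coefficient.\<close>

abbreviation swap :: "'a \<Rightarrow> 'a \<Rightarrow> 'a \<Rightarrow> 'a" where
  "swap \<equiv> Transposition.transpose"

text \<open>Being the identity outside \<open>X\<close> makes a pairing a single function, so that
  sums over pairings count each of them once.\<close>

definition pairing :: "'a set \<Rightarrow> ('a \<Rightarrow> 'a) \<Rightarrow> bool" where
  "pairing X S \<longleftrightarrow> (\<forall>x\<in>X. S x \<in> X \<and> S x \<noteq> x \<and> S (S x) = x) \<and> (\<forall>x. x \<notin> X \<longrightarrow> S x = x)"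

definition adj :: "'a set \<Rightarrow> ('a \<Rightarrow> 'a) \<Rightarrow> ('a \<Rightarrow> 'a) \<Rightarrow> ('a \<times> 'a) set" where
  "adj X A B = {(i, A i) | i. i \<in> X} \<union> {(i, B i) | i. i \<in> X}"

definition lps :: "'a set \<Rightarrow> ('a \<Rightarrow> 'a) \<Rightarrow> ('a \<Rightarrow> 'a) \<Rightarrow> 'a set set" where
  "lps X A B = X // (adj X A B)\<^sup>*"

definition ltype :: "'a set \<Rightarrow> ('a \<Rightarrow> 'a) \<Rightarrow> ('a \<Rightarrow> 'a) \<Rightarrow> nat multiset" where
  "ltype X A B = image_mset (\<lambda>C. card C div 2) (mset_set (lps X A B))"

definition cls :: "'a set \<Rightarrow> ('a \<Rightarrow> 'a) \<Rightarrow> ('a \<Rightarrow> 'a) \<Rightarrow> 'a \<Rightarrow> 'a set" where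
  "cls X A B x = (adj X A B)\<^sup>* `` {x}"

text \<open>Traverses the loop through \<open>x\<close> by applying \<open>A\<close> and
  \<open>B\<close> alternately, \<open>A\<close> first. The parity of the index decides which
  pairing comes next, so shift arguments compare indices of equal parity.\<close>

primrec walk :: "('a \<Rightarrow> 'a) \<Rightarrow> ('a \<Rightarrow> 'a) \<Rightarrow> 'a \<Rightarrow> nat \<Rightarrow> 'a" where
  "walk A B x 0 = x"
| "walk A B x (Suc n) = (if even n then A else B) (walk A B x n)"

lemma pairingD:
  assumes "pairing X S"
  shows "x \<in> X \<Longrightarrow> S x \<in> X" "x \<in> X \<Longrightarrow> S x \<noteq> x" "S (S x) = x" "x \<notin> X \<Longrightarrow> S x = x"
  using assms unfolding pairing_def by - (blast, blast, metis, blast)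

lemma pairing_mem_iff: "pairing X S \<Longrightarrow> S x \<in> X \<longleftrightarrow> x \<in> X"
  by (metis pairingD)

lemma pairing_eq_iff: "pairing X S \<Longrightarrow> S x = S y \<longleftrightarrow> x = y"
  by (metis pairingD(3))

lemma pairing_even_card:
  assumes "pairing X S" "finite C" "C \<subseteq> X" "\<And>x. x \<in> C \<Longrightarrow> S x \<in> C"
  shows "even (card C)"
  using assms(2-4)
proof (induction "card C" arbitrary: C rule: less_induct)
  case less
  show ?case
  proof (cases "C = {}")
    case False
    then obtain x where x: "x \<in> C" by auto
    let ?D = "C - {x, S x}"
    have ne: "S x \<noteq> x" using pairingD(2)[OF assms(1)] x less.prems by auto
    have "card {x, S x} \<le> card C" using x less.prems by (intro card_mono) auto
    have c: "card ?D = card C - 2" using x less.prems ne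
      by (subst card_Diff_subset) auto
    have c2: "card C \<ge> 2" using \<open>card {x, S x} \<le> card C\<close> ne by simp
    have "even (card ?D)"
    proof (rule less.hyps)
      show "card ?D < card C" using c c2 by simp
      show "S y \<in> ?D" if "y \<in> ?D" for y
        using that less.prems(3)[of y] pairingD(3)[OF assms(1)] by (metis Diff_iff insert_iff singletonD)
    qed (use less.prems in auto)
    thus ?thesis using c c2 by simp
  qed simp
qed

section \<open>The loop through a point as the range of an alternating walk\<close>

locale pairings =
  fixes X :: "'a set" and A B :: "'a \<Rightarrow> 'a"
  assumes fin: "finite X" and pA: "pairing X A" and pB: "pairing X B"
begin

lemma walk_mem: "x \<in> X \<Longrightarrow> walk A B x n \<in> X"
  by (induction n) (auto simp: pairing_mem_iff[OF pA] pairing_mem_iff[OF pB])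

lemma walk_cancel:
  assumes "even i = even j" "walk A B x (i + m) = walk A B x (j + m)"
  shows "walk A B x i = walk A B x j"
  using assms by (induction m) (auto simp: pairing_eq_iff[OF pA] pairing_eq_iff[OF pB] split: if_splits)

lemma walk_shift:
  assumes "even i = even j" "walk A B x i = walk A B x j"
  shows "walk A B x (i + m) = walk A B x (j + m)"
  using assms by (induction m) auto

text \<open>A return after an odd number of steps would be a reflection of the walk, with a fixed point halfway.\<close>
lemma walk_odd: "x \<in> X \<Longrightarrow> walk A B x i \<noteq> walk A B x (i + 2 * m + 1)"
proof (induction m arbitrary: i)
  case 0
  have "walk A B x i \<in> X" using 0 by (rule walk_mem)
  then show ?case using pairingD(2)[OF pA, of "walk A B x i"] pairingD(2)[OF pB, of "walk A B x i"] by auto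
next
  case (Suc m)
  show ?case
  proof
    assume eq: "walk A B x i = walk A B x (i + 2 * Suc m + 1)"
    have "walk A B x (Suc i) = walk A B x (Suc i + 2 * m + 1)"
    proof -
      have s: "i + 2 * Suc m + 1 = Suc (Suc i + 2 * m + 1)" by simp
      show ?thesis using eq unfolding s
        by (auto simp: pairingD(3)[OF pA] pairingD(3)[OF pB])
    qed
    thus False using Suc.IH[of "Suc i"] Suc.prems by blast
  qed
qed

lemma cls_refl: "x \<in> cls X A B x"
  by (simp add: cls_def)

text \<open>Induction along a loop without mentioning paths: a loop is the least set that contains
  its base point and is stable under both pairings.\<close>

lemma cls_least:
  assumes "y \<in> cls X A B x" "x \<in> D" "\<And>z. z \<in> D \<Longrightarrow> A z \<in> D" "\<And>z. z \<in> D \<Longrightarrow> B z \<in> D"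
  shows "y \<in> D"
proof -
  have "(x, y) \<in> (adj X A B)\<^sup>*" using assms(1) by (simp add: cls_def)
  thus ?thesis using assms(2) by (induction) (auto simp: adj_def assms)
qed

lemma cls_stepA: "y \<in> cls X A B x \<Longrightarrow> A y \<in> cls X A B x"
proof -
  assume y: "y \<in> cls X A B x"
  show ?thesis
  proof (cases "y \<in> X")
    case True
    hence "(y, A y) \<in> adj X A B" by (auto simp: adj_def)
    thus ?thesis using y by (auto simp: cls_def intro: rtrancl_into_rtrancl)
  qed (use y pairingD(4)[OF pA] in simp)
qed

lemma cls_stepB: "y \<in> cls X A B x \<Longrightarrow> B y \<in> cls X A B x"
proof -
  assume y: "y \<in> cls X A B x"
  show ?thesis
  proof (cases "y \<in> X")
    case True
    hence "(y, B y) \<in> adj X A B" by (auto simp: adj_def)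
    thus ?thesis using y by (auto simp: cls_def intro: rtrancl_into_rtrancl)
  qed (use y pairingD(4)[OF pB] in simp)
qed

lemma cls_sub: "x \<in> X \<Longrightarrow> cls X A B x \<subseteq> X"
  using cls_least[of _ x X] pairing_mem_iff[OF pA] pairing_mem_iff[OF pB] by blast

lemma cls_sym: "y \<in> cls X A B x \<Longrightarrow> x \<in> cls X A B y"
proof -
  assume "y \<in> cls X A B x"
  hence "y \<in> {z. x \<in> cls X A B z}"
  proof (rule cls_least)
    fix z assume z: "z \<in> {z. x \<in> cls X A B z}"
    have "z \<in> cls X A B (A z)" "z \<in> cls X A B (B z)"
      using cls_stepA[OF cls_refl[of "A z"]] cls_stepB[OF cls_refl[of "B z"]]
        pairingD(3)[OF pA] pairingD(3)[OF pB] by simp_all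
    thus "A z \<in> {z. x \<in> cls X A B z}" "B z \<in> {z. x \<in> cls X A B z}"
      using z by (auto simp: cls_def)
  qed (simp add: cls_refl)
  thus ?thesis by simp
qed

lemma cls_trans: "y \<in> cls X A B x \<Longrightarrow> z \<in> cls X A B y \<Longrightarrow> z \<in> cls X A B x"
  by (auto simp: cls_def)

lemma cls_eq: "y \<in> cls X A B x \<Longrightarrow> cls X A B y = cls X A B x"
  using cls_trans cls_sym by blast

lemma lps_eq: "lps X A B = cls X A B ` X"
  by (auto simp: lps_def quotient_def cls_def)

lemma finite_lps: "finite (lps X A B)"
  using fin by (simp add: lps_eq)

lemma lps_cls: "C \<in> lps X A B \<Longrightarrow> x \<in> C \<Longrightarrow> C = cls X A B x"
  by (auto simp: lps_eq cls_eq)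

lemma lps_sub: "C \<in> lps X A B \<Longrightarrow> C \<subseteq> X"
  using cls_sub by (auto simp: lps_eq)

lemma lps_nonempty: "C \<in> lps X A B \<Longrightarrow> C \<noteq> {}"
  using cls_refl by (auto simp: lps_eq)

lemma lps_disjoint: "C \<in> lps X A B \<Longrightarrow> D \<in> lps X A B \<Longrightarrow> C \<noteq> D \<Longrightarrow> C \<inter> D = {}"
  using lps_cls by blast

lemma Union_lps: "\<Union> (lps X A B) = X"
  using cls_sub cls_refl by (auto simp: lps_eq)

lemma cls_even: "x \<in> X \<Longrightarrow> even (card (cls X A B x))"
  using pairing_even_card[OF pA _ cls_sub] cls_stepA finite_subset[OF cls_sub fin] by blast

lemma walk_cls: "walk A B x n \<in> cls X A B x"
  by (induction n) (auto intro: cls_refl cls_stepA cls_stepB)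

text \<open>The least positive return time turns out to be the loop length. It is even because
  \<open>walk_odd\<close> excludes odd returns, so the walk repeats with the roles of
  \<open>A\<close> and \<open>B\<close> preserved, and its range is already closed under both
  pairings.\<close>

lemma walk_period:
  assumes x: "x \<in> X"
  shows "(\<forall>i j. walk A B x i = walk A B x j \<longleftrightarrow> i mod card (cls X A B x) = j mod card (cls X A B x))
      \<and> cls X A B x = range (walk A B x) \<and> card (cls X A B x) > 0"
proof -
  let ?w = "walk A B x"
  have "\<not> inj ?w" using walk_mem[OF x] fin finite_imageD[of ?w UNIV] finite_subset[of "range ?w" X] by auto
  then obtain i j where ij: "i < j" "?w i = ?w j" by (metis injI linorder_neqE_nat)
  have par: "even i = even j" if "?w i = ?w j" for i j
  proof (rule ccontr)
    assume "even i \<noteq> even j"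
    hence "(\<exists>m. j = i + 2 * m + 1) \<or> (\<exists>m. i = j + 2 * m + 1)" by presburger
    thus False using that walk_odd[OF x] by metis
  qed
  have down: "?w (j - i) = x" if "?w i = ?w j" "i \<le> j" for i j
    using walk_cancel[of 0 "j - i" x i] par[OF that(1)] that by simp
  define p where "p = (LEAST p. p > 0 \<and> ?w p = x)"
  have p: "p > 0 \<and> ?w p = x" unfolding p_def
    by (rule LeastI[of _ "j - i"]) (use ij down in auto)
  have least: "p \<le> q" if "q > 0" "?w q = x" for q
    unfolding p_def by (rule Least_le) (use that in auto)
  have ev: "even p" using par[of p 0] p by simp
  have per: "?w (i + p) = ?w i" for i
    using walk_shift[of 0 p x i] p ev by (simp add: add.commute)
  have per': "?w (i + p * m) = ?w i" for i m
  proof (induction m)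
    case (Suc m)
    have "i + p * Suc m = (i + p * m) + p" by simp
    then show ?case using per[of "i + p * m"] Suc by metis
  qed simp
  have wm: "?w i = ?w (i mod p)" for i
    using per'[of "i mod p" "i div p"] by simp
  have inj: "i = j" if "?w i = ?w j" "i < p" "j < p" "i \<le> j" for i j
    using down[OF that(1,4)] least[of "j - i"] that by (cases "i = j") auto
  have iff: "?w i = ?w j \<longleftrightarrow> i mod p = j mod p" for i j
  proof
    assume "?w i = ?w j"
    hence "?w (i mod p) = ?w (j mod p)" using wm by simp
    thus "i mod p = j mod p" using inj[of "i mod p" "j mod p"] inj[of "j mod p" "i mod p"] p
      by (cases "i mod p \<le> j mod p") auto
  qed (metis wm)
  have stA: "A (?w i) \<in> range ?w" for i
  proof (cases "even i")
    case True thus ?thesis by (metis walk.simps(2) rangeI)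
  next
    case False
    then obtain m where "i = Suc m" "even m" by (cases i) auto
    thus ?thesis by (simp add: pairingD(3)[OF pA])
  qed
  \<comment> \<open>For \<open>i = 0\<close> the predecessor of \<open>x\<close> is reached only by
    going once around; adding the even period supplies a predecessor without changing the
    parity.\<close>
  have stB: "B (?w i) \<in> range ?w" for i
  proof (cases "odd i")
    case True thus ?thesis by (metis walk.simps(2) rangeI)
  next
    case False
    hence "even (i + p)" "i + p > 0" using p ev by auto
    then obtain m where m: "i + p = Suc m" "odd m" by (cases "i + p") auto
    have "B (?w (i + p)) \<in> range ?w" using m by (simp add: pairingD(3)[OF pB])
    thus ?thesis using per by simp
  qed
  have cl: "cls X A B x = range ?w"
  proof
    show "cls X A B x \<subseteq> range ?w"
    proof
      fix y assume "y \<in> cls X A B x"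
      moreover have "x \<in> range ?w" using p by (metis rangeI)
      ultimately show "y \<in> range ?w" by (rule cls_least) (use stA stB in auto)
    qed
  qed (use walk_cls in auto)
  have "range ?w = ?w ` {..<p}"
  proof
    show "range ?w \<subseteq> ?w ` {..<p}" using wm p by (metis image_subsetI imageI lessThan_iff mod_less_divisor)
  qed auto
  moreover have "card (?w ` {..<p}) = p"
    by (subst card_image) (auto intro!: inj_onI simp: iff)
  ultimately have "card (cls X A B x) = p" using cl by simp
  thus ?thesis using iff cl p by simp
qed

end

text \<open>Sending the \<open>i\<close>-th point of one walk to the \<open>i\<close>-th point of
  the other is well defined as soon as the period of the target divides that of the source.
  Divisibility instead of equality also covers two-element targets, that is, colourings.\<close>

lemma equivariant_extend:
  assumes "pairings X A B" "pairings Y A' B'" "x \<in> X" "y \<in> Y"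
    and dvd: "card (cls Y A' B' y) dvd card (cls X A B x)"
  obtains \<phi> where "\<phi> x = y" "\<phi> ` cls X A B x = cls Y A' B' y"
    "\<And>z. z \<in> cls X A B x \<Longrightarrow> \<phi> (A z) = A' (\<phi> z) \<and> \<phi> (B z) = B' (\<phi> z)"
proof -
  interpret p: pairings X A B by fact
  interpret q: pairings Y A' B' by fact
  let ?w = "walk A B x" and ?v = "walk A' B' y"
  let ?p = "card (cls X A B x)" and ?q = "card (cls Y A' B' y)"
  note P = p.walk_period[OF assms(3)] and Q = q.walk_period[OF assms(4)]
  define \<phi> where "\<phi> z = ?v (SOME i. ?w i = z)" for z
  have \<phi>: "\<phi> (?w i) = ?v i" for i
  proof -
    have "?w (SOME j. ?w j = ?w i) = ?w i" by (rule someI) simp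
    hence "(SOME j. ?w j = ?w i) mod ?p = i mod ?p" using P by blast
    hence "(SOME j. ?w j = ?w i) mod ?p mod ?q = i mod ?p mod ?q" by (rule arg_cong)
    hence "(SOME j. ?w j = ?w i) mod ?q = i mod ?q" by (simp only: mod_mod_cancel[OF dvd])
    thus ?thesis using Q unfolding \<phi>_def by blast
  qed
  have ev: "even ?p" by (rule p.cls_even) fact
  show ?thesis
  proof (rule that[of \<phi>])
    show "\<phi> x = y" using \<phi>[of 0] by simp
    show "\<phi> ` cls X A B x = cls Y A' B' y"
      using P Q \<phi> by (auto simp: image_iff)
    fix z assume "z \<in> cls X A B x"
    then obtain i where i: "z = ?w i" using P by auto
    \<comment> \<open>Going once around writes \<open>z\<close> as a point of positive index, so its
      two neighbours on the loop are \<open>?w j\<close> and \<open>?w (Suc (Suc j))\<close>; the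
      parity of \<open>j\<close> tells which of them is \<open>A z\<close>.\<close>
    obtain j where j: "i + ?p = Suc j" using P by (cases "i + ?p") auto
    have z: "z = ?w (Suc j)" using P unfolding i j[symmetric] by simp
    note [simp] = pairingD(3)[OF p.pA] pairingD(3)[OF p.pB] pairingD(3)[OF q.pA] pairingD(3)[OF q.pB]
    have "?w (Suc (Suc j)) = (if even j then B else A) z" "?w j = (if even j then A else B) z"
      using z by auto
    moreover have "?v (Suc (Suc j)) = (if even j then B' else A') (\<phi> z)" "?v j = (if even j then A' else B') (\<phi> z)"
      using \<phi>[of "Suc j"] z by auto
    ultimately show "\<phi> (A z) = A' (\<phi> z) \<and> \<phi> (B z) = B' (\<phi> z)"
      using \<phi>[of j] \<phi>[of "Suc (Suc j)"] by (cases "even j") simp_all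
  qed
qed

declare restrict_id_cong [cong del]

section \<open>Restriction to unions of loops\<close>

definition closed_under :: "('a \<Rightarrow> 'a) \<Rightarrow> ('a \<Rightarrow> 'a) \<Rightarrow> 'a set \<Rightarrow> bool" where
  "closed_under A B D \<longleftrightarrow> (\<forall>x\<in>D. A x \<in> D \<and> B x \<in> D)"

lemma restrict_id_apply: "restrict_id f D x = (if x \<in> D then f x else x)"
  by (simp add: restrict_id_def)

context pairings
begin

lemma closed_Diff:
  assumes "closed_under A B D"
  shows "closed_under A B (X - D)"
  using assms pairingD(3)[OF pA] pairingD(3)[OF pB] pairing_mem_iff[OF pA] pairing_mem_iff[OF pB]
  unfolding closed_under_def by (metis Diff_iff)

lemma closed_cls: "closed_under A B (cls X A B x)"
  by (simp add: closed_under_def cls_stepA cls_stepB)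

lemma pairings_restrict:
  assumes "D \<subseteq> X" "closed_under A B D"
  shows "pairings D (restrict_id A D) (restrict_id B D)"
proof
  show "finite D" using assms fin finite_subset by blast
  show "pairing D (restrict_id A D)" "pairing D (restrict_id B D)"
    using assms pairingD[OF pA] pairingD[OF pB]
    unfolding pairing_def closed_under_def restrict_id_apply by auto
qed

lemma cls_restrict:
  assumes "D \<subseteq> X" "closed_under A B D" "z \<in> D"
  shows "cls D (restrict_id A D) (restrict_id B D) z = cls X A B z"
proof
  interpret d: pairings D "restrict_id A D" "restrict_id B D"
    using assms by (intro pairings_restrict)
  show "cls D (restrict_id A D) (restrict_id B D) z \<subseteq> cls X A B z"
    by (rule subsetI, erule d.cls_least) (auto simp: cls_refl restrict_id_apply cls_stepA cls_stepB)
  show "cls X A B z \<subseteq> cls D (restrict_id A D) (restrict_id B D) z"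
  proof
    fix y assume "y \<in> cls X A B z"
    thus "y \<in> cls D (restrict_id A D) (restrict_id B D) z"
    proof (rule cls_least)
      fix w assume w: "w \<in> cls D (restrict_id A D) (restrict_id B D) z"
      hence "w \<in> D" using d.cls_sub assms(3) by auto
      thus "A w \<in> cls D (restrict_id A D) (restrict_id B D) z"
           "B w \<in> cls D (restrict_id A D) (restrict_id B D) z"
        using d.cls_stepA[OF w] d.cls_stepB[OF w] by (simp_all add: restrict_id_apply)
    qed (rule d.cls_refl)
  qed
qed

lemma lps_restrict:
  assumes "D \<subseteq> X" "closed_under A B D"
  shows "lps D (restrict_id A D) (restrict_id B D) = cls X A B ` D"
  using pairings.lps_eq[OF pairings_restrict[OF assms]] cls_restrict[OF assms] by simp

lemma lps_split:
  assumes "D \<subseteq> X" "closed_under A B D"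
  shows "lps X A B = lps D (restrict_id A D) (restrict_id B D) \<union>
            lps (X - D) (restrict_id A (X - D)) (restrict_id B (X - D))"
    and "lps D (restrict_id A D) (restrict_id B D) \<inter>
            lps (X - D) (restrict_id A (X - D)) (restrict_id B (X - D)) = {}"
proof -
  have e: "closed_under A B (X - D)" "X - D \<subseteq> X" using closed_Diff[OF assms(2)] by auto
  show "lps X A B = lps D (restrict_id A D) (restrict_id B D) \<union>
            lps (X - D) (restrict_id A (X - D)) (restrict_id B (X - D))"
    using assms e by (simp add: lps_restrict lps_eq image_Un[symmetric] Un_absorb1)
  have "C \<subseteq> D" if "C \<in> lps D (restrict_id A D) (restrict_id B D)" for C
    using pairings.lps_sub[OF pairings_restrict[OF assms] that] .
  moreover have "C \<subseteq> X - D" "C \<noteq> {}" if "C \<in> lps (X - D) (restrict_id A (X - D)) (restrict_id B (X - D))" for C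
    using pairings.lps_sub[OF pairings_restrict[OF e(2,1)] that]
      pairings.lps_nonempty[OF pairings_restrict[OF e(2,1)] that] by auto
  ultimately show "lps D (restrict_id A D) (restrict_id B D) \<inter>
            lps (X - D) (restrict_id A (X - D)) (restrict_id B (X - D)) = {}" by blast
qed

lemma ltype_split:
  assumes "D \<subseteq> X" "closed_under A B D"
  shows "ltype X A B = ltype D (restrict_id A D) (restrict_id B D) +
            ltype (X - D) (restrict_id A (X - D)) (restrict_id B (X - D))"
proof -
  have e: "closed_under A B (X - D)" "X - D \<subseteq> X" using closed_Diff[OF assms(2)] by auto
  show ?thesis
    unfolding ltype_def lps_split(1)[OF assms]
    by (subst mset_set_Union)
       (use lps_split(2)[OF assms] pairings.finite_lps[OF pairings_restrict[OF assms]]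
         pairings.finite_lps[OF pairings_restrict[OF e(2,1)]] in auto)
qed

lemma lps_cls_restrict:
  assumes "x \<in> X" "C = cls X A B x"
  shows "lps C (restrict_id A C) (restrict_id B C) = {C}"
proof -
  have "cls X A B y = C" if "y \<in> C" for y using that cls_eq unfolding assms by blast
  moreover have "x \<in> C" using cls_refl assms by simp
  ultimately have "cls X A B ` C = {C}" by (simp add: image_constant[of x])
  thus ?thesis using lps_restrict[of C] cls_sub[OF assms(1)] closed_cls assms by auto
qed

lemma ltype_cls:
  assumes "x \<in> X" "C = cls X A B x"
  shows "ltype X A B = add_mset (card C div 2) (ltype (X - C) (restrict_id A (X - C)) (restrict_id B (X - C)))"
proof -
  have "ltype C (restrict_id A C) (restrict_id B C) = {#card C div 2#}"
    unfolding ltype_def lps_cls_restrict[OF assms] by simp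
  thus ?thesis using ltype_split[of C] cls_sub[OF assms(1)] closed_cls assms by simp
qed

lemma card_lps_cls:
  assumes "x \<in> X" "C = cls X A B x"
  shows "card (lps X A B) = Suc (card (lps (X - C) (restrict_id A (X - C)) (restrict_id B (X - C))))"
  using arg_cong[OF ltype_cls[OF assms], of size] by (simp add: ltype_def)

lemma sum_ltype: "sum_mset (ltype X A B) = card X div 2"
proof -
  have "card X = (\<Sum>C\<in>lps X A B. card C)"
    using card_Union_disjoint[of "lps X A B"] Union_lps lps_sub fin lps_disjoint
    by (metis disjoint_def finite_subset pairwise_def disjnt_def)
  also have "\<dots> = (\<Sum>C\<in>lps X A B. 2 * (card C div 2))"
    using cls_even by (intro sum.cong) (auto simp: lps_eq)
  finally have "card X = 2 * (\<Sum>C\<in>lps X A B. card C div 2)" by (simp add: sum_distrib_left)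
  thus ?thesis by (simp add: ltype_def sum_unfold_sum_mset)
qed

lemma ltype_pos: "0 \<notin># ltype X A B"
proof
  assume "0 \<in># ltype X A B"
  then obtain x where x: "x \<in> X" "card (cls X A B x) div 2 = 0"
    using finite_lps by (auto simp: ltype_def lps_eq)
  thus False using cls_even[OF x(1)] walk_period[OF x(1)] by auto
qed

text \<open>Counts the admissible images of a base point when an embedding is built loop by loop:
  any point on any loop of the required length.\<close>

lemma card_mem_ltype:
  "card {y \<in> X. card (cls X A B y) = 2 * l} = 2 * l * count (ltype X A B) l"
proof -
  let ?L = "{C \<in> lps X A B. card C = 2 * l}"
  have "{y \<in> X. card (cls X A B y) = 2 * l} = \<Union> ?L"
  proof (intro equalityI subsetI)
    fix y assume "y \<in> {y \<in> X. card (cls X A B y) = 2 * l}"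
    thus "y \<in> \<Union> ?L" using cls_refl[of y] by (auto simp: lps_eq)
  next
    fix y assume "y \<in> \<Union> ?L"
    then obtain C where "C \<in> lps X A B" "y \<in> C" "card C = 2 * l" by blast
    thus "y \<in> {y \<in> X. card (cls X A B y) = 2 * l}"
      using lps_cls[of C y] lps_sub[of C] by auto
  qed
  moreover have "card (\<Union> ?L) = (\<Sum>C\<in>?L. card C)"
    using lps_disjoint lps_sub fin
    by (intro card_Union_disjoint) (auto simp: pairwise_def disjnt_def intro: finite_subset[OF lps_sub])
  moreover have "(\<Sum>C\<in>?L. card C) = card ?L * (2 * l)" by simp
  moreover have "count (ltype X A B) l = card ?L"
  proof -
    have e: "even (card C)" if "C \<in> lps X A B" for C using that cls_even by (auto simp: lps_eq)
    have "count (ltype X A B) l = card {C \<in> lps X A B. card C div 2 = l}"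
      using finite_lps
      by (simp add: ltype_def count_image_mset' conj_commute eq_commute)
    also have "{C \<in> lps X A B. card C div 2 = l} = ?L" using e by auto
    finally show ?thesis .
  qed
  ultimately show ?thesis by simp
qed

end

text \<open>Removing one loop splits off one factor from the number of embeddings, the number of
  colourings and the sign. The pairings become the identity on the removed loop, so they are again
  pairings of the remaining set.\<close>

lemma pairings_induct [consumes 1, case_names empty step]:
  assumes "pairings X A B"
    and "\<And>A B. pairings {} A B \<Longrightarrow> P {} A B"
    and "\<And>X A B x C. pairings X A B \<Longrightarrow> x \<in> X \<Longrightarrow> C = cls X A B x \<Longrightarrow>
        pairings (X - C) (restrict_id A (X - C)) (restrict_id B (X - C)) \<Longrightarrow>
        P (X - C) (restrict_id A (X - C)) (restrict_id B (X - C)) \<Longrightarrow> P X A B"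
  shows "P X A B"
  using assms(1)
proof (induction "card X" arbitrary: X A B rule: less_induct)
  case less
  interpret pairings X A B by fact
  show ?case
  proof (cases "X = {}")
    case True
    thus ?thesis using less.prems assms(2) by simp
  next
    case False
    then obtain x where x: "x \<in> X" by auto
    let ?C = "cls X A B x"
    have p: "pairings (X - ?C) (restrict_id A (X - ?C)) (restrict_id B (X - ?C))"
      using closed_Diff[OF closed_cls] by (intro pairings_restrict) auto
    show ?thesis
    proof (rule assms(3)[OF less.prems x refl p less.hyps[OF _ p]])
      show "card (X - ?C) < card X"
        using x cls_refl[of x] fin by (intro psubset_card_mono) auto
    qed
  qed
qed

section \<open>Counting embeddings and alternating colourings\<close>

definition embs :: "'a set \<Rightarrow> ('a \<Rightarrow> 'a) \<Rightarrow> ('a \<Rightarrow> 'a) \<Rightarrow> 'b set \<Rightarrow> ('b \<Rightarrow> 'b) \<Rightarrow> ('b \<Rightarrow> 'b) \<Rightarrow> ('a \<Rightarrow> 'b) set" where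
  "embs X A B Y A' B' = {\<phi> \<in> X \<rightarrow>\<^sub>E Y. inj_on \<phi> X \<and> (\<forall>x\<in>X. \<phi> (A x) = A' (\<phi> x) \<and> \<phi> (B x) = B' (\<phi> x))}"

lemma equivariant_image_cls:
  assumes "pairings X A B" "pairings Y A' B'" "x \<in> X"
    and "\<And>z. z \<in> cls X A B x \<Longrightarrow> \<phi> (A z) = A' (\<phi> z) \<and> \<phi> (B z) = B' (\<phi> z)"
  shows "\<phi> ` cls X A B x = cls Y A' B' (\<phi> x)"
proof
  interpret p: pairings X A B by fact
  interpret q: pairings Y A' B' by fact
  show "\<phi> ` cls X A B x \<subseteq> cls Y A' B' (\<phi> x)"
  proof
    fix y assume "y \<in> \<phi> ` cls X A B x"
    then obtain z where z: "z \<in> cls X A B x" "y = \<phi> z" by auto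
    from z(1) have "z \<in> {z \<in> cls X A B x. \<phi> z \<in> cls Y A' B' (\<phi> x)}"
      by (rule p.cls_least) (use assms(4) p.cls_refl q.cls_refl p.cls_stepA p.cls_stepB q.cls_stepA q.cls_stepB in auto)
    thus "y \<in> cls Y A' B' (\<phi> x)" using z by simp
  qed
  show "cls Y A' B' (\<phi> x) \<subseteq> \<phi> ` cls X A B x"
  proof
    fix y assume "y \<in> cls Y A' B' (\<phi> x)"
    thus "y \<in> \<phi> ` cls X A B x"
    proof (rule q.cls_least)
      show "\<phi> x \<in> \<phi> ` cls X A B x" using p.cls_refl by auto
      fix w assume "w \<in> \<phi> ` cls X A B x"
      then obtain z where "z \<in> cls X A B x" "w = \<phi> z" by auto
      thus "A' w \<in> \<phi> ` cls X A B x" "B' w \<in> \<phi> ` cls X A B x"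
        using assms(4)[of z] p.cls_stepA p.cls_stepB by (metis imageI)+
    qed
  qed
qed

lemma equivariant_unique:
  assumes "pairings X A B"
    and "\<And>z. z \<in> cls X A B x \<Longrightarrow> \<phi> (A z) = A' (\<phi> z) \<and> \<phi> (B z) = B' (\<phi> z)"
    and "\<And>z. z \<in> cls X A B x \<Longrightarrow> \<psi> (A z) = A' (\<psi> z) \<and> \<psi> (B z) = B' (\<psi> z)"
    and "\<phi> x = \<psi> x" "z \<in> cls X A B x"
  shows "\<phi> z = \<psi> z"
proof -
  interpret p: pairings X A B by fact
  from assms(5) have "z \<in> {z \<in> cls X A B x. \<phi> z = \<psi> z}"
    by (rule p.cls_least) (use assms p.cls_refl p.cls_stepA p.cls_stepB in auto)
  thus ?thesis by simp
qed

text \<open>An embedding with \<open>\<phi> x = y\<close> is determined on the loop of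
  \<open>x\<close> by equivariance, maps it onto the loop of \<open>y\<close>, and by injectivity
  sends everything else outside that loop. What remains to be chosen is an embedding of the
  complements.\<close>

lemma card_fibre_embs:
  assumes "pairings X A B" "pairings Y A' B'" "x \<in> X" "y \<in> Y"
    and C: "C = cls X A B x" and D: "D = cls Y A' B' y" and cd: "card C = card D"
  shows "card {\<phi> \<in> embs X A B Y A' B'. \<phi> x = y} =
    card (embs (X - C) (restrict_id A (X - C)) (restrict_id B (X - C))
               (Y - D) (restrict_id A' (Y - D)) (restrict_id B' (Y - D)))"
    (is "card ?F = card ?E")
proof (rule bij_betw_same_card)
  interpret p: pairings X A B by fact
  interpret q: pairings Y A' B' by fact
  have CX: "C \<subseteq> X" and DY: "D \<subseteq> Y" using p.cls_sub q.cls_sub assms by auto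
  have cC: "A z \<in> C \<longleftrightarrow> z \<in> C" "B z \<in> C \<longleftrightarrow> z \<in> C" for z
    using p.cls_stepA[of _ x] p.cls_stepB[of _ x] pairingD(3)[OF p.pA] pairingD(3)[OF p.pB] unfolding C by metis+
  have cD: "A' z \<in> D \<longleftrightarrow> z \<in> D" "B' z \<in> D \<longleftrightarrow> z \<in> D" for z
    using q.cls_stepA[of _ y] q.cls_stepB[of _ y] pairingD(3)[OF q.pA] pairingD(3)[OF q.pB] unfolding D by metis+
  have cX: "A z \<in> X \<longleftrightarrow> z \<in> X" "B z \<in> X \<longleftrightarrow> z \<in> X" for z
    by (simp_all add: pairing_mem_iff[OF p.pA] pairing_mem_iff[OF p.pB])
  have xC: "x \<in> C" using C p.cls_refl by simp
  have finC: "finite C" using CX p.fin finite_subset by blast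
  have img: "\<phi> ` C = D" if "\<phi> \<in> ?F" for \<phi>
    using equivariant_image_cls[OF assms(1-3), of \<phi>] that CX unfolding C D embs_def by auto
  have "card (cls Y A' B' y) dvd card (cls X A B x)" using cd C D by simp
  from equivariant_extend[OF assms(1-4) this] obtain \<psi> where
    \<psi>: "\<psi> x = y" "\<psi> ` C = D" "\<And>z. z \<in> C \<Longrightarrow> \<psi> (A z) = A' (\<psi> z) \<and> \<psi> (B z) = B' (\<psi> z)"
    using C D by metis
  have inj\<psi>: "inj_on \<psi> C" using \<psi>(2) cd finC by (metis eq_card_imp_inj_on)
  show "bij_betw (\<lambda>\<phi>. restrict \<phi> (X - C)) ?F ?E"
  proof (rule bij_betw_byWitness[where f' = "\<lambda>\<phi> z. if z \<in> C then \<psi> z else \<phi> z"])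
    show "\<forall>\<phi>\<in>?F. (\<lambda>z. if z \<in> C then \<psi> z else restrict \<phi> (X - C) z) = \<phi>"
    proof (intro ballI ext)
      fix \<phi> z assume f: "\<phi> \<in> ?F"
      have "\<phi> z = \<psi> z" if "z \<in> C"
        using equivariant_unique[OF assms(1), of x \<phi> A' B' \<psi> z] f that \<psi> CX unfolding C[symmetric]
        by (auto simp: embs_def)
      thus "(if z \<in> C then \<psi> z else restrict \<phi> (X - C) z) = \<phi> z"
        using f by (auto simp: embs_def PiE_def extensional_def)
    qed
    show "\<forall>\<phi>\<in>?E. restrict (\<lambda>z. if z \<in> C then \<psi> z else \<phi> z) (X - C) = \<phi>"
      by (auto simp: embs_def PiE_def extensional_def fun_eq_iff)
    show "(\<lambda>\<phi>. restrict \<phi> (X - C)) ` ?F \<subseteq> ?E"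
    proof (intro image_subsetI)
      fix \<phi> assume f: "\<phi> \<in> ?F"
      have out: "\<phi> z \<in> Y - D" if "z \<in> X - C" for z
      proof -
        have "\<phi> z \<noteq> \<phi> w" if "w \<in> C" for w
          using f that \<open>z \<in> X - C\<close> CX unfolding embs_def inj_on_def by blast
        hence "\<phi> z \<notin> \<phi> ` C" by blast
        thus ?thesis using that f img[OF f] by (auto simp: embs_def PiE_def)
      qed
      thus "restrict \<phi> (X - C) \<in> ?E"
        using f unfolding embs_def
        by (auto simp: restrict_id_apply inj_on_def cC cX)
    qed
    show "(\<lambda>\<phi> z. if z \<in> C then \<psi> z else \<phi> z) ` ?E \<subseteq> ?F"
    proof (intro image_subsetI)
      fix \<phi> assume f: "\<phi> \<in> ?E"
      let ?h = "\<lambda>z. if z \<in> C then \<psi> z else \<phi> z"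
      have h: "\<phi> z \<in> Y - D" if "z \<in> X - C" for z using f that by (auto simp: embs_def PiE_def)
      have "?h \<in> X \<rightarrow>\<^sub>E Y"
      proof (rule PiE_I)
        show "?h z \<in> Y" if "z \<in> X" for z using that h[of z] DY \<psi>(2) by auto
        show "?h z = undefined" if "z \<notin> X" for z
          using that f CX by (auto simp: embs_def PiE_def extensional_def)
      qed
      moreover have "inj_on ?h X"
      proof (rule inj_onI)
        fix u v assume uv: "u \<in> X" "v \<in> X" "?h u = ?h v"
        have "inj_on \<phi> (X - C)" using f by (simp add: embs_def)
        moreover have "?h w \<in> D \<longleftrightarrow> w \<in> C" if "w \<in> X" for w using that h[of w] \<psi>(2) by auto
        hence "u \<in> C \<longleftrightarrow> v \<in> C" using uv by metis
        ultimately show "u = v" using uv inj\<psi>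
          by (cases "u \<in> C") (auto dest: inj_onD)
      qed
      moreover have "?h (A z) = A' (?h z) \<and> ?h (B z) = B' (?h z)" if "z \<in> X" for z
      proof (cases "z \<in> C")
        case False
        hence "\<phi> (restrict_id A (X - C) z) = restrict_id A' (Y - D) (\<phi> z) \<and> \<phi> (restrict_id B (X - C) z) = restrict_id B' (Y - D) (\<phi> z)"
          using f that by (simp add: embs_def)
        thus ?thesis using False that h[of z] by (simp add: cC)
      qed (use \<psi>(3) cC in simp)
      moreover have "?h x = y" using xC \<psi>(1) by simp
      ultimately show "?h \<in> ?F" by (simp add: embs_def)
    qed
  qed
qed

lemma finite_embs: "finite X \<Longrightarrow> finite Y \<Longrightarrow> finite (embs X A B Y A' B')"
  unfolding embs_def by (rule finite_subset[of _ "X \<rightarrow>\<^sub>E Y"]) (auto intro: finite_PiE)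

lemma prod_falling_Suc: "(\<Prod>j<Suc c. m - j) = m * (\<Prod>j<c. m - 1 - j)" for m :: nat
  by (simp only: prod.lessThan_Suc_shift) simp

text \<open>The subtraction truncates, so the product vanishes if some part occurs more often in the type of the
  source than in that of the target.\<close>
lemma card_embs:
  assumes "pairings X A B" "pairings Y A' B'" "finite I" "set_mset (ltype X A B) \<subseteq> I"
  shows "card (embs X A B Y A' B') =
    (\<Prod>i\<in>I. (2 * i) ^ count (ltype X A B) i * (\<Prod>j<count (ltype X A B) i. count (ltype Y A' B') i - j))"
  using assms(1,2,4)
proof (induction arbitrary: Y A' B' rule: pairings_induct)
  case (empty A B)
  have "embs {} A B Y A' B' = {\<lambda>x. undefined}" by (auto simp: embs_def)
  thus ?case by (simp add: ltype_def lps_def)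
next
  case (step X A B x C)
  interpret p: pairings X A B by fact
  interpret q: pairings Y A' B' by fact
  define l where "l = card C div 2"
  have cC: "card C = 2 * l" using p.cls_even[OF step.hyps(2)] by (simp add: l_def step.hyps(3))
  let ?X' = "X - C" let ?A = "restrict_id A ?X'" let ?B = "restrict_id B ?X'"
  let ?T = "ltype X A B" let ?T' = "ltype ?X' ?A ?B" let ?M = "ltype Y A' B'"
  have T: "?T = add_mset l ?T'" using p.ltype_cls[OF step.hyps(2,3)] l_def by simp
  let ?S = "{y \<in> Y. card (cls Y A' B' y) = 2 * l}"
  let ?g = "\<lambda>T M i. (2 * i) ^ count T i * (\<Prod>j<count T i. count M i - j)"
  have lI: "l \<in> I" using step.prems(2) T by auto
  \<comment> \<open>The base point can only go to a point on a loop of the same length, since an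
    embedding maps loops bijectively onto loops.\<close>
  have "embs X A B Y A' B' = (\<Union>y\<in>?S. {\<phi> \<in> embs X A B Y A' B'. \<phi> x = y})" (is "?E = ?U")
  proof
    show "?E \<subseteq> ?U"
    proof
      fix \<phi> assume f: "\<phi> \<in> ?E"
      have "\<phi> ` C = cls Y A' B' (\<phi> x)"
        unfolding step.hyps(3)
        by (rule equivariant_image_cls[OF step.hyps(1) step.prems(1) step.hyps(2)])
           (use f p.cls_sub[OF step.hyps(2)] in \<open>auto simp: embs_def\<close>)
      moreover have "card (\<phi> ` C) = card C"
        using f p.cls_sub step.hyps(2,3) by (intro card_image) (auto simp: embs_def intro: inj_on_subset)
      ultimately show "\<phi> \<in> ?U" using f step.hyps(2) cC by (auto simp: embs_def)
    qed
  qed auto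
  hence "card ?E = card ?U" by (rule arg_cong)
  also have "\<dots> = (\<Sum>y\<in>?S. card {\<phi> \<in> ?E. \<phi> x = y})"
    using q.fin finite_embs[OF p.fin q.fin] by (intro card_UN_disjoint) auto
  also have "\<dots> = (\<Sum>y\<in>?S. \<Prod>i\<in>I. ?g ?T' (?M - {#l#}) i)"
  proof (rule sum.cong)
    fix y assume y: "y \<in> ?S"
    let ?D = "cls Y A' B' y"
    have "card {\<phi> \<in> ?E. \<phi> x = y} = card (embs ?X' ?A ?B (Y - ?D) (restrict_id A' (Y - ?D)) (restrict_id B' (Y - ?D)))"
      using card_fibre_embs[OF step.hyps(1) step.prems(1) step.hyps(2) _ step.hyps(3) refl] y cC by auto
    also have "\<dots> = (\<Prod>i\<in>I. ?g ?T' (ltype (Y - ?D) (restrict_id A' (Y - ?D)) (restrict_id B' (Y - ?D))) i)"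
    proof (rule step.IH)
      show "pairings (Y - ?D) (restrict_id A' (Y - ?D)) (restrict_id B' (Y - ?D))"
        using q.closed_Diff[OF q.closed_cls] by (intro q.pairings_restrict) auto
    qed (use step.prems(2) T in auto)
    also have "ltype (Y - ?D) (restrict_id A' (Y - ?D)) (restrict_id B' (Y - ?D)) = ?M - {#l#}"
      using q.ltype_cls[of y ?D] y by simp
    finally show "card {\<phi> \<in> ?E. \<phi> x = y} = (\<Prod>i\<in>I. ?g ?T' (?M - {#l#}) i)" .
  qed simp
  \<comment> \<open>Every admissible \<open>y\<close> leaves the same target type
    \<open>?M - {#l#}\<close>, so the sum is a multiple of one product. Only the factor at
    \<open>l\<close> differs from the claim, and \<open>2 * l * count ?M l\<close> supplies the
    missing power and the head of the falling product.\<close>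
  also have "\<dots> = 2 * l * count ?M l * (\<Prod>i\<in>I. ?g ?T' (?M - {#l#}) i)"
    using q.card_mem_ltype by simp
  also have "\<dots> = 2 * l * count ?M l * (?g ?T' (?M - {#l#}) l * (\<Prod>i\<in>I - {l}. ?g ?T' (?M - {#l#}) i))"
    using lI assms(3) by (simp add: prod.remove)
  also have "\<dots> = ?g ?T ?M l * (\<Prod>i\<in>I - {l}. ?g ?T' (?M - {#l#}) i)"
    unfolding T count_add_mset by (simp add: prod_falling_Suc del: prod.lessThan_Suc)
  also have "(\<Prod>i\<in>I - {l}. ?g ?T' (?M - {#l#}) i) = (\<Prod>i\<in>I - {l}. ?g ?T ?M i)"
    by (rule prod.cong) (auto simp: T)
  also have "?g ?T ?M l * \<dots> = (\<Prod>i\<in>I. ?g ?T ?M i)"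
    using lI assms(3) by (simp add: prod.remove)
  finally show ?case .
qed

section \<open>Alternating colourings and the sign of a pair of pairings\<close>

definition alts :: "'a set \<Rightarrow> ('a \<Rightarrow> 'a) \<Rightarrow> ('a \<Rightarrow> 'a) \<Rightarrow> ('a \<Rightarrow> bool) set" where
  "alts X A B = {e \<in> X \<rightarrow>\<^sub>E UNIV. \<forall>x\<in>X. e (A x) = (\<not> e x) \<and> e (B x) = (\<not> e x)}"

text \<open>An alternating colouring is an equivariant map into the two-element set on which both
  pairings are negation. Since loops have even length, either colour of a base point extends along
  its loop, in exactly one way.\<close>

lemma card_alts:
  assumes "pairings X A B"
  shows "card (alts X A B) = 2 ^ card (lps X A B)"
  using assms
proof (induction rule: pairings_induct)
  case (empty A B)
  have "alts {} A B = {\<lambda>x. undefined}" by (auto simp: alts_def)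
  thus ?case by (simp add: lps_def)
next
  case (step X A B x C)
  interpret p: pairings X A B by fact
  let ?X' = "X - C" let ?A = "restrict_id A ?X'" let ?B = "restrict_id B ?X'"
  have q: "pairings (UNIV :: bool set) Not Not"
    by unfold_locales (auto simp: pairing_def)
  interpret q: pairings "UNIV :: bool set" Not Not by (rule q)
  have CX: "C \<subseteq> X" and xC: "x \<in> C" using p.cls_sub p.cls_refl step.hyps by auto
  have cC: "A z \<in> C \<longleftrightarrow> z \<in> C" "B z \<in> C \<longleftrightarrow> z \<in> C" for z
    using p.cls_stepA[of _ x] p.cls_stepB[of _ x] pairingD(3)[OF p.pA] pairingD(3)[OF p.pB]
    unfolding step.hyps(3) by metis+
  have cX: "A z \<in> X \<longleftrightarrow> z \<in> X" "B z \<in> X \<longleftrightarrow> z \<in> X" for z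
    by (simp_all add: pairing_mem_iff[OF p.pA] pairing_mem_iff[OF p.pB])
  have "card (cls UNIV Not Not b) = 2" for b
  proof -
    have "{b, \<not> b} \<subseteq> cls UNIV Not Not b" using q.cls_refl q.cls_stepA by auto
    moreover have "{b, \<not> b} = UNIV" by auto
    ultimately have "cls UNIV Not Not b = UNIV" by auto
    thus ?thesis by simp
  qed
  hence dvd: "card (cls UNIV Not Not b) dvd card (cls X A B x)" for b
    using p.cls_even[OF step.hyps(2)] by simp
  have "\<exists>\<psi>. \<psi> x = b \<and> (\<forall>z\<in>C. \<psi> (A z) = (\<not> \<psi> z) \<and> \<psi> (B z) = (\<not> \<psi> z))" for b
    using equivariant_extend[OF step.hyps(1) q step.hyps(2) UNIV_I dvd[of b]] step.hyps(3) by metis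
  then obtain \<psi> where \<psi>: "\<psi> b x = b" "z \<in> C \<Longrightarrow> \<psi> b (A z) = (\<not> \<psi> b z) \<and> \<psi> b (B z) = (\<not> \<psi> b z)" for b z
    by metis
  let ?j = "\<lambda>(b, e) z. if z \<in> C then \<psi> b z else e z"
  have "bij_betw (\<lambda>e. (e x, restrict e ?X')) (alts X A B) (UNIV \<times> alts ?X' ?A ?B)"
  proof (rule bij_betw_byWitness[where f' = ?j])
    show "\<forall>e\<in>alts X A B. ?j (e x, restrict e ?X') = e"
    proof (intro ballI ext)
      fix e z assume e: "e \<in> alts X A B"
      have "\<psi> (e x) z = e z" if "z \<in> C"
      proof (rule equivariant_unique[OF step.hyps(1), of x "\<psi> (e x)" Not Not e z])
        show "\<psi> (e x) x = e x" using \<psi>(1) .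
        show "z \<in> cls X A B x" using that step.hyps(3) by simp
        show "\<psi> (e x) (A w) = (\<not> \<psi> (e x) w) \<and> \<psi> (e x) (B w) = (\<not> \<psi> (e x) w)" if "w \<in> cls X A B x" for w
          using \<psi>(2) that step.hyps(3) by blast
        show "e (A w) = (\<not> e w) \<and> e (B w) = (\<not> e w)" if "w \<in> cls X A B x" for w
          using e that step.hyps(3) CX unfolding alts_def by blast
      qed
      thus "?j (e x, restrict e ?X') z = e z"
        using e by (auto simp: alts_def PiE_def extensional_def)
    qed
    show "\<forall>be\<in>(UNIV :: bool set) \<times> alts ?X' ?A ?B. (?j be x, restrict (?j be) ?X') = be"
      using xC \<psi>(1) by (auto simp: alts_def PiE_def extensional_def fun_eq_iff)
    show "(\<lambda>e. (e x, restrict e ?X')) ` alts X A B \<subseteq> UNIV \<times> alts ?X' ?A ?B"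
      using cC cX by (auto simp: alts_def)
    show "?j ` (UNIV \<times> alts ?X' ?A ?B) \<subseteq> alts X A B"
    proof (intro image_subsetI)
      fix be assume "be \<in> (UNIV :: bool set) \<times> alts ?X' ?A ?B"
      then obtain b e where be: "be = (b, e)" "e \<in> alts ?X' ?A ?B" by auto
      have "e (A z) = (\<not> e z) \<and> e (B z) = (\<not> e z)" if "z \<in> X - C" for z
        using be(2) that by (simp add: alts_def)
      moreover have "e z = undefined" if "z \<notin> X - C" for z
        using be(2) that by (auto simp: alts_def PiE_def extensional_def)
      ultimately show "?j be \<in> alts X A B"
        using \<psi>(2)[of _ b] CX unfolding be(1) by (auto simp: alts_def cC PiE_def extensional_def)
    qed
  qed
  hence "card (alts X A B) = 2 * card (alts ?X' ?A ?B)"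
    by (subst bij_betw_same_card) (auto simp: card_cartesian_product)
  thus ?case using step.IH p.card_lps_cls[OF step.hyps(2,3)] by simp
qed

lemma sign_cycle_of_list:
  "distinct cs \<Longrightarrow> sign (cycle_of_list cs) = (- 1) ^ (length cs - 1)"
proof (induction cs rule: cycle_of_list.induct)
  case (1 i j cs)
  have "sign (cycle_of_list (i # j # cs)) = sign (swap i j) * sign (cycle_of_list (j # cs))"
    unfolding cycle_of_list.simps by (rule sign_compose) (simp_all add: permutation_swap_id permutation_of_cycle)
  thus ?case using 1 by (simp add: sign_swap_id del: cycle_of_list.simps)
qed simp_all

text \<open>A loop of length \<open>2l\<close> contributes one cycle of length \<open>l\<close>, so the sign of this permutation is the sign of
  the pair of pairings, for every alternating colouring \<open>e\<close>.\<close>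
definition halfperm :: "'a set \<Rightarrow> ('a \<Rightarrow> 'a) \<Rightarrow> ('a \<Rightarrow> 'a) \<Rightarrow> ('a \<Rightarrow> bool) \<Rightarrow> 'a \<Rightarrow> 'a" where
  "halfperm X A B e = (\<lambda>x. if x \<in> X \<and> \<not> e x then B (A x) else x)"

lemma halfperm_permutes:
  assumes "pairings X A B" "\<And>x. x \<in> X \<Longrightarrow> e (A x) = (\<not> e x) \<and> e (B x) = (\<not> e x)"
  shows "halfperm X A B e permutes {x \<in> X. \<not> e x}"
proof -
  interpret p: pairings X A B by fact
  have "finite {x \<in> X. \<not> e x}" using p.fin by simp
  moreover have "halfperm X A B e ` {x \<in> X. \<not> e x} \<subseteq> {x \<in> X. \<not> e x}"
    using assms(2) pairing_mem_iff[OF p.pA] pairing_mem_iff[OF p.pB]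
    by (auto simp: halfperm_def)
  moreover have "inj_on (halfperm X A B e) {x \<in> X. \<not> e x}"
    by (auto simp: halfperm_def inj_on_def pairing_eq_iff[OF p.pA] pairing_eq_iff[OF p.pB])
  ultimately have "bij_betw (halfperm X A B e) {x \<in> X. \<not> e x} {x \<in> X. \<not> e x}"
    by (simp add: bij_betw_def endo_inj_surj)
  thus ?thesis by (rule bij_imp_permutes) (auto simp: halfperm_def)
qed

text \<open>Each loop has half-length at least one; hence the exponent of the sign is a genuine
  difference.\<close>

lemma card_lps_le:
  assumes "pairings X A B"
  shows "card (lps X A B) \<le> card X div 2"
proof -
  interpret p: pairings X A B by fact
  have "size M \<le> sum_mset M" if "0 \<notin># M" for M :: "nat multiset"
    using that by (induction M) auto
  from this[OF p.ltype_pos] show ?thesis using p.sum_ltype by (simp add: ltype_def)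
qed

lemma sign_halfperm:
  assumes "pairings X A B" "\<And>x. x \<in> X \<Longrightarrow> e (A x) = (\<not> e x) \<and> e (B x) = (\<not> e x)"
  shows "sign (halfperm X A B e) = (- 1) ^ (card X div 2 - card (lps X A B))"
  using assms
proof (induction rule: pairings_induct)
  case (empty A B)
  have "halfperm {} A B e = id" by (auto simp: halfperm_def)
  thus ?case by (simp add: lps_def)
next
  case (step X A B x C)
  interpret p: pairings X A B by fact
  let ?X' = "X - C" let ?A = "restrict_id A ?X'" let ?B = "restrict_id B ?X'"
  interpret r: pairings ?X' ?A ?B by fact
  have CX: "C \<subseteq> X" and xC: "x \<in> C" using p.cls_sub p.cls_refl step.hyps by auto
  have cC: "A z \<in> C \<longleftrightarrow> z \<in> C" "B z \<in> C \<longleftrightarrow> z \<in> C" for z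
    using p.cls_stepA[of _ x] p.cls_stepB[of _ x] pairingD(3)[OF p.pA] pairingD(3)[OF p.pB]
    unfolding step.hyps(3) by metis+
  have cX: "A z \<in> X \<longleftrightarrow> z \<in> X" "B z \<in> X \<longleftrightarrow> z \<in> X" for z
    by (simp_all add: pairing_mem_iff[OF p.pA] pairing_mem_iff[OF p.pB])
  have e': "e (?A z) = (\<not> e z) \<and> e (?B z) = (\<not> e z)" if "z \<in> ?X'" for z
    using step.prems that by simp
  have IH: "sign (halfperm ?X' ?A ?B e) = (- 1) ^ (card ?X' div 2 - card (lps ?X' ?A ?B))"
    using e' by (rule step.IH)
  \<comment> \<open>Starting the walk at a point coloured \<open>False\<close> makes the even
    indices exactly the points of this loop on which the half permutation acts.\<close>
  define y where "y = (if e x then A x else x)"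
  have y: "y \<in> X" "\<not> e y" "y \<in> C"
    using step.hyps(2) step.prems[of x] cX xC cC by (auto simp: y_def)
  have Cy: "C = cls X A B y" using p.lps_cls[of C y] y step.hyps by (auto simp: p.lps_eq)
  define m where "m = card C div 2"
  have cm: "card C = 2 * m" using p.cls_even[OF y(1)] by (simp add: m_def Cy)
  let ?w = "walk A B y"
  note W = p.walk_period[OF y(1), folded Cy, unfolded cm]
  have ew: "e (?w i) = odd i" for i
  proof (induction i)
    case (Suc i)
    thus ?case using step.prems[OF p.walk_mem[OF y(1), of i]] by auto
  qed (use y in simp)
  let ?cs = "map (\<lambda>i. ?w (2 * i)) [0..<m]"
  have dist: "distinct ?cs"
    unfolding distinct_map
  proof (intro conjI inj_onI)
    fix i j assume ij: "i \<in> set [0..<m]" "j \<in> set [0..<m]" "?w (2 * i) = ?w (2 * j)"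
    hence "(2 * i) mod (2 * m) = (2 * j) mod (2 * m)" using W by blast
    thus "i = j" using ij by simp
  qed simp
  have m0: "m > 0" using W by simp
  have set_cs: "z \<in> set ?cs" if z: "z \<in> C" "\<not> e z" for z
  proof -
    obtain i where i: "z = ?w i" using z W by auto
    have "even i" using ew[of i] z i by simp
    have "z = ?w (i mod (2 * m))" using W i by simp
    moreover have "i mod (2 * m) = 2 * (i div 2 mod m)" using \<open>even i\<close> by (metis dvd_mult_div_cancel mult_mod_right)
    ultimately show ?thesis using m0 by auto
  qed
  \<comment> \<open>Two steps of the walk amount to \<open>B \<circ> A\<close>, so on this loop the
    half permutation advances the even positions cyclically by one.\<close>
  have cyc: "cycle_of_list ?cs (?w (2 * i)) = B (A (?w (2 * i)))" if "i < m" for i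
  proof -
    have "map (cycle_of_list ?cs) ?cs = rotate1 ?cs"
      using cyclic_rotation[OF dist, of 1] by simp
    hence "cycle_of_list ?cs (?cs ! i) = rotate1 ?cs ! i" using that by (metis length_map length_upt minus_nat.diff_0 nth_map)
    also have "\<dots> = ?cs ! (Suc i mod m)" using that by (simp add: nth_rotate1)
    also have "\<dots> = ?w (2 * (Suc i mod m))" using m0 by simp
    also have "\<dots> = ?w (2 * Suc i)" using W by (metis mod_mod_trivial mult_mod_right)
    finally show ?thesis using that by simp
  qed
  have "halfperm X A B e = cycle_of_list ?cs \<circ> halfperm ?X' ?A ?B e"
  proof
    fix z
    show "halfperm X A B e z = (cycle_of_list ?cs \<circ> halfperm ?X' ?A ?B e) z"
    proof (cases "z \<in> C \<and> \<not> e z")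
      case True
      then obtain i where "i < m" "z = ?w (2 * i)" using set_cs by force
      thus ?thesis using True cyc CX by (auto simp: halfperm_def)
    next
      case False
      have cs: "set ?cs \<subseteq> {z \<in> C. \<not> e z}" using ew p.walk_cls[of y] Cy by auto
      show ?thesis
      proof (cases "z \<in> X \<and> \<not> e z")
        case True
        hence z: "z \<in> ?X'" using False by simp
        hence "B (A z) \<notin> C" using cC by simp
        hence "cycle_of_list ?cs (B (A z)) = B (A z)" using cs by (intro id_outside_supp) auto
        thus ?thesis using z True by (simp add: halfperm_def cC cX)
      next
        case False
        hence "cycle_of_list ?cs z = z" using cs CX by (intro id_outside_supp) auto
        thus ?thesis using False by (auto simp: halfperm_def)
      qed
    qed
  qed
  moreover have "permutation (halfperm ?X' ?A ?B e)"
  proof -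
    have "finite {z \<in> ?X'. \<not> e z}" by (rule finite_subset[OF _ r.fin]) auto
    thus ?thesis using halfperm_permutes[OF r.pairings_axioms e'] unfolding permutation_permutes by blast
  qed
  ultimately have "sign (halfperm X A B e) = (- 1) ^ (m - 1) * sign (halfperm ?X' ?A ?B e)"
    using sign_cycle_of_list[OF dist] by (simp add: sign_compose permutation_of_cycle)
  also have "\<dots> = (- 1) ^ (m - 1 + (card ?X' div 2 - card (lps ?X' ?A ?B)))"
    by (simp add: IH power_add)
  \<comment> \<open>The removed loop contributes \<open>m - 1\<close> to the exponent; the bound
    \<open>card_lps_le\<close> for the remaining loops allows the subtractions to be
    combined.\<close>
  also have "m - 1 + (card ?X' div 2 - card (lps ?X' ?A ?B)) = card X div 2 - card (lps X A B)"
  proof -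
    have "card X = card ?X' + card C" using CX p.fin by (metis card_Diff_subset card_mono finite_subset le_add_diff_inverse2)
    hence "card X div 2 = card ?X' div 2 + m" using cm by simp
    thus ?thesis using p.card_lps_cls[OF step.hyps(2,3)] card_lps_le[OF r.pairings_axioms] m0 by simp
  qed
  finally show ?case .
qed

section \<open>Uniqueness of Jack polynomials\<close>

lemma is_partition_unique:
  assumes "is_partition \<rho>" "is_partition \<sigma>" "mset \<rho> = mset \<sigma>"
  shows "\<rho> = \<sigma>"
proof -
  have "sorted (rev \<rho>)" "sorted (rev \<sigma>)"
    using assms(1,2) by (simp_all add: is_partition_def sorted_wrt_rev)
  moreover have "mset (rev \<rho>) = mset (rev \<sigma>)" using assms(3) by simp
  ultimately have "rev \<rho> = rev \<sigma>" by (metis properties_for_sort)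
  thus ?thesis by simp
qed

lemma partition_of_multiset:
  assumes "0 \<notin># M"
  obtains \<rho> where "\<rho> \<in> partitions_of (sum_mset M)" "mset \<rho> = M"
proof -
  obtain xs where xs: "mset xs = M" using ex_mset by blast
  let ?r = "rev (sort xs)"
  have "sorted_wrt (\<ge>) ?r" by (simp add: sorted_wrt_rev)
  moreover have "0 \<notin> set ?r" using assms xs by auto
  moreover have "sum_list ?r = sum_mset M" using xs by (metis mset_rev mset_sort sum_mset_sum_list)
  ultimately show ?thesis using that[of ?r] xs by (simp add: partitions_of_def is_partition_def)
qed

lemma partitions_of_mset: "\<rho> \<in> partitions_of n \<Longrightarrow> \<sigma> \<in> partitions_of n \<Longrightarrow> mset \<rho> = mset \<sigma> \<longleftrightarrow> \<rho> = \<sigma>"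
  using is_partition_unique by (auto simp: partitions_of_def)

lemma finite_partitions_of: "finite (partitions_of n)"
proof (rule finite_subset)
  show "partitions_of n \<subseteq> {xs. set xs \<subseteq> {..n} \<and> length xs \<le> n}"
  proof
    fix xs assume xs: "xs \<in> partitions_of n"
    have "length xs \<le> sum_list xs" if "0 \<notin> set xs" for xs :: "nat list"
      using that by (induction xs) auto
    thus "xs \<in> {xs. set xs \<subseteq> {..n} \<and> length xs \<le> n}"
      using xs member_le_sum_list by (auto simp: partitions_of_def is_partition_def)
  qed
  show "finite {xs. set xs \<subseteq> {..n} \<and> length xs \<le> n}"
    by (rule finite_lists_length_le) simp
qed

lemma dominated_refl: "dominated \<mu> \<mu>"
  by (simp add: dominated_def)

lemma dominated_trans: "dominated \<mu> \<nu> \<Longrightarrow> dominated \<nu> \<kappa> \<Longrightarrow> dominated \<mu> \<kappa>"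
  unfolding dominated_def by (metis order_trans)

lemma take_sums_unique:
  assumes "0 \<notin> set \<mu>" "0 \<notin> set \<nu>" "\<And>i. sum_list (take i \<mu>) = sum_list (take i (\<nu> :: nat list))"
  shows "\<mu> = \<nu>"
  using assms
proof (induction \<mu> arbitrary: \<nu>)
  case Nil
  thus ?case using Nil.prems(3)[of 1] by (cases \<nu>) auto
next
  case (Cons a \<mu>)
  then obtain b \<nu>' where \<nu>: "\<nu> = b # \<nu>'" using Cons.prems(3)[of 1] by (cases \<nu>) auto
  have "a = b" using Cons.prems(3)[of 1] \<nu> by simp
  moreover have "sum_list (take i \<mu>) = sum_list (take i \<nu>')" for i
    using Cons.prems(3)[of "Suc i"] \<nu> \<open>a = b\<close> by simp
  ultimately show ?case using Cons \<nu> by simp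
qed

lemma dominated_antisym:
  assumes "\<mu> \<in> partitions_of n" "\<nu> \<in> partitions_of n" "dominated \<mu> \<nu>" "dominated \<nu> \<mu>"
  shows "\<mu> = \<nu>"
  by (rule take_sums_unique) (use assms in \<open>auto simp: partitions_of_def is_partition_def dominated_def intro: antisym\<close>)

text \<open>Numbers the loops by the positions in \<open>\<rho>\<close>, because
  \<open>p_to_m\<close> counts functions on positions and thereby distinguishes equal parts.\<close>

lemma bij_betw_of_image_mset:
  assumes "finite L" "image_mset h (mset_set L) = mset \<rho>"
  obtains \<beta> where "bij_betw \<beta> {0..<length \<rho>} L" "\<And>i. i < length \<rho> \<Longrightarrow> h (\<beta> i) = \<rho> ! i"
proof -
  obtain ls where set: "set ls = L" and dist: "distinct ls" using finite_distinct_list[OF assms(1)] by blast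
  have ls: "mset ls = mset_set L" using mset_set_set[OF dist] set by simp
  have "mset \<rho> = mset (map h ls)" using assms(2) ls by simp
  from mset_eq_permutation[OF this] obtain p where
    p: "p permutes {..<length (map h ls)}" "permute_list p (map h ls) = \<rho>" by metis
  have len: "length ls = length \<rho>" using p(2) by auto
  have "bij_betw (\<lambda>i. ls ! (p i)) {0..<length \<rho>} L"
  proof -
    have "bij_betw p {..<length ls} {..<length ls}" using p(1) by (simp add: permutes_imp_bij)
    moreover have "bij_betw ((!) ls) {..<length ls} L" using dist set by (auto intro: bij_betw_nth)
    ultimately show ?thesis using bij_betw_trans len by (fastforce simp: o_def atLeast0LessThan)
  qed
  moreover have "h (ls ! (p i)) = \<rho> ! i" if "i < length \<rho>" for i
  proof -
    have "p i < length ls" using p(1) that len permutes_in_image[OF p(1), of i] by simp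
    thus ?thesis using p that len by (metis length_map nth_map permute_list_nth)
  qed
  ultimately show ?thesis using that by blast
qed

section \<open>Monomial coefficients of power sums via loop-constant colourings\<close>

definition mono_fills :: "'a set \<Rightarrow> ('a \<Rightarrow> 'a) \<Rightarrow> ('a \<Rightarrow> 'a) \<Rightarrow> nat list \<Rightarrow> ('a \<Rightarrow> nat) set" where
  "mono_fills X A B \<mu> = {g \<in> X \<rightarrow>\<^sub>E {0..<length \<mu>}. (\<forall>x\<in>X. g (A x) = g x \<and> g (B x) = g x) \<and>
      (\<forall>j<length \<mu>. card {x \<in> X. g x = j} = 2 * \<mu> ! j)}"

text \<open>A map from the positions of \<open>\<rho>\<close> to those of \<open>\<mu>\<close> is
  the same as a colouring that is constant on loops. A loop of half-length \<open>r\<close> has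
  \<open>2 * r\<close> points, whence the doubled content in \<open>mono_fills\<close>.\<close>

lemma p_to_m_eq:
  assumes "pairings X A B" "ltype X A B = mset \<rho>"
  shows "p_to_m \<rho> \<mu> = card (mono_fills X A B \<mu>)"
proof -
  interpret p: pairings X A B by fact
  obtain \<beta> where \<beta>: "bij_betw \<beta> {0..<length \<rho>} (lps X A B)" "\<And>i. i < length \<rho> \<Longrightarrow> card (\<beta> i) div 2 = \<rho> ! i"
    using bij_betw_of_image_mset[OF p.finite_lps assms(2)[unfolded ltype_def]] by blast
  define idx where "idx x = inv_into {0..<length \<rho>} \<beta> (cls X A B x)" for x
  have \<beta>l: "\<beta> i \<in> lps X A B" if "i < length \<rho>" for i using \<beta>(1) that by (auto simp: bij_betw_def)
  have idx: "idx x < length \<rho>" "\<beta> (idx x) = cls X A B x" if "x \<in> X" for x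
  proof -
    have "cls X A B x \<in> \<beta> ` {0..<length \<rho>}" using \<beta>(1) that by (auto simp: bij_betw_def p.lps_eq)
    thus "idx x < length \<rho>" "\<beta> (idx x) = cls X A B x"
      using inv_into_into[of "cls X A B x" \<beta> "{0..<length \<rho>}"] f_inv_into_f[of "cls X A B x" \<beta> "{0..<length \<rho>}"]
      unfolding idx_def by simp_all
  qed
  have idx_eq: "idx x = i" if "i < length \<rho>" "x \<in> \<beta> i" for x i
  proof -
    have "\<beta> i = cls X A B x" using p.lps_cls[OF \<beta>l[OF that(1)] that(2)] .
    thus ?thesis using \<beta>(1) that(1) unfolding idx_def bij_betw_def by (metis atLeast0LessThan inv_into_f_f lessThan_iff)
  qed
  have in_iff: "x \<in> \<beta> i \<longleftrightarrow> x \<in> X \<and> idx x = i" if "i < length \<rho>" for x i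
    using idx_eq[OF that] p.lps_sub[OF \<beta>l[OF that]] idx(2)[of x] p.cls_refl[of x] by auto
  have idxA: "idx (A x) = idx x" "idx (B x) = idx x" for x
    using p.cls_eq[OF p.cls_stepA[OF p.cls_refl]] p.cls_eq[OF p.cls_stepB[OF p.cls_refl]]
    by (simp_all add: idx_def)
  define rep where "rep i = (SOME x. x \<in> \<beta> i)" for i
  have rep: "rep i \<in> \<beta> i" if "i < length \<rho>" for i
    using p.lps_nonempty[OF \<beta>l[OF that]] unfolding rep_def by (auto intro: someI_ex)
  have cX: "A x \<in> X" "B x \<in> X" if "x \<in> X" for x using pairingD(1)[OF p.pA that] pairingD(1)[OF p.pB that] .
  let ?F = "{f \<in> {0..<length \<rho>} \<rightarrow>\<^sub>E {0..<length \<mu>}.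
       \<forall>j < length \<mu>. (\<Sum>i\<in>{i. i < length \<rho> \<and> f i = j}. \<rho> ! i) = \<mu> ! j}"
  let ?i = "\<lambda>f. \<lambda>x\<in>X. f (idx x)" and ?j = "\<lambda>g. \<lambda>i\<in>{0..<length \<rho>}. g (rep i)"
  have fib: "card {x \<in> X. f (idx x) = j} = 2 * (\<Sum>i\<in>{i. i < length \<rho> \<and> f i = j}. \<rho> ! i)" for f :: "nat \<Rightarrow> nat" and j
  proof -
    have "{x \<in> X. f (idx x) = j} = (\<Union>i\<in>{i. i < length \<rho> \<and> f i = j}. \<beta> i)"
      using in_iff idx(1) by auto
    also have "card \<dots> = (\<Sum>i\<in>{i. i < length \<rho> \<and> f i = j}. card (\<beta> i))"
    proof (rule card_UN_disjoint)
      show "\<forall>i\<in>{i. i < length \<rho> \<and> f i = j}. finite (\<beta> i)"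
        using finite_subset[OF p.lps_sub[OF \<beta>l] p.fin] by simp
      show "\<forall>i\<in>{i. i < length \<rho> \<and> f i = j}. \<forall>i'\<in>{i. i < length \<rho> \<and> f i = j}. i \<noteq> i' \<longrightarrow> \<beta> i \<inter> \<beta> i' = {}"
        using in_iff by auto
    qed simp
    also have "\<dots> = (\<Sum>i\<in>{i. i < length \<rho> \<and> f i = j}. 2 * \<rho> ! i)"
    proof (rule sum.cong)
      fix i assume "i \<in> {i. i < length \<rho> \<and> f i = j}"
      hence "i < length \<rho>" by simp
      hence "even (card (\<beta> i))" using \<beta>l[of i] p.cls_even by (auto simp: p.lps_eq)
      thus "card (\<beta> i) = 2 * \<rho> ! i" using \<beta>(2)[OF \<open>i < length \<rho>\<close>] by auto
    qed simp
    finally show ?thesis by (simp add: sum_distrib_left)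
  qed
  have const: "g (rep (idx x)) = g x" if "x \<in> X" "\<forall>x\<in>X. g (A x) = g x \<and> g (B x) = g x" for g :: "'a \<Rightarrow> nat" and x
  proof -
    have "rep (idx x) \<in> cls X A B x" using rep idx that(1) by metis
    hence "rep (idx x) \<in> {y \<in> X. g y = g x}"
      by (rule p.cls_least) (use that cX in auto)
    thus ?thesis by simp
  qed
  have "bij_betw ?i ?F (mono_fills X A B \<mu>)"
  proof (rule bij_betw_byWitness[where f' = ?j])
    show "\<forall>f\<in>?F. ?j (?i f) = f"
      using rep in_iff by (auto simp: fun_eq_iff PiE_def extensional_def)
    show "\<forall>g\<in>mono_fills X A B \<mu>. ?i (?j g) = g"
      using const idx(1) by (auto simp: fun_eq_iff PiE_def extensional_def mono_fills_def)
    show "?i ` ?F \<subseteq> mono_fills X A B \<mu>"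
    proof (intro image_subsetI)
      fix f assume f: "f \<in> ?F"
      have "{x \<in> X. ?i f x = j} = {x \<in> X. f (idx x) = j}" for j by auto
      thus "?i f \<in> mono_fills X A B \<mu>"
        using f fib[of f] idx(1) cX by (auto simp: mono_fills_def idxA PiE_def Pi_def)
    qed
    show "?j ` mono_fills X A B \<mu> \<subseteq> ?F"
    proof (intro image_subsetI)
      fix g assume g: "g \<in> mono_fills X A B \<mu>"
      have "(\<Sum>i\<in>{i. i < length \<rho> \<and> ?j g i = j}. \<rho> ! i) = \<mu> ! j" if j: "j < length \<mu>" for j
      proof -
        have "{x \<in> X. ?j g (idx x) = j} = {x \<in> X. g x = j}"
          using const[of _ g] g idx(1) by (force simp: mono_fills_def)
        hence "2 * (\<Sum>i\<in>{i. i < length \<rho> \<and> ?j g i = j}. \<rho> ! i) = card {x \<in> X. g x = j}"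
          using fib[of "?j g" j] by simp
        also have "\<dots> = 2 * \<mu> ! j" using g j by (simp add: mono_fills_def)
        finally show ?thesis by simp
      qed
      moreover have "?j g \<in> {0..<length \<rho>} \<rightarrow>\<^sub>E {0..<length \<mu>}"
        using g rep in_iff by (fastforce simp: mono_fills_def PiE_def Pi_def)
      ultimately show "?j g \<in> ?F" by blast
    qed
  qed
  thus ?thesis unfolding p_to_m_def by (rule bij_betw_same_card)
qed

lemma p_to_m_refl: "p_to_m \<mu> \<mu> > 0"
proof -
  let ?F = "{f \<in> {0..<length \<mu>} \<rightarrow>\<^sub>E {0..<length \<mu>}.
       \<forall>j < length \<mu>. (\<Sum>i\<in>{i. i < length \<mu> \<and> f i = j}. \<mu> ! i) = \<mu> ! j}"
  have "(\<lambda>i\<in>{0..<length \<mu>}. i) \<in> ?F"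
  proof -
    have "{i. i < length \<mu> \<and> (\<lambda>i\<in>{0..<length \<mu>}. i) i = j} = {j}" if "j < length \<mu>" for j
      using that by auto
    thus ?thesis by auto
  qed
  moreover have "finite ?F" by (rule finite_subset[of _ "{0..<length \<mu>} \<rightarrow>\<^sub>E {0..<length \<mu>}"]) (auto intro: finite_PiE)
  ultimately show ?thesis unfolding p_to_m_def by (metis (no_types, lifting) card_gt_0_iff empty_iff)
qed

text \<open>The parts of \<open>\<mu>\<close> being positive, a map counted by \<open>p_to_m\<close>
  is surjective, so \<open>\<mu>\<close> is not longer than \<open>\<rho>\<close>; if the lengths
  agree, the map is a bijection matching equal parts.\<close>

lemma p_to_m_triangular:
  assumes "\<rho> \<in> partitions_of n" "\<mu> \<in> partitions_of n" "p_to_m \<rho> \<mu> \<noteq> 0" "length \<rho> \<le> length \<mu>"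
  shows "\<rho> = \<mu>"
proof -
  obtain f where f: "f \<in> {0..<length \<rho>} \<rightarrow>\<^sub>E {0..<length \<mu>}"
    "\<And>j. j < length \<mu> \<Longrightarrow> (\<Sum>i\<in>{i. i < length \<rho> \<and> f i = j}. \<rho> ! i) = \<mu> ! j"
  proof -
    have "{f \<in> {0..<length \<rho>} \<rightarrow>\<^sub>E {0..<length \<mu>}.
       \<forall>j < length \<mu>. (\<Sum>i\<in>{i. i < length \<rho> \<and> f i = j}. \<rho> ! i) = \<mu> ! j} \<noteq> {}" (is "?F \<noteq> {}")
    proof
      assume "?F = {}"
      hence "card ?F = 0" by (simp only: card.empty)
      thus False using assms(3) unfolding p_to_m_def by blast
    qed
    then obtain f where "f \<in> ?F" by blast
    thus ?thesis using that[of f] by simp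
  qed
  have pos: "\<mu> ! j > 0" if "j < length \<mu>" for j
    using assms(2) nth_mem[OF that] unfolding partitions_of_def is_partition_def by (cases "\<mu> ! j") auto
  have surj: "f ` {0..<length \<rho>} = {0..<length \<mu>}"
  proof
    show "{0..<length \<mu>} \<subseteq> f ` {0..<length \<rho>}"
    proof
      fix j assume "j \<in> {0..<length \<mu>}"
      hence "(\<Sum>i\<in>{i. i < length \<rho> \<and> f i = j}. \<rho> ! i) \<noteq> 0" using f(2) pos by simp
      hence "{i. i < length \<rho> \<and> f i = j} \<noteq> {}" by (metis sum.empty)
      thus "j \<in> f ` {0..<length \<rho>}" by auto
    qed
  qed (use f(1) in auto)
  hence "length \<mu> \<le> length \<rho>" using card_image_le[of "{0..<length \<rho>}" f] by simp
  hence len: "length \<rho> = length \<mu>" using assms(4) by simp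
  have inj: "inj_on f {0..<length \<rho>}" using surj len by (intro eq_card_imp_inj_on) auto
  have val: "\<rho> ! i = \<mu> ! (f i)" if "i < length \<rho>" for i
  proof -
    have "f i < length \<mu>" using f(1) that by auto
    moreover have "{i'. i' < length \<rho> \<and> f i' = f i} = {i}" using inj that by (auto dest: inj_onD)
    ultimately show ?thesis using f(2)[of "f i"] by simp
  qed
  have "mset \<rho> = image_mset ((!) \<rho>) (mset_set {0..<length \<rho>})"
    by (metis map_nth mset_map mset_upt)
  also have "\<dots> = image_mset ((!) \<mu>) (image_mset f (mset_set {0..<length \<rho>}))"
    unfolding multiset.map_comp by (rule image_mset_cong) (simp add: val)
  also have "\<dots> = image_mset ((!) \<mu>) (mset_set {0..<length \<mu>})"
    using inj surj by (simp add: image_mset_mset_set)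
  also have "\<dots> = mset \<mu>" by (metis map_nth mset_map mset_upt)
  finally show ?thesis using partitions_of_mset[OF assms(1,2)] by simp
qed

text \<open>For a longest partition \<open>\<mu>\<close> in the support of \<open>f\<close>,
  \<open>p_to_m_triangular\<close> shows that no other member of the support contributes to the
  monomial of exponent \<open>\<mu>\<close>.\<close>

lemma mcoeff_faithful:
  assumes "\<And>\<mu>. \<mu> \<in> partitions_of n \<Longrightarrow> mcoeff n f \<mu> = 0" "\<rho> \<in> partitions_of n"
  shows "f \<rho> = 0"
proof (rule ccontr)
  assume "f \<rho> \<noteq> 0"
  let ?S = "{\<rho> \<in> partitions_of n. f \<rho> \<noteq> 0}"
  have fin: "finite ?S" using finite_partitions_of by simp
  have ne: "?S \<noteq> {}" using assms(2) \<open>f \<rho> \<noteq> 0\<close> by auto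
  obtain \<mu> where \<mu>: "\<mu> \<in> ?S" "\<And>\<nu>. \<nu> \<in> ?S \<Longrightarrow> length \<nu> \<le> length \<mu>"
  proof -
    have "Max (length ` ?S) \<in> length ` ?S" using fin ne by (intro Max_in) auto
    then obtain \<mu> where \<mu>: "\<mu> \<in> ?S" "Max (length ` ?S) = length \<mu>" by (rule imageE)
    have "length \<nu> \<le> length \<mu>" if "\<nu> \<in> ?S" for \<nu>
      unfolding \<mu>(2)[symmetric] using fin that by (intro Max_ge) auto
    with \<mu>(1) show ?thesis by (rule that)
  qed
  have \<mu>P: "\<mu> \<in> partitions_of n" using \<mu>(1) by simp
  have "mcoeff n f \<mu> = (\<Sum>\<rho>\<in>partitions_of n. if \<rho> = \<mu> then f \<mu> * real (p_to_m \<mu> \<mu>) else 0)"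
    unfolding mcoeff_def
  proof (rule sum.cong)
    fix \<nu> assume \<nu>: "\<nu> \<in> partitions_of n"
    show "f \<nu> * real (p_to_m \<nu> \<mu>) = (if \<nu> = \<mu> then f \<mu> * real (p_to_m \<mu> \<mu>) else 0)"
    proof (cases "f \<nu> = 0 \<or> p_to_m \<nu> \<mu> = 0")
      case True
      thus ?thesis by auto
    next
      case False
      hence "\<nu> = \<mu>" using p_to_m_triangular[OF \<nu> \<mu>P] \<mu>(2)[of \<nu>] \<nu> by simp
      thus ?thesis by simp
    qed
  qed simp
  also have "\<dots> = f \<mu> * real (p_to_m \<mu> \<mu>)"
    using \<mu>(1) finite_partitions_of by simp
  finally show False using assms(1)[of \<mu>] \<mu>(1) p_to_m_refl[of \<mu>] by auto
qed

lemma mcoeff_diff: "mcoeff n (\<lambda>\<rho>. f \<rho> - g \<rho>) \<mu> = mcoeff n f \<mu> - mcoeff n g \<mu>"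
  by (simp add: mcoeff_def sum_subtractf algebra_simps)

lemma mcoeff_sum: "mcoeff n (\<lambda>\<rho>. \<Sum>i\<in>I. c i * f i \<rho>) \<mu> = (\<Sum>i\<in>I. c i * mcoeff n (f i) \<mu>)"
  unfolding mcoeff_def sum_distrib_left sum_distrib_right
  by (subst sum.swap) (simp add: algebra_simps)

lemma jack_scalar_diff: "jack_scalar a n (\<lambda>\<rho>. f \<rho> - g \<rho>) d = jack_scalar a n f d - jack_scalar a n g d"
  by (simp add: jack_scalar_def sum_subtractf algebra_simps)

lemma jack_scalar_sum: "jack_scalar a n (\<lambda>\<rho>. \<Sum>i\<in>I. c i * f i \<rho>) d = (\<Sum>i\<in>I. c i * jack_scalar a n (f i) d)"
  unfolding jack_scalar_def sum_distrib_left sum_distrib_right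
  by (subst sum.swap) (simp add: algebra_simps)

lemma jack_scalar_commute: "jack_scalar a n f g = jack_scalar a n g f"
  by (simp add: jack_scalar_def mult.commute)

lemma zee_pos: "0 \<notin> set \<mu> \<Longrightarrow> zee \<mu> > 0"
  unfolding zee_def by (rule prod_pos) (metis fact_gt_zero gr0I mult_pos_pos of_nat_0_less_iff zero_less_power)

lemma jack_scalar_definite:
  assumes "a > 0" "jack_scalar a n f f = 0" "\<rho> \<in> partitions_of n"
  shows "f \<rho> = 0"
proof -
  have z: "zee \<sigma> * a ^ length \<sigma> > 0" if "\<sigma> \<in> partitions_of n" for \<sigma>
    using that zee_pos[of \<sigma>] assms(1) by (simp add: partitions_of_def is_partition_def)
  have s: "jack_scalar a n f f = (\<Sum>\<rho>\<in>partitions_of n. f \<rho> ^ 2 * (zee \<rho> * a ^ length \<rho>))"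
    by (simp add: jack_scalar_def power2_eq_square algebra_simps)
  have "\<forall>\<rho>\<in>partitions_of n. f \<rho> ^ 2 * (zee \<rho> * a ^ length \<rho>) = 0"
    using assms(2) unfolding s
    by (subst (asm) sum_nonneg_eq_0_iff) (use finite_partitions_of z in \<open>auto intro!: mult_nonneg_nonneg less_imp_le[OF z]\<close>)
  hence "f \<rho> ^ 2 * (zee \<rho> * a ^ length \<rho>) = 0" using assms(3) by blast
  thus ?thesis using z[OF assms(3)] by (metis less_irrefl mult_eq_0_iff power_not_zero)
qed

section \<open>Macdonald's characterization determines the family\<close>

definition is_jack_family :: "real \<Rightarrow> nat \<Rightarrow> (nat list \<Rightarrow> nat list \<Rightarrow> real) \<Rightarrow> bool" where
  "is_jack_family \<alpha> n P \<longleftrightarrow>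
      (\<forall>la\<in>partitions_of n. \<forall>\<mu>\<in>partitions_of n. mcoeff n (P la) \<mu> \<noteq> 0 \<longrightarrow> dominated \<mu> la) \<and>
      (\<forall>la\<in>partitions_of n. mcoeff n (P la) la = 1) \<and>
      (\<forall>la\<in>partitions_of n. \<forall>\<mu>\<in>partitions_of n. la \<noteq> \<mu> \<longrightarrow> jack_scalar \<alpha> n (P la) (P \<mu>) = 0) \<and>
      (\<forall>la. la \<notin> partitions_of n \<longrightarrow> P la = (\<lambda>_. 0)) \<and>
      (\<forall>la \<rho>. \<rho> \<notin> partitions_of n \<longrightarrow> P la \<rho> = 0)"

text \<open>A rank that increases strictly along dominance, which turns recursion over a partial
  order into induction over natural numbers.\<close>

definition drank :: "nat \<Rightarrow> nat list \<Rightarrow> nat" where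
  "drank n la = card {\<nu> \<in> partitions_of n. dominated \<nu> la}"

lemma drank_less:
  assumes "\<mu> \<in> partitions_of n" "\<nu> \<in> partitions_of n" "dominated \<mu> \<nu>" "\<mu> \<noteq> \<nu>"
  shows "drank n \<mu> < drank n \<nu>"
  unfolding drank_def
proof (rule psubset_card_mono)
  have "\<not> dominated \<nu> \<mu>" using dominated_antisym[OF assms(1,2,3)] assms(4) by blast
  thus "{\<kappa> \<in> partitions_of n. dominated \<kappa> \<mu>} \<subset> {\<kappa> \<in> partitions_of n. dominated \<kappa> \<nu>}"
    using dominated_trans[OF _ assms(3)] assms(2) dominated_refl[of \<nu>] by auto
qed (use finite_partitions_of in simp)

text \<open>A function supported strictly below \<open>la\<close> is a combination of the
  \<open>P \<mu>\<close> with \<open>\<mu>\<close> below \<open>la\<close>. The expansion arises by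
  stripping off the layer of highest rank; triangularity moves the error terms into lower
  layers.\<close>

lemma orthogonal_below:
  assumes P: "is_jack_family a n P" and la: "la \<in> partitions_of n"
    and orth: "\<And>\<mu>. \<mu> \<in> partitions_of n \<Longrightarrow> dominated \<mu> la \<Longrightarrow> \<mu> \<noteq> la \<Longrightarrow> jack_scalar a n (P \<mu>) d = 0"
    and supp: "\<And>\<mu>. \<mu> \<in> partitions_of n \<Longrightarrow> mcoeff n f \<mu> \<noteq> 0 \<Longrightarrow> dominated \<mu> la \<and> \<mu> \<noteq> la \<and> drank n \<mu> < m"
  shows "jack_scalar a n f d = 0"
  using supp
proof (induction m arbitrary: f)
  case 0
  hence "f \<rho> = 0" if "\<rho> \<in> partitions_of n" for \<rho>
    using mcoeff_faithful[of n f, OF _ that] by blast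
  thus ?case by (simp add: jack_scalar_def)
next
  case (Suc m)
  let ?D = "{\<mu> \<in> partitions_of n. dominated \<mu> la \<and> \<mu> \<noteq> la \<and> drank n \<mu> = m}"
  have finD: "finite ?D" using finite_partitions_of by simp
  define g where "g = (\<lambda>\<rho>. \<Sum>\<mu>\<in>?D. mcoeff n f \<mu> * P \<mu> \<rho>)"
  have tri: "dominated \<nu> \<mu>" if "\<mu> \<in> partitions_of n" "\<nu> \<in> partitions_of n" "mcoeff n (P \<mu>) \<nu> \<noteq> 0" for \<mu> \<nu>
    using P that by (auto simp: is_jack_family_def)
  have one: "mcoeff n (P \<mu>) \<mu> = 1" if "\<mu> \<in> partitions_of n" for \<mu>
    using P that by (auto simp: is_jack_family_def)
  have mg: "mcoeff n g \<nu> = (\<Sum>\<mu>\<in>?D. mcoeff n f \<mu> * mcoeff n (P \<mu>) \<nu>)" for \<nu>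
    unfolding g_def by (rule mcoeff_sum)
  \<comment> \<open>Distinct partitions of equal rank are incomparable, so at a partition of this
    layer only its own \<open>P\<close> contributes, through the leading term.\<close>
  have top: "mcoeff n g \<nu> = mcoeff n f \<nu>" if "\<nu> \<in> ?D" for \<nu>
  proof -
    have "mcoeff n g \<nu> = (\<Sum>\<mu>\<in>?D. if \<mu> = \<nu> then mcoeff n f \<nu> else 0)"
      unfolding mg
    proof (rule sum.cong)
      fix \<mu> assume "\<mu> \<in> ?D"
      thus "mcoeff n f \<mu> * mcoeff n (P \<mu>) \<nu> = (if \<mu> = \<nu> then mcoeff n f \<nu> else 0)"
        using that tri[of \<mu> \<nu>] one[of \<mu>] drank_less[of \<nu> n \<mu>] by auto
    qed simp
    thus ?thesis using that finD by simp
  qed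
  have "jack_scalar a n (\<lambda>\<rho>. f \<rho> - g \<rho>) d = 0"
  proof (rule Suc.IH)
    fix \<nu> assume \<nu>: "\<nu> \<in> partitions_of n" "mcoeff n (\<lambda>\<rho>. f \<rho> - g \<rho>) \<nu> \<noteq> 0"
    hence ne: "mcoeff n f \<nu> \<noteq> mcoeff n g \<nu>" by (simp add: mcoeff_diff)
    hence nD: "\<nu> \<notin> ?D" using top[of \<nu>] by argo
    show "dominated \<nu> la \<and> \<nu> \<noteq> la \<and> drank n \<nu> < m"
    proof (cases "mcoeff n f \<nu> = 0")
      case False
      thus ?thesis using Suc.prems[OF \<nu>(1)] nD \<nu>(1) by auto
    next
      case True
      hence "(\<Sum>\<mu>\<in>?D. mcoeff n f \<mu> * mcoeff n (P \<mu>) \<nu>) \<noteq> 0" using ne mg by simp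
      then obtain \<mu> where \<mu>: "\<mu> \<in> ?D" "mcoeff n f \<mu> * mcoeff n (P \<mu>) \<nu> \<noteq> 0"
        by (rule sum.not_neutral_contains_not_neutral)
      have "\<nu> \<noteq> \<mu>" using nD \<mu>(1) by auto
      moreover have d: "dominated \<nu> \<mu>" using tri[of \<mu> \<nu>] \<mu> \<nu>(1) by auto
      ultimately have "drank n \<nu> < m" using drank_less[of \<nu> n \<mu>] \<mu>(1) \<nu>(1) by auto
      moreover have "dominated \<nu> la" using d \<mu>(1) dominated_trans by blast
      moreover have "\<nu> \<noteq> la" using d \<mu>(1) dominated_antisym[of \<mu> n la] la by auto
      ultimately show ?thesis by simp
    qed
  qed
  moreover have "jack_scalar a n g d = 0"
    unfolding g_def jack_scalar_sum by (rule sum.neutral) (use orth in auto)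
  ultimately show ?case by (simp add: jack_scalar_diff)
qed

text \<open>In the difference of two candidates the leading terms cancel, so it lies strictly below
  \<open>la\<close>, where both families agree by induction. It is orthogonal to all these lower
  members, hence to itself.\<close>

lemma is_jack_family_unique:
  assumes a: "a > 0" and P: "is_jack_family a n P" and Q: "is_jack_family a n Q"
  shows "P = Q"
proof -
  have "P la = Q la" if "la \<in> partitions_of n" for la
    using that
  proof (induction "drank n la" arbitrary: la rule: less_induct)
    case less
    define d where "d = (\<lambda>\<rho>. P la \<rho> - Q la \<rho>)"
    have "jack_scalar a n d d = 0"
    proof (rule orthogonal_below[OF P less.prems])
      fix \<mu> assume \<mu>: "\<mu> \<in> partitions_of n" "dominated \<mu> la" "\<mu> \<noteq> la"
      hence "P \<mu> = Q \<mu>" using less.hyps drank_less less.prems by metis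
      hence "jack_scalar a n (P la) (P \<mu>) = 0" "jack_scalar a n (Q la) (P \<mu>) = 0"
        using P Q \<mu> less.prems unfolding is_jack_family_def by metis+
      hence "jack_scalar a n d (P \<mu>) = 0" unfolding d_def jack_scalar_diff by simp
      thus "jack_scalar a n (P \<mu>) d = 0" by (simp add: jack_scalar_commute)
    next
      fix \<mu> assume \<mu>: "\<mu> \<in> partitions_of n" "mcoeff n d \<mu> \<noteq> 0"
      hence "mcoeff n (P la) \<mu> \<noteq> mcoeff n (Q la) \<mu>" by (simp add: d_def mcoeff_diff)
      hence "dominated \<mu> la \<and> \<mu> \<noteq> la"
        using P Q \<mu>(1) less.prems unfolding is_jack_family_def by metis
      thus "dominated \<mu> la \<and> \<mu> \<noteq> la \<and> drank n \<mu> < drank n la"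
        using drank_less \<mu>(1) less.prems by blast
    qed
    hence "d \<rho> = 0" if "\<rho> \<in> partitions_of n" for \<rho>
      using jack_scalar_definite[OF a] that by blast
    moreover have "d \<rho> = 0" if "\<rho> \<notin> partitions_of n" for \<rho>
      using P Q that by (simp add: d_def is_jack_family_def)
    ultimately show ?case unfolding d_def by (metis eq_iff_diff_eq_0 ext)
  qed
  moreover have "P la = Q la" if "la \<notin> partitions_of n" for la
    using P Q that by (simp add: is_jack_family_def)
  ultimately show ?thesis by blast
qed

lemma jack_P_family_eqI:
  assumes "a > 0" "is_jack_family a n P"
  shows "jack_P_family a n = P"
  unfolding jack_P_family_def is_jack_family_def[symmetric]
  using assms is_jack_family_unique by (intro the_equality) blast+

section \<open>Zonal polynomials as signed sums over column permutations and row pairings\<close>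

text \<open>Fixed points of \<open>i\<close> are covered as well: there \<open>f x = - f x\<close>,
  so they contribute zero.\<close>

lemma sum_sign_reversing:
  fixes f :: "'a \<Rightarrow> real"
  assumes "\<And>x. x \<in> S \<Longrightarrow> i x \<in> S" "\<And>x. x \<in> S \<Longrightarrow> i (i x) = x" "\<And>x. x \<in> S \<Longrightarrow> f (i x) = - f x"
  shows "sum f S = 0"
proof -
  have "sum f S = sum (\<lambda>x. f (i x)) S"
    by (rule sum.reindex_bij_witness[where i = i and j = i]) (use assms in auto)
  also have "\<dots> = - sum f S" using assms(3) by (simp add: sum_negf)
  finally show ?thesis by simp
qed

text \<open>The second component selects the copy of the box, \<open>False\<close> for the first and
  \<open>True\<close> for the second.\<close>

definition cells :: "(nat \<times> nat) set \<Rightarrow> ((nat \<times> nat) \<times> bool) set" where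
  "cells B = B \<times> UNIV"

definition col_perms :: "(nat \<times> nat) set \<Rightarrow> (nat \<times> nat \<Rightarrow> nat \<times> nat) set" where
  "col_perms B = {p. p permutes B \<and> (\<forall>s. snd (p s) = snd s)}"

definition row_pairings :: "(nat \<times> nat) set \<Rightarrow> ((nat \<times> nat) \<times> bool \<Rightarrow> (nat \<times> nat) \<times> bool) set" where
  "row_pairings B = {A. pairing (cells B) A \<and> (\<forall>y. fst (fst (A y)) = fst (fst y))}"

definition col_pairing :: "(nat \<times> nat) set \<Rightarrow> (nat \<times> nat \<Rightarrow> nat \<times> nat) \<Rightarrow> (nat \<times> nat) \<times> bool \<Rightarrow> (nat \<times> nat) \<times> bool" where
  "col_pairing B p y = (if fst y \<in> B then if snd y then (inv p (fst y), False) else (p (fst y), True) else y)"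

definition sgnr :: "('a \<Rightarrow> 'a) \<Rightarrow> real" where
  "sgnr p = real_of_int (sign p)"

definition zonal :: "(nat \<times> nat) set \<Rightarrow> nat list \<Rightarrow> real" where
  "zonal B \<rho> = (\<Sum>p\<in>col_perms B. \<Sum>A\<in>row_pairings B.
     if ltype (cells B) (col_pairing B p) A = mset \<rho> then sgnr p else 0)"

text \<open>A product of minors in disguise: the sum factors into a determinant for each column, and vanishes
  unless \<open>g\<close> is injective on the first copy of every column.\<close>
definition alt_sum :: "(nat \<times> nat) set \<Rightarrow> ((nat \<times> nat) \<times> bool \<Rightarrow> 'a) \<Rightarrow> real" where
  "alt_sum B g = (\<Sum>p\<in>col_perms B. if \<forall>y\<in>cells B. g (col_pairing B p y) = g y then sgnr p else 0)"

lemma mem_cells: "y \<in> cells B \<longleftrightarrow> fst y \<in> B"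
  by (cases y) (simp add: cells_def)

lemma finite_cells: "finite B \<Longrightarrow> finite (cells B)"
  by (simp add: cells_def)

lemma card_cells: "finite B \<Longrightarrow> card (cells B) = 2 * card B"
  by (simp add: cells_def card_cartesian_product)

lemma finite_col_perms: "finite B \<Longrightarrow> finite (col_perms B)"
  unfolding col_perms_def by (rule finite_subset[OF _ finite_permutations[of B]]) auto

lemma finite_pairings: "finite X \<Longrightarrow> finite {S. pairing X S}"
  by (rule finite_subset[OF _ finite_permutations[of X]])
     (auto simp: permutes_def pairing_def, metis)

lemma finite_row_pairings: "finite B \<Longrightarrow> finite (row_pairings B)"
  unfolding row_pairings_def
  by (rule finite_subset[OF _ finite_pairings[OF finite_cells[of B]]]) auto

lemma pairing_col_pairing:
  assumes "p \<in> col_perms B"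
  shows "pairing (cells B) (col_pairing B p)"
proof -
  have p: "p permutes B" using assms by (simp add: col_perms_def)
  show ?thesis
    using permutes_in_image[OF p] permutes_in_image[OF permutes_inv[OF p]] permutes_inverses[OF p]
    by (auto simp: pairing_def mem_cells col_pairing_def)
qed

lemma pairings_cells:
  "finite B \<Longrightarrow> p \<in> col_perms B \<Longrightarrow> A \<in> row_pairings B \<Longrightarrow> pairings (cells B) (col_pairing B p) A"
  by (simp add: pairings_def finite_cells pairing_col_pairing row_pairings_def)

lemma col_pairing_invariant_iff:
  assumes "p \<in> col_perms B"
  shows "(\<forall>y\<in>cells B. g (col_pairing B p y) = g y) \<longleftrightarrow> (\<forall>s\<in>B. g (s, False) = g (p s, True))"
proof -
  have p: "p permutes B" using assms by (simp add: col_perms_def)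
  have "g (inv p s, False) = g (s, True)" if "\<forall>s\<in>B. g (s, False) = g (p s, True)" "s \<in> B" for s
    using that permutes_in_image[OF permutes_inv[OF p]] permutes_inverses[OF p] by metis
  moreover have "g (s, False) = g (p s, True)" if "\<forall>y\<in>cells B. g (col_pairing B p y) = g y" "s \<in> B" for s
    using bspec[OF that(1), of "(s, False)"] that(2) by (simp add: mem_cells col_pairing_def)
  ultimately show ?thesis by (auto simp: mem_cells col_pairing_def)
qed

lemma sgnr_compose_transpose:
  assumes "p permutes B" "finite B" "s \<noteq> t"
  shows "sgnr (p \<circ> swap s t) = - sgnr p" "sgnr (swap s t \<circ> p) = - sgnr p"
proof -
  have "permutation p" using assms permutation_permutes by blast
  thus "sgnr (p \<circ> swap s t) = - sgnr p" "sgnr (swap s t \<circ> p) = - sgnr p"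
    using assms(3) by (simp_all add: sgnr_def sign_compose permutation_swap_id sign_swap_id)
qed

text \<open>Two equal rows of a determinant: composing \<open>p\<close> with the transposition of
  \<open>s\<close> and \<open>t\<close> keeps the invariance condition, as \<open>g\<close> agrees
  on their first copies, and reverses the sign.\<close>

lemma alt_sum_eq_0:
  assumes "finite B" "s \<in> B" "t \<in> B" "s \<noteq> t" "snd s = snd t" "g (s, False) = g (t, False)"
  shows "alt_sum B g = 0"
  unfolding alt_sum_def
proof (rule sum_sign_reversing[where i = "\<lambda>p. p \<circ> swap s t"])
  let ?t = "swap s t"
  fix p assume p: "p \<in> col_perms B"
  hence pB: "p permutes B" by (simp add: col_perms_def)
  have tB: "?t permutes B" using assms by (simp add: permutes_swap_id)
  show m: "p \<circ> ?t \<in> col_perms B"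
  proof -
    have "snd (?t u) = snd u" for u using assms(5) by (simp add: Transposition.transpose_def)
    moreover have "snd (p u) = snd u" for u using p unfolding col_perms_def by blast
    ultimately have "snd (p (?t u)) = snd u" for u by metis
    thus ?thesis using permutes_compose[OF tB pB] by (simp add: col_perms_def)
  qed
  show "p \<circ> ?t \<circ> ?t = p" by (simp add: o_assoc[symmetric])
  have "(\<forall>u\<in>B. g (u, False) = g ((p \<circ> ?t) u, True)) \<longleftrightarrow> (\<forall>u\<in>B. g (?t u, False) = g (p u, True))"
  proof -
    have "(\<forall>u\<in>B. g (u, False) = g ((p \<circ> ?t) u, True)) \<longleftrightarrow> (\<forall>u\<in>?t ` B. g (u, False) = g ((p \<circ> ?t) u, True))"
      using permutes_image[OF tB] by simp
    thus ?thesis by simp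
  qed
  also have "\<dots> \<longleftrightarrow> (\<forall>u\<in>B. g (u, False) = g (p u, True))"
  proof -
    have "g (?t u, False) = g (u, False)" for u
      using assms(6) by (cases "u = s"; cases "u = t") simp_all
    thus ?thesis by simp
  qed
  finally show "(if \<forall>y\<in>cells B. g (col_pairing B (p \<circ> ?t) y) = g y then sgnr (p \<circ> ?t) else 0) =
         - (if \<forall>y\<in>cells B. g (col_pairing B p y) = g y then sgnr p else 0)"
    unfolding col_pairing_invariant_iff[OF m] col_pairing_invariant_iff[OF p]
    using sgnr_compose_transpose(1)[OF pB assms(1,4)] by simp
qed

lemma sum_ltype_select:
  assumes "pairings X A B" "card X = 2 * n"
  shows "(\<Sum>\<rho>\<in>partitions_of n. (if ltype X A B = mset \<rho> then c else 0) * h \<rho>) =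
         c * (h (THE \<rho>. \<rho> \<in> partitions_of n \<and> mset \<rho> = ltype X A B) :: real)"
    and "\<exists>!\<rho>. \<rho> \<in> partitions_of n \<and> mset \<rho> = ltype X A B"
proof -
  interpret p: pairings X A B by fact
  obtain \<rho> where \<rho>: "\<rho> \<in> partitions_of n" "mset \<rho> = ltype X A B"
    using partition_of_multiset[OF p.ltype_pos] p.sum_ltype assms(2) by auto
  show ex1: "\<exists>!\<rho>. \<rho> \<in> partitions_of n \<and> mset \<rho> = ltype X A B"
    using \<rho> partitions_of_mset by (intro ex1I[of _ \<rho>]) metis+
  have the: "(THE \<rho>. \<rho> \<in> partitions_of n \<and> mset \<rho> = ltype X A B) = \<rho>"
    using ex1 \<rho> by (intro the1_equality) auto
  have "(\<Sum>\<rho>'\<in>partitions_of n. (if ltype X A B = mset \<rho>' then c else 0) * h \<rho>') =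
        (\<Sum>\<rho>'\<in>partitions_of n. if \<rho>' = \<rho> then c * h \<rho> else 0)"
    using \<rho> partitions_of_mset by (intro sum.cong) auto
  thus "(\<Sum>\<rho>\<in>partitions_of n. (if ltype X A B = mset \<rho> then c else 0) * h \<rho>) =
         c * (h (THE \<rho>. \<rho> \<in> partitions_of n \<and> mset \<rho> = ltype X A B))"
    using \<rho>(1) finite_partitions_of the by simp
qed

lemma real_card_sum_indicator:
  "finite G \<Longrightarrow> real (card {g \<in> G. P g}) = (\<Sum>g\<in>G. if P g then 1 else 0)"
  by (simp add: sum.If_cases Int_def)

text \<open>Makes the sum over column permutations innermost, which is where cancellation takes
  place; the row pairing only restricts the fillings that occur.\<close>

lemma signed_fill_sum:
  assumes "finite B" "finite G"
  shows "(\<Sum>p\<in>col_perms B. \<Sum>A\<in>row_pairings B. sgnr p *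
            real (card {g \<in> G. (\<forall>y\<in>cells B. g (col_pairing B p y) = g y) \<and> (\<forall>y\<in>cells B. g (A y) = g y)})) =
         (\<Sum>A\<in>row_pairings B. \<Sum>g\<in>{g \<in> G. \<forall>y\<in>cells B. g (A y) = g y}. alt_sum B g)"
    (is "?l = ?r")
proof -
  let ?P = "\<lambda>p g. \<forall>y\<in>cells B. g (col_pairing B p y) = g y"
  have "?l = (\<Sum>p\<in>col_perms B. \<Sum>A\<in>row_pairings B. \<Sum>g\<in>{g \<in> G. \<forall>y\<in>cells B. g (A y) = g y}. if ?P p g then sgnr p else 0)"
  proof (intro sum.cong refl)
    fix p A
    define G' where "G' = {g \<in> G. \<forall>y\<in>cells B. g (A y) = g y}"
    have "finite G'" using assms by (simp add: G'_def)
    have "{g \<in> G. ?P p g \<and> (\<forall>y\<in>cells B. g (A y) = g y)} = {g \<in> G'. ?P p g}"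
      by (auto simp: G'_def)
    hence "real (card {g \<in> G. ?P p g \<and> (\<forall>y\<in>cells B. g (A y) = g y)}) = (\<Sum>g\<in>G'. if ?P p g then 1 else 0)"
      using real_card_sum_indicator[OF \<open>finite G'\<close>, of "?P p"] by simp
    thus "sgnr p * real (card {g \<in> G. ?P p g \<and> (\<forall>y\<in>cells B. g (A y) = g y)}) =
       (\<Sum>g\<in>{g \<in> G. \<forall>y\<in>cells B. g (A y) = g y}. if ?P p g then sgnr p else 0)"
      unfolding G'_def[symmetric] by (simp add: sum_distrib_left if_distrib cong: if_cong)
  qed
  also have "\<dots> = (\<Sum>A\<in>row_pairings B. \<Sum>p\<in>col_perms B. \<Sum>g\<in>{g \<in> G. \<forall>y\<in>cells B. g (A y) = g y}. if ?P p g then sgnr p else 0)"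
    by (rule sum.swap)
  also have "\<dots> = ?r"
    unfolding alt_sum_def by (intro sum.cong refl, rule sum.swap)
  finally show ?thesis .
qed

lemma mono_fills_eq:
  "mono_fills X A B \<mu> = {g \<in> {g \<in> X \<rightarrow>\<^sub>E {0..<length \<mu>}. \<forall>j<length \<mu>. card {x \<in> X. g x = j} = 2 * \<mu> ! j}.
      (\<forall>x\<in>X. g (A x) = g x) \<and> (\<forall>x\<in>X. g (B x) = g x)}"
  by (auto simp: mono_fills_def)

lemma zonal_sum_against:
  assumes "finite B" "card B = n"
  shows "(\<Sum>\<rho>\<in>partitions_of n. zonal B \<rho> * h \<rho>) =
    (\<Sum>p\<in>col_perms B. \<Sum>A\<in>row_pairings B. sgnr p *
       h (THE \<rho>. \<rho> \<in> partitions_of n \<and> mset \<rho> = ltype (cells B) (col_pairing B p) A))"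
proof -
  have "(\<Sum>\<rho>\<in>partitions_of n. zonal B \<rho> * h \<rho>) = (\<Sum>p\<in>col_perms B. \<Sum>A\<in>row_pairings B. \<Sum>\<rho>\<in>partitions_of n.
      (if ltype (cells B) (col_pairing B p) A = mset \<rho> then sgnr p else 0) * h \<rho>)"
    unfolding zonal_def sum_distrib_right
    by (subst sum.swap, rule sum.cong[OF refl], subst sum.swap, rule refl)
  thus ?thesis
    using sum_ltype_select(1)[OF pairings_cells[OF assms(1)]] card_cells[OF assms(1)] assms(2) by simp
qed

lemma mcoeff_zonal:
  assumes "finite B" "card B = n"
  shows "mcoeff n (zonal B) \<mu> =
    (\<Sum>A\<in>row_pairings B. \<Sum>g\<in>{g \<in> {g \<in> cells B \<rightarrow>\<^sub>E {0..<length \<mu>}. \<forall>j<length \<mu>. card {x \<in> cells B. g x = j} = 2 * \<mu> ! j}.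
        \<forall>y\<in>cells B. g (A y) = g y}. alt_sum B g)"
    (is "_ = ?r")
proof -
  let ?G = "{g \<in> cells B \<rightarrow>\<^sub>E {0..<length \<mu>}. \<forall>j<length \<mu>. card {x \<in> cells B. g x = j} = 2 * \<mu> ! j}"
  let ?the = "\<lambda>p A. THE \<rho>. \<rho> \<in> partitions_of n \<and> mset \<rho> = ltype (cells B) (col_pairing B p) A"
  have "mcoeff n (zonal B) \<mu> = (\<Sum>p\<in>col_perms B. \<Sum>A\<in>row_pairings B. sgnr p * real (p_to_m (?the p A) \<mu>))"
    unfolding mcoeff_def by (rule zonal_sum_against[OF assms])
  also have "\<dots> = (\<Sum>p\<in>col_perms B. \<Sum>A\<in>row_pairings B. sgnr p *
            real (card {g \<in> ?G. (\<forall>y\<in>cells B. g (col_pairing B p y) = g y) \<and> (\<forall>y\<in>cells B. g (A y) = g y)}))"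
  proof (intro sum.cong refl)
    fix p A assume pA: "p \<in> col_perms B" "A \<in> row_pairings B"
    have ps: "pairings (cells B) (col_pairing B p) A" using pairings_cells[OF assms(1) pA] .
    have c: "card (cells B) = 2 * n" using card_cells assms by simp
    have "mset (?the p A) = ltype (cells B) (col_pairing B p) A"
      using theI'[OF sum_ltype_select(2)[OF ps c]] by simp
    thus "sgnr p * real (p_to_m (?the p A) \<mu>) =
       sgnr p * real (card {g \<in> ?G. (\<forall>y\<in>cells B. g (col_pairing B p y) = g y) \<and> (\<forall>y\<in>cells B. g (A y) = g y)})"
      using p_to_m_eq[OF ps] unfolding mono_fills_eq by simp
  qed
  also have "\<dots> = ?r"
  proof (rule signed_fill_sum[OF assms(1)])
    show "finite ?G"
      by (rule finite_subset[of _ "cells B \<rightarrow>\<^sub>E {0..<length \<mu>}"]) (auto intro!: finite_PiE finite_cells assms)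
  qed
  finally show ?thesis .
qed

section \<open>Column-injective fillings of a Young diagram\<close>

lemma finite_boxes: "finite (boxes la)"
proof -
  have "boxes la = Sigma {..<length la} (\<lambda>i. {..<la ! i})" by (auto simp: boxes_def)
  thus ?thesis by simp
qed

lemma card_boxes_rows: "card {s \<in> boxes la. fst s < i} = sum_list (take i la)"
proof -
  have "{s \<in> boxes la. fst s < i} = Sigma {..<min i (length la)} (\<lambda>i. {..<la ! i})" by (auto simp: boxes_def)
  hence "card {s \<in> boxes la. fst s < i} = (\<Sum>k<min i (length la). la ! k)" by simp
  also have "\<dots> = (\<Sum>k<length (take i la). take i la ! k)"
    by (rule sum.cong) (auto simp: min.commute)
  also have "\<dots> = sum_list (take i la)" by (simp add: sum_list_sum_nth atLeast0LessThan)
  finally show ?thesis .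
qed

lemma card_boxes: "card (boxes la) = sum_list la"
proof -
  have "{s \<in> boxes la. fst s < length la} = boxes la" by (auto simp: boxes_def)
  thus ?thesis using card_boxes_rows[of la "length la"] by simp
qed

lemma boxes_iff_conj_part:
  assumes "is_partition la"
  shows "(i, j) \<in> boxes la \<longleftrightarrow> i < conj_part la j"
proof -
  let ?S = "{i. i < length la \<and> j < la ! i}"
  have down: "i' \<in> ?S" if "i \<in> ?S" "i' \<le> i" for i i'
  proof (cases "i' = i")
    case False
    hence "la ! i' \<ge> la ! i" using assms that
      by (auto simp: is_partition_def sorted_wrt_iff_nth_less)
    thus ?thesis using that by auto
  qed (use that in simp)
  have fin: "finite ?S" by simp
  have eq: "?S = {..<card ?S}"
  proof (cases "?S = {}")
    case False
    let ?m = "Max ?S"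
    have m: "?m \<in> ?S" using fin False by (rule Max_in)
    have "?S = {..?m}"
    proof
      show "?S \<subseteq> {..?m}" using Max_ge[OF fin] by blast
      show "{..?m} \<subseteq> ?S" using down[OF m] by blast
    qed
    hence "?S = {..<Suc ?m}" by (simp add: lessThan_Suc_atMost)
    thus ?thesis by (metis card_lessThan)
  next
    case True
    show ?thesis unfolding True by simp
  qed
  have "(i, j) \<in> boxes la \<longleftrightarrow> i \<in> ?S" by (simp add: boxes_def)
  also have "\<dots> \<longleftrightarrow> i < card ?S" by (subst eq) simp
  finally show ?thesis by (simp add: conj_part_def)
qed

lemma card_by_columns:
  assumes "finite B" "S \<subseteq> B"
  shows "card S = (\<Sum>j\<in>snd ` B. card {s \<in> S. snd s = j})"
proof -
  have "card S = card (\<Union>j\<in>snd ` B. {s \<in> S. snd s = j})"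
    by (rule arg_cong[of _ _ card]) (use assms in auto)
  also have "\<dots> = (\<Sum>j\<in>snd ` B. card {s \<in> S. snd s = j})"
    using assms finite_subset[OF assms(2,1)] by (intro card_UN_disjoint) auto
  finally show ?thesis .
qed

context
  fixes la :: "nat list" and g :: "nat \<times> nat \<Rightarrow> nat"
  assumes la: "is_partition la"
    and inj: "\<And>s t. s \<in> boxes la \<Longrightarrow> t \<in> boxes la \<Longrightarrow> snd s = snd t \<Longrightarrow> g s = g t \<Longrightarrow> s = t"
begin

text \<open>Injectivity leaves at most \<open>i\<close> boxes of a column with values below
  \<open>i\<close>, and there are at most as many as the column is long. The filling by row numbers
  attains the smaller of the two bounds.\<close>

lemma column_le:
  "card {s \<in> boxes la. g s < i \<and> snd s = j} \<le> card {s \<in> boxes la. fst s < i \<and> snd s = j}"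
proof -
  have "{s \<in> boxes la. fst s < i \<and> snd s = j} = (\<lambda>r. (r, j)) ` {..<min i (conj_part la j)}"
    using boxes_iff_conj_part[OF la] by auto
  hence r: "card {s \<in> boxes la. fst s < i \<and> snd s = j} = min i (conj_part la j)"
    by (simp add: card_image inj_on_def)
  have "{s \<in> boxes la. g s < i \<and> snd s = j} \<subseteq> (\<lambda>r. (r, j)) ` {..<conj_part la j}"
    using boxes_iff_conj_part[OF la] by auto
  from card_mono[OF _ this] have a: "card {s \<in> boxes la. g s < i \<and> snd s = j} \<le> conj_part la j"
    by (simp add: card_image inj_on_def)
  have "card {s \<in> boxes la. g s < i \<and> snd s = j} = card (g ` {s \<in> boxes la. g s < i \<and> snd s = j})"
    using inj by (intro card_image[symmetric] inj_onI) auto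
  also have "\<dots> \<le> card {..<i}" by (rule card_mono) auto
  finally show ?thesis using r a by simp
qed

lemma column_injective_le:
  "card {s \<in> boxes la. g s < i} \<le> sum_list (take i la)"
proof -
  have "card {s \<in> boxes la. g s < i} = (\<Sum>j\<in>snd ` boxes la. card {s \<in> {s \<in> boxes la. g s < i}. snd s = j})"
    by (rule card_by_columns) (auto simp: finite_boxes)
  also have "\<dots> \<le> (\<Sum>j\<in>snd ` boxes la. card {s \<in> {s \<in> boxes la. fst s < i}. snd s = j})"
    using column_le by (intro sum_mono) simp
  also have "\<dots> = card {s \<in> boxes la. fst s < i}"
    by (rule card_by_columns[symmetric]) (auto simp: finite_boxes)
  finally show ?thesis by (simp add: card_boxes_rows)
qed

text \<open>If the total bound is attained, it is attained in every column. With \<open>i\<close>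
  the length of the column of \<open>s\<close>, a value outside the range would make that column
  fall short.\<close>

lemma column_injective_eq:
  assumes "\<And>i. card {s \<in> boxes la. g s < i} = sum_list (take i la)" "s \<in> boxes la"
  shows "g s < conj_part la (snd s)"
proof (rule ccontr)
  let ?j = "snd s" let ?i = "conj_part la ?j"
  assume "\<not> g s < ?i"
  let ?c = "\<lambda>j. card {s \<in> boxes la. g s < ?i \<and> snd s = j}" and ?d = "\<lambda>j. card {s \<in> boxes la. fst s < ?i \<and> snd s = j}"
  have "?c ?j < ?d ?j"
  proof -
    have "{t \<in> boxes la. fst t < ?i \<and> snd t = ?j} = {t \<in> boxes la. snd t = ?j}"
      using boxes_iff_conj_part[OF la] by auto
    moreover have "?c ?j < card {t \<in> boxes la. snd t = ?j}"
    proof (rule psubset_card_mono)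
      show "{t \<in> boxes la. g t < ?i \<and> snd t = ?j} \<subset> {t \<in> boxes la. snd t = ?j}"
        using assms(2) \<open>\<not> g s < ?i\<close> by blast
    qed (simp add: finite_boxes)
    ultimately show ?thesis by simp
  qed
  hence "(\<Sum>j\<in>snd ` boxes la. ?c j) < (\<Sum>j\<in>snd ` boxes la. ?d j)"
    using column_le assms(2) finite_boxes by (intro sum_strict_mono_ex1) auto
  moreover have "(\<Sum>j\<in>snd ` boxes la. ?c j) = card {s \<in> boxes la. g s < ?i}"
    using card_by_columns[of "boxes la" "{s \<in> boxes la. g s < ?i}"] by (simp add: finite_boxes)
  moreover have "(\<Sum>j\<in>snd ` boxes la. ?d j) = card {s \<in> boxes la. fst s < ?i}"
    using card_by_columns[of "boxes la" "{s \<in> boxes la. fst s < ?i}"] by (simp add: finite_boxes)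
  ultimately show False using assms(1)[of ?i] card_boxes_rows[of la ?i] by simp
qed

end

lemma alt_sum_nonzero:
  assumes "finite B" "alt_sum B g \<noteq> 0"
  obtains p where "p \<in> col_perms B" "\<And>s. s \<in> B \<Longrightarrow> g (s, False) = g (p s, True)"
    "\<And>s t. s \<in> B \<Longrightarrow> t \<in> B \<Longrightarrow> snd s = snd t \<Longrightarrow> g (s, False) = g (t, False) \<Longrightarrow> s = t"
proof -
  obtain p where p: "p \<in> col_perms B" "(if \<forall>y\<in>cells B. g (col_pairing B p y) = g y then sgnr p else 0) \<noteq> 0"
    using assms(2) unfolding alt_sum_def by (rule sum.not_neutral_contains_not_neutral)
  show ?thesis
  proof (rule that[OF p(1)])
    show "g (s, False) = g (p s, True)" if "s \<in> B" for s
      using p col_pairing_invariant_iff[OF p(1), of g] that by (auto split: if_splits)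
    show "s = t" if "s \<in> B" "t \<in> B" "snd s = snd t" "g (s, False) = g (t, False)" for s t
      using alt_sum_eq_0[OF assms(1) that(1,2) _ that(3), of g] that(4) assms(2) by blast
  qed
qed

text \<open>The column pairing matches first copies with second copies of equal value, so every
  count of values is twice the count on first copies.\<close>

lemma card_cells_pred:
  assumes "finite B" "p permutes B" "\<And>s. s \<in> B \<Longrightarrow> g (s, False) = g (p s, True)"
  shows "card {y \<in> cells B. P (g y)} = 2 * card {s \<in> B. P (g (s, False))}"
proof -
  let ?S = "{s \<in> B. P (g (s, False))}"
  have "{y \<in> cells B. P (g y)} = (\<lambda>s. (s, False)) ` ?S \<union> (\<lambda>s. (p s, True)) ` ?S"
  proof (intro equalityI subsetI)
    fix y assume y: "y \<in> {y \<in> cells B. P (g y)}"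
    show "y \<in> (\<lambda>s. (s, False)) ` ?S \<union> (\<lambda>s. (p s, True)) ` ?S"
    proof (cases "snd y")
      case True
      have "fst y \<in> p ` B" using y permutes_image[OF assms(2)] by (simp add: mem_cells)
      then obtain s where s: "s \<in> B" "p s = fst y" by (metis imageE)
      have y': "y = (p s, True)" using s True by (cases y) simp
      hence "s \<in> ?S" using y s assms(3)[OF s(1)] by simp
      thus ?thesis using y' by blast
    next
      case False
      hence "y = (fst y, False)" by (cases y) simp
      thus ?thesis using y by (auto simp: mem_cells intro!: image_eqI[of y _ "fst y"])
    qed
  next
    fix y assume "y \<in> (\<lambda>s. (s, False)) ` ?S \<union> (\<lambda>s. (p s, True)) ` ?S"
    thus "y \<in> {y \<in> cells B. P (g y)}"
      using assms(3) permutes_in_image[OF assms(2)] by (auto simp: mem_cells)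
  qed
  also have "card \<dots> = card ((\<lambda>s. (s, False)) ` ?S) + card ((\<lambda>s. (p s, True)) ` ?S)"
    using assms(1) by (intro card_Un_disjoint) auto
  also have "card ((\<lambda>s. (s, False)) ` ?S) = card ?S" by (rule card_image) (simp add: inj_on_def)
  also have "card ((\<lambda>s. (p s, True)) ` ?S) = card ?S"
    using permutes_inj[OF assms(2)] by (intro card_image) (auto simp: inj_on_def)
  finally show ?thesis by simp
qed

lemma alt_sum_dominated:
  assumes "is_partition la" "alt_sum (boxes la) g \<noteq> 0"
  shows "card {y \<in> cells (boxes la). g y < i} \<le> 2 * sum_list (take i la)"
proof -
  obtain p where p: "p \<in> col_perms (boxes la)" "\<And>s. s \<in> boxes la \<Longrightarrow> g (s, False) = g (p s, True)"
    "\<And>s t. s \<in> boxes la \<Longrightarrow> t \<in> boxes la \<Longrightarrow> snd s = snd t \<Longrightarrow> g (s, False) = g (t, False) \<Longrightarrow> s = t"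
    using alt_sum_nonzero[OF finite_boxes assms(2)] by metis
  have "p permutes boxes la" using p(1) by (simp add: col_perms_def)
  from card_cells_pred[OF finite_boxes this p(2)]
  have "card {y \<in> cells (boxes la). g y < i} = 2 * card {s \<in> boxes la. g (s, False) < i}" .
  also have "card {s \<in> boxes la. g (s, False) < i} \<le> sum_list (take i la)"
    using column_injective_le[OF assms(1), of "\<lambda>s. g (s, False)"] p(3) by blast
  finally show ?thesis by simp
qed

lemma card_less_content:
  assumes "finite X" "g ` X \<subseteq> {0..<length \<mu>}" "\<And>j. j < length \<mu> \<Longrightarrow> card {x \<in> X. g x = j} = c * \<mu> ! j"
  shows "card {x \<in> X. g x < i} = c * sum_list (take i \<mu>)"
proof -
  have "{x \<in> X. g x < i} = (\<Union>j<length (take i \<mu>). {x \<in> X. g x = j})" using assms(2) by auto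
  hence "card {x \<in> X. g x < i} = card (\<Union>j<length (take i \<mu>). {x \<in> X. g x = j})" by (rule arg_cong)
  also have "\<dots> = (\<Sum>j<length (take i \<mu>). card {x \<in> X. g x = j})"
    using assms(1) by (intro card_UN_disjoint) auto
  also have "\<dots> = (\<Sum>j<length (take i \<mu>). c * take i \<mu> ! j)"
    using assms(3) by (intro sum.cong) auto
  also have "\<dots> = c * sum_list (take i \<mu>)"
    by (simp add: sum_distrib_left sum_list_sum_nth atLeast0LessThan)
  finally show ?thesis .
qed

lemma zonal_triangular:
  assumes "la \<in> partitions_of n" "\<mu> \<in> partitions_of n" "mcoeff n (zonal (boxes la)) \<mu> \<noteq> 0"
  shows "dominated \<mu> la"
proof -
  have la: "is_partition la" "card (boxes la) = n" using assms(1) by (simp_all add: partitions_of_def card_boxes)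
  have "(\<Sum>A\<in>row_pairings (boxes la). \<Sum>g\<in>{g \<in> {g \<in> cells (boxes la) \<rightarrow>\<^sub>E {0..<length \<mu>}. \<forall>j<length \<mu>. card {x \<in> cells (boxes la). g x = j} = 2 * \<mu> ! j}.
        \<forall>y\<in>cells (boxes la). g (A y) = g y}. alt_sum (boxes la) g) \<noteq> 0"
    using assms(3) mcoeff_zonal[OF finite_boxes la(2)] by simp
  then obtain A where "(\<Sum>g\<in>{g \<in> {g \<in> cells (boxes la) \<rightarrow>\<^sub>E {0..<length \<mu>}. \<forall>j<length \<mu>. card {x \<in> cells (boxes la). g x = j} = 2 * \<mu> ! j}.
        \<forall>y\<in>cells (boxes la). g (A y) = g y}. alt_sum (boxes la) g) \<noteq> 0"
    by (rule sum.not_neutral_contains_not_neutral)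
  then obtain g where g: "g \<in> cells (boxes la) \<rightarrow>\<^sub>E {0..<length \<mu>}"
    "\<And>j. j < length \<mu> \<Longrightarrow> card {x \<in> cells (boxes la). g x = j} = 2 * \<mu> ! j" "alt_sum (boxes la) g \<noteq> 0"
    by (rule sum.not_neutral_contains_not_neutral) (use that in blast)
  have "2 * sum_list (take i \<mu>) \<le> 2 * sum_list (take i la)" for i
  proof -
    have "g ` cells (boxes la) \<subseteq> {0..<length \<mu>}" using g(1) by (auto simp: PiE_def Pi_def)
    from card_less_content[OF finite_cells[OF finite_boxes] this g(2)] show ?thesis
      using alt_sum_dominated[OF la(1) g(3), of i] by simp
  qed
  thus ?thesis using assms(1,2) by (simp add: dominated_def partitions_of_def)
qed

section \<open>Orthogonality\<close>

lemma lps_commute: "lps X A B = lps X B A"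
  by (simp add: lps_def adj_def Un_commute)

lemma ltype_commute: "ltype X A B = ltype X B A"
  by (simp add: ltype_def lps_commute)

lemma prod_falling_fact: "(\<Prod>j<c. c - j) = (fact c :: nat)"
  by (simp add: fact_prod_rev atLeast0LessThan)

lemma zee_pow2:
  "zee \<rho> * 2 ^ length \<rho> = real (\<Prod>i\<in>set \<rho>. (2 * i) ^ count (mset \<rho>) i * fact (count (mset \<rho>) i))"
proof -
  have "(\<Prod>i\<in>set \<rho>. (2 :: real) ^ count (mset \<rho>) i) = 2 ^ (\<Sum>i\<in>set \<rho>. count (mset \<rho>) i)"
    by (simp add: power_sum)
  also have "(\<Sum>i\<in>set \<rho>. count (mset \<rho>) i) = length \<rho>"
    by (metis set_mset_mset size_mset size_multiset_overloaded_eq)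
  finally show ?thesis
    by (simp add: zee_def mult_def prod.distrib power_mult_distrib)
qed

lemma card_embs_same_type:
  assumes "pairings X A B" "pairings Y A' B'" "ltype X A B = mset \<rho>" "ltype Y A' B' = mset \<rho>"
  shows "real (card (embs X A B Y A' B')) = zee \<rho> * 2 ^ length \<rho>"
  unfolding zee_pow2 card_embs[OF assms(1,2) finite_set[of \<rho>], unfolded assms(3,4), simplified]
  by (simp add: prod_falling_fact)

text \<open>With equal sizes and positive parts, a type contained in another one equals it. So some
  part occurs more often in the source, and its truncated falling product has a zero factor.\<close>

lemma card_embs_other_type:
  assumes "pairings X A B" "pairings Y A' B'" "card X = card Y" "ltype X A B \<noteq> ltype Y A' B'"
  shows "card (embs X A B Y A' B') = 0"
proof -
  interpret p: pairings X A B by fact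
  interpret q: pairings Y A' B' by fact
  let ?T = "ltype X A B" and ?M = "ltype Y A' B'"
  have "\<not> ?T \<subseteq># ?M"
  proof
    assume sub: "?T \<subseteq># ?M"
    then obtain N where N: "?M = ?T + N" by (auto simp: mset_subset_eq_exists_conv)
    have "sum_mset ?M = sum_mset ?T" using p.sum_ltype q.sum_ltype assms(3) by simp
    hence "sum_mset N = 0" using N by simp
    moreover have "0 \<notin># N" using q.ltype_pos N by auto
    ultimately have "N = {#}" by (cases N) auto
    thus False using N assms(4) by simp
  qed
  then obtain i where i: "count ?M i < count ?T i" by (auto simp: subseteq_mset_def not_le)
  have "(\<Prod>j<count ?T i. count ?M i - j) = 0" using i by (intro prod_zero) auto
  moreover have "i \<in># ?T" using i by (metis count_inI gr_implies_not0)
  ultimately have "(\<Prod>i\<in>set_mset ?T. (2 * i) ^ count ?T i * (\<Prod>j<count ?T i. count ?M i - j)) = 0"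
    by (intro prod_zero) auto
  thus ?thesis using card_embs[OF assms(1,2), of "set_mset ?T"] by simp
qed

text \<open>The shape of the regrouping in \<open>zonal_scalar\<close>: a column permutation of one
  diagram is coupled with a row pairing of the other.\<close>

lemma sum_factor:
  fixes F :: "'p \<Rightarrow> 'q \<Rightarrow> 'f \<Rightarrow> real"
  shows "(\<Sum>p\<in>P. \<Sum>A\<in>R. \<Sum>p'\<in>P'. \<Sum>A'\<in>R'. \<Sum>f\<in>\<Phi>. F p A' f * G A p' f) =
    (\<Sum>f\<in>\<Phi>. (\<Sum>p\<in>P. \<Sum>A'\<in>R'. F p A' f) * (\<Sum>A\<in>R. \<Sum>p'\<in>P'. G A p' f))"
proof -
  have "(\<Sum>f\<in>\<Phi>. (\<Sum>p\<in>P. \<Sum>A'\<in>R'. F p A' f) * (\<Sum>A\<in>R. \<Sum>p'\<in>P'. G A p' f)) =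
     (\<Sum>f\<in>\<Phi>. \<Sum>p\<in>P. \<Sum>A\<in>R. \<Sum>p'\<in>P'. \<Sum>A'\<in>R'. F p A' f * G A p' f)"
    by (simp only: sum_distrib_right) (simp only: sum_distrib_left, rule sum.cong[OF refl], rule sum.cong[OF refl],
      subst sum.swap, rule sum.cong[OF refl], subst sum.swap, rule refl)
  also have "\<dots> = (\<Sum>p\<in>P. \<Sum>A\<in>R. \<Sum>p'\<in>P'. \<Sum>A'\<in>R'. \<Sum>f\<in>\<Phi>. F p A' f * G A p' f)"
    by (subst sum.swap, rule sum.cong[OF refl], subst sum.swap, rule sum.cong[OF refl],
        subst sum.swap, rule sum.cong[OF refl], rule sum.swap)
  finally show ?thesis by simp
qed

text \<open>Given \<open>p\<close>, the only candidate for \<open>A\<close> is the column pairing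
  transported by \<open>f\<close>. It preserves rows exactly if the row numbers of the images are
  invariant under the column pairing, so the inner sum collapses to the condition in
  \<open>alt_sum\<close>.\<close>

lemma sum_row_pairings_equivariant:
  assumes "finite B" "finite B'" and bij: "bij_betw f (cells B) (cells B')"
  shows "(\<Sum>p\<in>col_perms B. \<Sum>A\<in>row_pairings B'. if \<forall>y\<in>cells B. f (col_pairing B p y) = A (f y) then sgnr p else 0) =
    alt_sum B (\<lambda>y. fst (fst (f y)))"
  unfolding alt_sum_def
proof (rule sum.cong[OF refl])
  fix p assume p: "p \<in> col_perms B"
  let ?c = "col_pairing B p" and ?i = "inv_into (cells B) f"
  let ?eq = "\<lambda>A. \<forall>y\<in>cells B. f (?c y) = A (f y)"
  let ?row = "\<forall>y\<in>cells B. fst (fst (f (?c y))) = fst (fst (f y))"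
  note pc = pairingD[OF pairing_col_pairing[OF p]]
  have f: "f y \<in> cells B'" if "y \<in> cells B" for y using bij that by (auto simp: bij_betw_def)
  have i1: "?i (f y) = y" if "y \<in> cells B" for y using bij that by (simp add: bij_betw_def)
  have i2: "?i z \<in> cells B" "f (?i z) = z" if "z \<in> cells B'" for z
    using bij that by (simp_all add: bij_betw_def f_inv_into_f inv_into_into)
  define A0 where "A0 z = (if z \<in> cells B' then f (?c (?i z)) else z)" for z
  show "(\<Sum>A\<in>row_pairings B'. if ?eq A then sgnr p else 0) = (if ?row then sgnr p else 0)"
  proof (cases ?row)
    case True
    have A0: "A0 \<in> row_pairings B'"
    proof -
      have "A0 z \<in> cells B'" "A0 (A0 z) = z" "A0 z \<noteq> z" if "z \<in> cells B'" for z
      proof -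
        have ci: "?c (?i z) \<in> cells B" using pc(1) i2(1)[OF that] .
        show "A0 z \<in> cells B'" using that f[OF ci] by (simp add: A0_def)
        show "A0 (A0 z) = z" using that f[OF ci] i1[OF ci] pc(3) i2(2)[OF that] by (simp add: A0_def)
        show "A0 z \<noteq> z" using that i1[OF ci] pc(2)[OF i2(1)[OF that]] by (auto simp: A0_def)
      qed
      moreover have "fst (fst (A0 z)) = fst (fst z)" for z using True i2 by (auto simp: A0_def)
      ultimately show ?thesis by (simp add: row_pairings_def pairing_def A0_def)
    qed
    have "?eq A \<longleftrightarrow> A = A0" if A: "A \<in> row_pairings B'" for A
    proof
      assume e: "?eq A"
      show "A = A0"
      proof
        fix z
        have "pairing (cells B') A" using A by (simp add: row_pairings_def)
        hence "A z = z" if "z \<notin> cells B'" using pairingD(4) that by metis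
        thus "A z = A0 z" using bspec[OF e, of "?i z"] i2[of z] by (auto simp: A0_def)
      qed
    next
      assume "A = A0"
      thus "?eq A" using f i1 by (simp add: A0_def)
    qed
    hence "(\<Sum>A\<in>row_pairings B'. if ?eq A then sgnr p else 0) = (\<Sum>A\<in>row_pairings B'. if A = A0 then sgnr p else 0)"
      by (intro sum.cong) auto
    thus ?thesis using True A0 finite_row_pairings[OF assms(2)] by simp
  next
    case False
    have "\<not> ?eq A" if "A \<in> row_pairings B'" for A
    proof
      assume e: "?eq A"
      have "fst (fst (A y)) = fst (fst y)" for y using that unfolding row_pairings_def by blast
      hence ?row using e by metis
      thus False using False by simp
    qed
    hence "(\<Sum>A\<in>row_pairings B'. if ?eq A then sgnr p else 0) = 0" by (intro sum.neutral) auto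
    thus ?thesis using False by (simp only: if_False)
  qed
qed

text \<open>The weight \<open>zee \<rho> * 2 ^ length \<rho>\<close> counts the isomorphisms between
  two pairs of type \<open>\<rho>\<close>. The second pair is taken in the opposite order, which
  leaves its type unchanged: the column pairing of \<open>B\<close> meets a row pairing of
  \<open>B'\<close>, and conversely. For a fixed bijection \<open>f\<close> the four sums then
  separate into two independent factors.\<close>

lemma zonal_scalar:
  assumes "finite B" "card B = n" "finite B'" "card B' = n"
  shows "jack_scalar 2 n (zonal B) (zonal B') =
    (\<Sum>f\<in>{f \<in> cells B \<rightarrow>\<^sub>E cells B'. inj_on f (cells B)}.
       alt_sum B (\<lambda>y. fst (fst (f y))) * alt_sum B' (\<lambda>y. fst (fst (inv_into (cells B) f y))))"
proof -
  let ?the = "\<lambda>p A. THE \<rho>. \<rho> \<in> partitions_of n \<and> mset \<rho> = ltype (cells B) (col_pairing B p) A"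
  let ?the' = "\<lambda>p A. THE \<rho>. \<rho> \<in> partitions_of n \<and> mset \<rho> = ltype (cells B') (col_pairing B' p) A"
  let ?z = "\<lambda>\<rho>. zee \<rho> * 2 ^ length \<rho>"
  let ?\<Phi> = "{f \<in> cells B \<rightarrow>\<^sub>E cells B'. inj_on f (cells B)}"
  have c: "card (cells B) = 2 * n" "card (cells B') = 2 * n" using assms by (simp_all add: card_cells)
  have fin: "finite ?\<Phi>"
    by (rule finite_subset[of _ "cells B \<rightarrow>\<^sub>E cells B'"]) (auto intro!: finite_PiE finite_cells assms)
  let ?F = "\<lambda>p A' f. if \<forall>y\<in>cells B. f (col_pairing B p y) = A' (f y) then sgnr p else 0"
  let ?G = "\<lambda>A p' f. if \<forall>y\<in>cells B. f (A y) = col_pairing B' p' (f y) then sgnr p' else 0"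
  have "jack_scalar 2 n (zonal B) (zonal B') = (\<Sum>\<rho>\<in>partitions_of n. zonal B \<rho> * (zonal B' \<rho> * ?z \<rho>))"
    by (simp add: jack_scalar_def algebra_simps)
  also have "\<dots> = (\<Sum>p\<in>col_perms B. \<Sum>A\<in>row_pairings B. sgnr p * (zonal B' (?the p A) * ?z (?the p A)))"
    by (rule zonal_sum_against[OF assms(1,2)])
  also have "\<dots> = (\<Sum>p\<in>col_perms B. \<Sum>A\<in>row_pairings B. \<Sum>p'\<in>col_perms B'. \<Sum>A'\<in>row_pairings B'.
      sgnr p * sgnr p' * real (card (embs (cells B) (col_pairing B p) A (cells B') A' (col_pairing B' p'))))"
  proof (intro sum.cong refl)
    fix p A assume pA: "p \<in> col_perms B" "A \<in> row_pairings B"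
    have ps: "pairings (cells B) (col_pairing B p) A" using pairings_cells[OF assms(1) pA] .
    have t: "mset (?the p A) = ltype (cells B) (col_pairing B p) A"
      using theI'[OF sum_ltype_select(2)[OF ps c(1)]] by simp
    have "(if ltype (cells B') (col_pairing B' p') A' = mset (?the p A) then sgnr p' else 0) * ?z (?the p A) =
      sgnr p' * real (card (embs (cells B) (col_pairing B p) A (cells B') A' (col_pairing B' p')))"
      if pA': "p' \<in> col_perms B'" "A' \<in> row_pairings B'" for p' A'
    proof -
      have ps': "pairings (cells B') A' (col_pairing B' p')"
        using pairings_cells[OF assms(3) pA'] by (simp add: pairings_def)
      show ?thesis
      proof (cases "ltype (cells B') (col_pairing B' p') A' = mset (?the p A)")
        case True
        hence "ltype (cells B') A' (col_pairing B' p') = mset (?the p A)" by (simp add: ltype_commute[of _ A'])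
        from card_embs_same_type[OF ps ps' t[symmetric] this] show ?thesis using True by simp
      next
        case False
        hence "ltype (cells B) (col_pairing B p) A \<noteq> ltype (cells B') A' (col_pairing B' p')"
          using t by (metis ltype_commute)
        from card_embs_other_type[OF ps ps' _ this] show ?thesis using False c by simp
      qed
    qed
    thus "sgnr p * (zonal B' (?the p A) * ?z (?the p A)) = (\<Sum>p'\<in>col_perms B'. \<Sum>A'\<in>row_pairings B'.
      sgnr p * sgnr p' * real (card (embs (cells B) (col_pairing B p) A (cells B') A' (col_pairing B' p'))))"
      unfolding zonal_def sum_distrib_right sum_distrib_left
      by (intro sum.cong refl) (simp only: mult.assoc)
  qed
  also have "\<dots> = (\<Sum>p\<in>col_perms B. \<Sum>A\<in>row_pairings B. \<Sum>p'\<in>col_perms B'. \<Sum>A'\<in>row_pairings B'. \<Sum>f\<in>?\<Phi>. ?F p A' f * ?G A p' f)"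
  proof (intro sum.cong refl)
    fix p A p' A'
    let ?P = "\<lambda>f. \<forall>y\<in>cells B. f (col_pairing B p y) = A' (f y) \<and> f (A y) = col_pairing B' p' (f y)"
    have "embs (cells B) (col_pairing B p) A (cells B') A' (col_pairing B' p') = {f \<in> ?\<Phi>. ?P f}"
      by (auto simp: embs_def)
    hence "real (card (embs (cells B) (col_pairing B p) A (cells B') A' (col_pairing B' p'))) = (\<Sum>f\<in>?\<Phi>. if ?P f then 1 else 0)"
      using real_card_sum_indicator[OF fin, of ?P] by simp
    also have "sgnr p * sgnr p' * \<dots> = (\<Sum>f\<in>?\<Phi>. ?F p A' f * ?G A p' f)"
      unfolding sum_distrib_left by (intro sum.cong refl) auto
    finally show "sgnr p * sgnr p' * real (card (embs (cells B) (col_pairing B p) A (cells B') A' (col_pairing B' p'))) =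
      (\<Sum>f\<in>?\<Phi>. ?F p A' f * ?G A p' f)" .
  qed
  also have "\<dots> = (\<Sum>f\<in>?\<Phi>. (\<Sum>p\<in>col_perms B. \<Sum>A'\<in>row_pairings B'. ?F p A' f) * (\<Sum>A\<in>row_pairings B. \<Sum>p'\<in>col_perms B'. ?G A p' f))"
    by (rule sum_factor)
  also have "\<dots> = (\<Sum>f\<in>?\<Phi>. alt_sum B (\<lambda>y. fst (fst (f y))) * alt_sum B' (\<lambda>y. fst (fst (inv_into (cells B) f y))))"
  proof (rule sum.cong[OF refl])
    fix f assume f: "f \<in> ?\<Phi>"
    have img: "f ` cells B = cells B'"
    proof (rule card_subset_eq)
      show "card (f ` cells B) = card (cells B')" using f c by (simp add: card_image)
    qed (use f finite_cells assms in auto)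
    have bij: "bij_betw f (cells B) (cells B')" using f img by (simp add: bij_betw_def)
    let ?i = "inv_into (cells B) f"
    have bij': "bij_betw ?i (cells B') (cells B)" using bij by (rule bij_betw_inv_into)
    have "(\<Sum>A\<in>row_pairings B. \<Sum>p'\<in>col_perms B'. ?G A p' f) = (\<Sum>p'\<in>col_perms B'. \<Sum>A\<in>row_pairings B. ?G A p' f)"
      by (rule sum.swap)
    also have "\<dots> = (\<Sum>p'\<in>col_perms B'. \<Sum>A\<in>row_pairings B. if \<forall>z\<in>cells B'. ?i (col_pairing B' p' z) = A (?i z) then sgnr p' else 0)"
    proof (intro sum.cong refl)
      fix p' A assume pA: "p' \<in> col_perms B'" "A \<in> row_pairings B"
      have A: "A y \<in> cells B" if "y \<in> cells B" for y using pA(2) that by (simp add: row_pairings_def pairing_def)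
      have p': "col_pairing B' p' z \<in> cells B'" if "z \<in> cells B'" for z
        using pairingD(1)[OF pairing_col_pairing[OF pA(1)] that] .
      have "(\<forall>z\<in>cells B'. ?i (col_pairing B' p' z) = A (?i z)) \<longleftrightarrow> (\<forall>z\<in>f ` cells B. ?i (col_pairing B' p' z) = A (?i z))"
        using img by simp
      also have "\<dots> \<longleftrightarrow> (\<forall>y\<in>cells B. ?i (col_pairing B' p' (f y)) = A y)" using f by simp
      also have "\<dots> \<longleftrightarrow> (\<forall>y\<in>cells B. f (A y) = col_pairing B' p' (f y))"
      proof (intro ball_cong refl)
        fix y assume y: "y \<in> cells B"
        have "f y \<in> cells B'" using img y by blast
        hence z: "col_pairing B' p' (f y) \<in> f ` cells B" using p' img by simp
        show "?i (col_pairing B' p' (f y)) = A y \<longleftrightarrow> f (A y) = col_pairing B' p' (f y)"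
        proof
          assume "f (A y) = col_pairing B' p' (f y)"
          thus "?i (col_pairing B' p' (f y)) = A y"
            using inv_into_f_f[of f "cells B" "A y"] f A[OF y] by (metis (lifting) mem_Collect_eq)
        qed (use f_inv_into_f[OF z] in auto)
      qed
      finally show "?G A p' f = (if \<forall>z\<in>cells B'. ?i (col_pairing B' p' z) = A (?i z) then sgnr p' else 0)" by simp
    qed
    also have "\<dots> = alt_sum B' (\<lambda>y. fst (fst (?i y)))"
      by (rule sum_row_pairings_equivariant[OF assms(3,1) bij'])
    finally show "(\<Sum>p\<in>col_perms B. \<Sum>A'\<in>row_pairings B'. ?F p A' f) * (\<Sum>A\<in>row_pairings B. \<Sum>p'\<in>col_perms B'. ?G A p' f) =
      alt_sum B (\<lambda>y. fst (fst (f y))) * alt_sum B' (\<lambda>y. fst (fst (?i y)))"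
      using sum_row_pairings_equivariant[OF assms(1,3) bij] by simp
  qed
  finally show ?thesis .
qed

lemma card_cells_rows: "card {y \<in> cells (boxes la). fst (fst y) < i} = 2 * sum_list (take i la)"
proof -
  have "{y \<in> cells (boxes la). fst (fst y) < i} = {s \<in> boxes la. fst s < i} \<times> UNIV"
    by (auto simp: cells_def)
  thus ?thesis by (simp add: card_cartesian_product card_boxes_rows)
qed

text \<open>Label each cell of \<open>la\<close> by the row of its image. The label \<open>i\<close>
  occurs \<open>2 * \<mu> ! i\<close> times, so a non-zero alternating sum forces dominance just as
  it does for monomials.\<close>

lemma alt_sum_row_dominated:
  assumes "la \<in> partitions_of n" "\<mu> \<in> partitions_of n" "bij_betw f (cells (boxes la)) (cells (boxes \<mu>))"
    "alt_sum (boxes la) (\<lambda>y. fst (fst (f y))) \<noteq> 0"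
  shows "dominated \<mu> la"
proof -
  have "sum_list (take i \<mu>) \<le> sum_list (take i la)" for i
  proof -
    have "bij_betw f {y \<in> cells (boxes la). fst (fst (f y)) < i} {y \<in> cells (boxes \<mu>). fst (fst y) < i}"
      unfolding bij_betw_def
    proof
      show "inj_on f {y \<in> cells (boxes la). fst (fst (f y)) < i}"
        using assms(3) by (auto simp: bij_betw_def intro: inj_on_subset)
      have e: "f ` cells (boxes la) = cells (boxes \<mu>)" using assms(3) by (simp add: bij_betw_def)
      show "f ` {y \<in> cells (boxes la). fst (fst (f y)) < i} = {y \<in> cells (boxes \<mu>). fst (fst y) < i}"
      proof (intro equalityI subsetI)
        fix z assume z: "z \<in> {y \<in> cells (boxes \<mu>). fst (fst y) < i}"
        then obtain y where "y \<in> cells (boxes la)" "z = f y" using e by (metis (lifting) imageE mem_Collect_eq)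
        thus "z \<in> f ` {y \<in> cells (boxes la). fst (fst (f y)) < i}" using z by simp
      next
        fix z assume "z \<in> f ` {y \<in> cells (boxes la). fst (fst (f y)) < i}"
        then obtain y where "y \<in> cells (boxes la)" "fst (fst (f y)) < i" "z = f y" by (elim imageE CollectE conjE) (rule that)
        thus "z \<in> {y \<in> cells (boxes \<mu>). fst (fst y) < i}" using e by (metis (lifting) imageI mem_Collect_eq)
      qed
    qed
    hence "card {y \<in> cells (boxes la). fst (fst (f y)) < i} = 2 * sum_list (take i \<mu>)"
      using bij_betw_same_card[of f] card_cells_rows[of \<mu> i] by simp
    thus ?thesis using alt_sum_dominated[OF _ assms(4), of i] assms(1) by (simp add: partitions_of_def)
  qed
  thus ?thesis using assms(1,2) by (simp add: dominated_def partitions_of_def)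
qed

text \<open>A non-zero summand would give dominance in one direction from \<open>f\<close> and in
  the other from its inverse.\<close>

lemma zonal_orthogonal:
  assumes "la \<in> partitions_of n" "\<mu> \<in> partitions_of n" "la \<noteq> \<mu>"
  shows "jack_scalar 2 n (zonal (boxes la)) (zonal (boxes \<mu>)) = 0"
proof -
  have c: "card (boxes la) = n" "card (boxes \<mu>) = n" using assms by (simp_all add: partitions_of_def card_boxes)
  let ?X = "cells (boxes la)" and ?Y = "cells (boxes \<mu>)"
  have "alt_sum (boxes la) (\<lambda>y. fst (fst (f y))) * alt_sum (boxes \<mu>) (\<lambda>y. fst (fst (inv_into ?X f y))) = 0"
    if f: "f \<in> ?X \<rightarrow>\<^sub>E ?Y" "inj_on f ?X" for f
  proof (rule ccontr)
    assume *: "\<not> ?thesis"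
    have "f ` ?X = ?Y"
    proof (rule card_subset_eq)
      show "card (f ` ?X) = card ?Y" using f(2) c by (simp add: card_image card_cells finite_boxes)
    qed (use f finite_cells[OF finite_boxes] in auto)
    hence bij: "bij_betw f ?X ?Y" using f(2) by (simp add: bij_betw_def)
    have "dominated \<mu> la" using alt_sum_row_dominated[OF assms(1,2) bij] * by simp
    moreover have "dominated la \<mu>"
      using alt_sum_row_dominated[OF assms(2,1) bij_betw_inv_into[OF bij]] * by simp
    ultimately show False using dominated_antisym assms by blast
  qed
  thus ?thesis unfolding zonal_scalar[OF finite_boxes c(1) finite_boxes c(2)] by (intro sum.neutral) blast
qed

section \<open>Normalization\<close>

text \<open>The prescribed content is replaced by one bound per column. As \<open>h\<close> does not
  depend on \<open>B\<close>, it can remain that of the full diagram while \<open>B\<close> loses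
  boxes.\<close>

definition fills :: "(nat \<Rightarrow> nat) \<Rightarrow> (nat \<times> nat) set \<Rightarrow> (nat \<times> nat \<Rightarrow> nat \<times> nat) \<Rightarrow>
    ((nat \<times> nat) \<times> bool \<Rightarrow> (nat \<times> nat) \<times> bool) \<Rightarrow> ((nat \<times> nat) \<times> bool \<Rightarrow> nat) set" where
  "fills h B p A = {g \<in> Pi\<^sub>E (cells B) (\<lambda>y. {..<h (snd (fst y))}).
     (\<forall>s\<in>B. g (s, False) = g (p s, True)) \<and> (\<forall>y\<in>cells B. g (A y) = g y)}"

definition signed_fills :: "(nat \<Rightarrow> nat) \<Rightarrow> (nat \<times> nat) set \<Rightarrow> real" where
  "signed_fills h B = (\<Sum>p\<in>col_perms B. \<Sum>A\<in>row_pairings B. sgnr p * real (card (fills h B p A)))"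

lemma finite_fills: "finite B \<Longrightarrow> finite (fills h B p A)"
  unfolding fills_def
  by (rule finite_subset[of _ "Pi\<^sub>E (cells B) (\<lambda>y. {..<h (snd (fst y))})"]) (auto intro!: finite_PiE finite_cells)

lemma col_permsD:
  assumes "p \<in> col_perms B"
  shows "p permutes B" "snd (p s) = snd s"
  using assms unfolding col_perms_def by blast+

lemma fillsD:
  assumes "g \<in> fills h B p A"
  shows "y \<in> cells B \<Longrightarrow> g y < h (snd (fst y))" "y \<notin> cells B \<Longrightarrow> g y = undefined"
    "s \<in> B \<Longrightarrow> g (s, False) = g (p s, True)" "y \<in> cells B \<Longrightarrow> g (A y) = g y"
proof -
  have g: "g \<in> Pi\<^sub>E (cells B) (\<lambda>y. {..<h (snd (fst y))})" using assms unfolding fills_def by blast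
  show "y \<in> cells B \<Longrightarrow> g y < h (snd (fst y))" using PiE_mem[OF g] by blast
  show "y \<notin> cells B \<Longrightarrow> g y = undefined" using PiE_arb[OF g] by blast
  show "s \<in> B \<Longrightarrow> g (s, False) = g (p s, True)" "y \<in> cells B \<Longrightarrow> g (A y) = g y"
    using assms unfolding fills_def by blast+
qed

lemma fillsI:
  assumes "\<And>y. y \<in> cells B \<Longrightarrow> g y < h (snd (fst y))" "\<And>y. y \<notin> cells B \<Longrightarrow> g y = undefined"
    "\<And>s. s \<in> B \<Longrightarrow> g (s, False) = g (p s, True)" "\<And>y. y \<in> cells B \<Longrightarrow> g (A y) = g y"
  shows "g \<in> fills h B p A"
proof -
  have "g \<in> Pi\<^sub>E (cells B) (\<lambda>y. {..<h (snd (fst y))})"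
    by (rule PiE_I) (use assms in blast)+
  thus ?thesis using assms unfolding fills_def by blast
qed

lemma row_pairingsD:
  assumes "A \<in> row_pairings B"
  shows "pairing (cells B) A" "fst (fst (A y)) = fst (fst y)"
  using assms unfolding row_pairings_def by blast+

lemma swap_simps:
  "swap a b a = b" "swap a b b = a"
  "x \<noteq> a \<Longrightarrow> x \<noteq> b \<Longrightarrow> swap a b x = x"
  by simp_all

lemma transpose_conj_pairing:
  assumes "pairing X A" "u \<in> X" "v \<in> X"
  shows "pairing X (swap u v \<circ> A \<circ> swap u v)"
proof -
  let ?t = "swap u v"
  have t: "?t permutes X" using assms by (simp add: permutes_swap_id)
  have m: "?t x \<in> X \<longleftrightarrow> x \<in> X" for x using permutes_in_image[OF t] .
  have i: "?t (?t x) = x" for x by simp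
  show ?thesis unfolding pairing_def
  proof (intro conjI ballI allI impI)
    fix x assume "x \<in> X"
    thus "(?t \<circ> A \<circ> ?t) x \<in> X" using m pairingD(1)[OF assms(1)] by simp
    show "(?t \<circ> A \<circ> ?t) x \<noteq> x" using \<open>x \<in> X\<close> m pairingD(2)[OF assms(1), of "?t x"] i by (metis comp_apply)
    show "(?t \<circ> A \<circ> ?t) ((?t \<circ> A \<circ> ?t) x) = x" using pairingD(3)[OF assms(1)] by simp
  next
    fix x assume "x \<notin> X"
    hence "A (?t x) = ?t x" using m pairingD(4)[OF assms(1)] by simp
    thus "(?t \<circ> A \<circ> ?t) x = x" by simp
  qed
qed

lemma transpose_conj_row_pairing:
  assumes "A \<in> row_pairings B" "u \<in> cells B" "v \<in> cells B" "fst (fst u) = fst (fst v)"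
  shows "swap u v \<circ> A \<circ> swap u v \<in> row_pairings B"
proof -
  have "fst (fst (swap u v y)) = fst (fst y)" for y
    using assms(4) by (cases "y = u"; cases "y = v") simp_all
  thus ?thesis
    using transpose_conj_pairing[OF row_pairingsD(1)[OF assms(1)] assms(2,3)] row_pairingsD(2)[OF assms(1)]
    by (simp add: row_pairings_def)
qed

text \<open>Removal of the box \<open>(k, j)\<close>, where \<open>k\<close> is the lowest row of column \<open>j\<close>. A column permutation of \<open>B\<close> is one
  of \<open>B'\<close> together with the image \<open>t\<close> of the box, and a row pairing is one of \<open>B'\<close> together with the
  partner \<open>c\<close> of the first copy \<open>a\<close> of the box.\<close>
locale box_removal =
  fixes B :: "(nat \<times> nat) set" and h :: "nat \<Rightarrow> nat" and k j :: nat
  assumes fin: "finite B"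
    and row: "\<And>s. s \<in> B \<Longrightarrow> fst s = k \<Longrightarrow> h (snd s) \<le> h j"
    and col: "{s \<in> B. snd s = j} = (\<lambda>i. (i, j)) ` {..k}"
    and down: "\<And>s i. s \<in> B \<Longrightarrow> fst s = k \<Longrightarrow> i < k \<Longrightarrow> (i, snd s) \<in> B"
begin

definition s0 where "s0 = (k, j)"
definition B' where "B' = B - {s0}"
definition a where "a = (s0, False)"
definition b where "b = (s0, True)"
definition COL where "COL = {s \<in> B. snd s = j}"
definition ROW where "ROW = {y \<in> cells B. fst (fst y) = k} - {a}"

lemma s0_B: "s0 \<in> B"
proof -
  have "(k, j) \<in> {s \<in> B. snd s = j}" unfolding col by simp
  thus ?thesis by (simp add: s0_def)
qed

lemma ab: "a \<in> cells B" "b \<in> cells B" "a \<noteq> b" "a \<notin> cells B'" "b \<notin> cells B'"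
  "fst (fst a) = k" "fst (fst b) = k" "b \<in> ROW"
  by (auto simp: a_def b_def mem_cells s0_B[unfolded s0_def] B'_def ROW_def s0_def)

lemma finB': "finite B'"
  using fin by (simp add: B'_def)

lemma cellsB': "y \<in> cells B \<longleftrightarrow> y \<in> cells B' \<or> y = a \<or> y = b"
  using s0_B by (cases y) (auto simp: mem_cells B'_def a_def b_def)

lemma ball_B: "(\<forall>s\<in>B. Q s) \<longleftrightarrow> Q s0 \<and> (\<forall>s\<in>B'. Q s)"
  using s0_B unfolding B'_def by blast

lemma ball_cells_B: "(\<forall>y\<in>cells B. Q y) \<longleftrightarrow> Q a \<and> Q b \<and> (\<forall>y\<in>cells B'. Q y)"
  using cellsB' by metis

lemma ROW_iff: "c \<in> ROW \<longleftrightarrow> c = b \<or> c \<in> cells B' \<and> fst (fst c) = k"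
  using ab cellsB' unfolding ROW_def by auto

lemma COL_iff: "t \<in> COL \<longleftrightarrow> t = s0 \<or> t \<in> B' \<and> snd t = j"
  using s0_B by (auto simp: COL_def B'_def s0_def)

lemma COL_lt: "t \<in> COL \<Longrightarrow> t \<noteq> s0 \<Longrightarrow> fst t < k"
  using col by (auto simp: COL_def s0_def)

lemma card_COL: "card COL = Suc k"
  unfolding COL_def col by (subst card_image) (auto simp: inj_on_def)

lemma card_ROW: "card ROW = 2 * card {s \<in> B'. fst s = k} + 1"
proof -
  have "ROW = insert b ({s \<in> B'. fst s = k} \<times> UNIV)"
    by (auto simp: ROW_iff mem_cells)
  moreover have "b \<notin> {s \<in> B'. fst s = k} \<times> UNIV" using ab(5) by (auto simp: mem_cells b_def)
  ultimately show ?thesis using finB' by (simp add: card_cartesian_product)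
qed

text \<open>Coset decomposition of the column group with respect to the stabilizer of the box, with
  the transpositions \<open>swap s0 t\<close> as representatives.\<close>

lemma col_perms_reindex:
  "(\<Sum>p\<in>col_perms B. f p) = (\<Sum>t\<in>COL. \<Sum>p\<in>col_perms B'. f (swap s0 t \<circ> p) :: real)"
proof -
  have "(\<Sum>p\<in>col_perms B. f p) = (\<Sum>(t, p)\<in>COL \<times> col_perms B'. f (swap s0 t \<circ> p))"
  proof (rule sum.reindex_bij_witness[where j = "\<lambda>p. (p s0, swap s0 (p s0) \<circ> p)"
        and i = "\<lambda>(t, p). swap s0 t \<circ> p"])
    fix p assume p: "p \<in> col_perms B"
    note pD = col_permsD[OF p]
    show "(case (p s0, swap s0 (p s0) \<circ> p) of (t, p) \<Rightarrow> swap s0 t \<circ> p) = p"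
      by (simp add: o_assoc)
    have t: "p s0 \<in> B" "snd (p s0) = j" using pD s0_B permutes_in_image[OF pD(1)] by (simp_all add: s0_def)
    let ?q = "swap s0 (p s0) \<circ> p"
    have "?q permutes insert s0 B'"
      using permutes_compose[OF pD(1) permutes_swap_id[OF s0_B t(1)]] s0_B by (simp add: B'_def insert_absorb)
    hence "?q permutes B'" by (rule permutes_superset) auto
    moreover have "snd (?q s) = snd s" for s
      using pD(2)[of s] pD(2)[of s0] by (cases "p s = s0"; cases "p s = p s0") auto
    ultimately show "(p s0, ?q) \<in> COL \<times> col_perms B'"
      using t by (simp add: COL_def col_perms_def)
    show "(case (p s0, ?q) of (t, p) \<Rightarrow> f (swap s0 t \<circ> p)) = f p"
      by (simp add: o_assoc)
  next
    fix tp assume "tp \<in> COL \<times> col_perms B'"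
    then obtain t p where tp: "tp = (t, p)" "t \<in> COL" "p \<in> col_perms B'" by auto
    note pD = col_permsD[OF tp(3)]
    have "s0 \<notin> B'" by (simp add: B'_def)
    hence ps: "p s0 = s0" using pD(1) by (simp add: permutes_not_in)
    have t: "t \<in> B" "snd t = snd s0" using tp(2) by (auto simp: COL_def s0_def)
    have "p permutes B" using pD(1) by (rule permutes_subset) (auto simp: B'_def)
    hence "swap s0 t \<circ> p permutes B"
      using permutes_swap_id[OF s0_B t(1)] by (rule permutes_compose)
    moreover have "snd (swap s0 t (p s)) = snd s" for s
      using pD(2)[of s] t(2) by (cases "p s = s0"; cases "p s = t") auto
    ultimately show "(case tp of (t, p) \<Rightarrow> swap s0 t \<circ> p) \<in> col_perms B"
      by (simp add: tp(1) col_perms_def)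
    show "(\<lambda>p. (p s0, swap s0 (p s0) \<circ> p)) (case tp of (t, p) \<Rightarrow> swap s0 t \<circ> p) = tp"
      using ps by (simp add: tp(1) o_assoc)
  qed
  thus ?thesis by (simp add: sum.cartesian_product)
qed

text \<open>Adds the pair of \<open>a\<close> and \<open>b\<close> and then exchanges the roles of
  \<open>b\<close> and \<open>c\<close>: for \<open>c \<noteq> b\<close>, the cell \<open>a\<close>
  is joined to \<open>c\<close>, and \<open>b\<close> to the former partner of
  \<open>c\<close>.\<close>

abbreviation glue where
  "glue c A \<equiv> swap b c \<circ> (A \<circ> swap a b) \<circ> swap b c"

lemma extend_row_pairing:
  assumes "A \<in> row_pairings B'"
  shows "A \<circ> swap a b \<in> row_pairings B"
proof -
  note AD = row_pairingsD[OF assms]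
  note pD = pairingD[OF AD(1)]
  let ?E = "A \<circ> swap a b"
  have ea: "?E a = b" "?E b = a" using pD(4) ab by simp_all
  have ey: "?E y = A y" if "y \<noteq> a" "y \<noteq> b" for y using that by simp
  have ne: "A y \<noteq> a" "A y \<noteq> b" if "y \<in> cells B'" for y using pD(1)[OF that] ab by auto
  have "pairing (cells B) ?E" unfolding pairing_def
  proof (intro conjI ballI allI impI)
    fix y assume "y \<in> cells B"
    then consider "y = a" | "y = b" | "y \<in> cells B'" "y \<noteq> a" "y \<noteq> b" using cellsB' ab by blast
    thus "?E y \<in> cells B" "?E y \<noteq> y" "?E (?E y) = y"
      using ea ey ab pD(1-3) ne cellsB' by (cases; simp; fail)+
  next
    fix y assume "y \<notin> cells B"
    thus "?E y = y" using cellsB' pD(4) ab(1,2) by (metis ey)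
  qed
  moreover have "fst (fst (?E y)) = fst (fst y)" for y
    using ea ey AD(2) ab by (cases "y = a"; cases "y = b") simp_all
  ultimately show ?thesis by (simp add: row_pairings_def)
qed

lemma row_pairings_reindex:
  "(\<Sum>A\<in>row_pairings B. f A) = (\<Sum>c\<in>ROW. \<Sum>A\<in>row_pairings B'. f (glue c A) :: real)"
proof -
  have "(\<Sum>A\<in>row_pairings B. f A) = (\<Sum>(c, A)\<in>ROW \<times> row_pairings B'. f (glue c A))"
  proof (rule sum.reindex_bij_witness[where
        j = "\<lambda>A. (A a, swap b (A a) \<circ> A \<circ> swap b (A a) \<circ> swap a b)"
        and i = "\<lambda>(c, A). glue c A"])
    fix A assume A: "A \<in> row_pairings B"
    note AD = row_pairingsD[OF A] and pD = pairingD[OF row_pairingsD(1)[OF A]]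
    let ?t = "swap b (A a)"
    let ?q = "?t \<circ> A \<circ> ?t \<circ> swap a b"
    have c: "A a \<in> cells B" "A a \<noteq> a" "fst (fst (A a)) = k" using pD(1,2) ab AD(2) by auto
    have g: "glue (A a) ?q = A" by (rule ext) simp
    show "(case (A a, ?q) of (c, A) \<Rightarrow> glue c A) = A" using g by simp
    show "(case (A a, ?q) of (c, A) \<Rightarrow> f (glue c A)) = f A" using g by simp
    let ?r = "?t \<circ> A \<circ> ?t"
    have r: "?r \<in> row_pairings B"
      by (rule transpose_conj_row_pairing) (use A ab c in auto)
    note rD = row_pairingsD[OF r] and rpD = pairingD[OF row_pairingsD(1)[OF r]]
    have ra: "?r a = b" using ab(3) c(2) by simp
    hence rb: "?r b = a" using rpD(3)[of a] by simp
    have qa: "?q a = a" "?q b = b" using ra rb by simp_all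
    have qy: "?q y = ?r y" if "y \<noteq> a" "y \<noteq> b" for y using that by simp
    have rne: "?r y \<noteq> a" "?r y \<noteq> b" if "y \<noteq> a" "y \<noteq> b" for y
      using that ra rb rpD(3)[of y] by metis+
    have "pairing (cells B') ?q" unfolding pairing_def
    proof (intro conjI ballI allI impI)
      fix y assume y: "y \<in> cells B'"
      hence ny: "y \<noteq> a" "y \<noteq> b" "y \<in> cells B" using ab cellsB' by auto
      show "?q y \<in> cells B'" "?q y \<noteq> y" "?q (?q y) = y"
        unfolding qy[OF ny(1,2)] qy[OF rne[OF ny(1,2)]]
        using rne[OF ny(1,2)] rpD(1,2)[OF ny(3)] rpD(3)[of y] cellsB' by blast+
    next
      fix y assume "y \<notin> cells B'"
      then consider "y = a" | "y = b" | "y \<notin> cells B" "y \<noteq> a" "y \<noteq> b" using cellsB' by blast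
      thus "?q y = y" using qa qy rpD(4) by (cases; metis)
    qed
    moreover have "fst (fst (?q y)) = fst (fst y)" for y
      using qa qy[of y] rD(2)[of y] by (cases "y = a"; cases "y = b") metis+
    ultimately show "(A a, ?q) \<in> ROW \<times> row_pairings B'"
      using c by (simp add: ROW_def row_pairings_def)
  next
    fix cA assume "cA \<in> ROW \<times> row_pairings B'"
    then obtain c A where cA: "cA = (c, A)" "c \<in> ROW" "A \<in> row_pairings B'" by auto
    have c: "c \<in> cells B" "c \<noteq> a" "fst (fst c) = k" using cA(2) by (auto simp: ROW_def)
    show "(case cA of (c, A) \<Rightarrow> glue c A) \<in> row_pairings B"
      unfolding cA(1) prod.case
      by (rule transpose_conj_row_pairing[OF extend_row_pairing[OF cA(3)]]) (use ab c in auto)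
    have Ab: "A b = b" using pairingD(4)[OF row_pairingsD(1)[OF cA(3)]] ab by simp
    have "glue c A a = c" using ab(3) c(2) Ab by simp
    thus "(\<lambda>A. (A a, swap b (A a) \<circ> A \<circ> swap b (A a) \<circ> swap a b))
       (case cA of (c, A) \<Rightarrow> glue c A) = cA"
      by (simp add: cA(1) fun_eq_iff)
  qed
  thus ?thesis by (simp add: sum.cartesian_product)
qed

text \<open>The cells \<open>a\<close> and \<open>b\<close> form a loop of their own, whose value is
  free below \<open>h j\<close>.\<close>

lemma card_fills_pair:
  assumes p: "p \<in> col_perms B'" and A: "A \<in> row_pairings B'"
  shows "card (fills h B p (A \<circ> swap a b)) = h j * card (fills h B' p A)"
proof -
  let ?E = "A \<circ> swap a b"
  note pD = col_permsD[OF p]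
  note AD = pairingD[OF row_pairingsD(1)[OF A]]
  have Aab: "A a = a" "A b = b" using AD(4) ab by auto
  have ps0: "p s0 = s0" using permutes_not_in[OF pD(1)] by (simp add: B'_def)
  have inB': "s \<in> B' \<Longrightarrow> p s \<in> B'" for s using permutes_in_image[OF pD(1)] by simp
  have BB: "s \<in> B \<longleftrightarrow> s = s0 \<or> s \<in> B'" for s using s0_B by (auto simp: B'_def)
  have nab: "(s, False) \<noteq> a" "(s, False) \<noteq> b" "(s, True) \<noteq> a" "(s, True) \<noteq> b" if "s \<in> B'" for s
    using that by (auto simp: a_def b_def B'_def)
  have hab: "h (snd (fst a)) = h j" "h (snd (fst b)) = h j" by (simp_all add: a_def b_def s0_def)
  have "bij_betw (\<lambda>g. (g a, restrict g (cells B'))) (fills h B p ?E) ({..<h j} \<times> fills h B' p A)"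
  proof (rule bij_betw_byWitness[where f' = "\<lambda>(v, g) y. if y = a \<or> y = b then v else g y"])
    show "\<forall>g\<in>fills h B p ?E. (\<lambda>(v, g) y. if y = a \<or> y = b then v else g y) (g a, restrict g (cells B')) = g"
    proof (intro ballI)
      fix g assume g: "g \<in> fills h B p ?E"
      have "g a = g b" using fillsD(3)[OF g s0_B] ps0 by (simp add: a_def b_def)
      moreover have "g y = undefined" if "y \<notin> cells B" for y
        using fillsD(2)[OF g that] .
      ultimately show "(\<lambda>(v, g) y. if y = a \<or> y = b then v else g y) (g a, restrict g (cells B')) = g"
        using cellsB' by (auto simp: fun_eq_iff)
    qed
    show "\<forall>vg\<in>{..<h j} \<times> fills h B' p A. (\<lambda>g. (g a, restrict g (cells B'))) ((\<lambda>(v, g) y. if y = a \<or> y = b then v else g y) vg) = vg"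
    proof
      fix vg assume "vg \<in> {..<h j} \<times> fills h B' p A"
      then obtain v g where vg: "vg = (v, g)" "g \<in> fills h B' p A" by auto
      have "restrict (\<lambda>y. if y = a \<or> y = b then v else g y) (cells B') y = g y" for y
        using fillsD(2)[OF vg(2), of y] ab by auto
      thus "(\<lambda>g. (g a, restrict g (cells B'))) ((\<lambda>(v, g) y. if y = a \<or> y = b then v else g y) vg) = vg"
        using vg(1) by auto
    qed
    show "(\<lambda>g. (g a, restrict g (cells B'))) ` fills h B p ?E \<subseteq> {..<h j} \<times> fills h B' p A"
    proof (intro image_subsetI)
      fix g assume g: "g \<in> fills h B p ?E"
      have "g a < h j" using fillsD(1)[OF g ab(1)] hab by simp
      moreover have "g (A y) = g y" if y: "y \<in> cells B'" for y
      proof -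
        have "g (?E y) = g y" using fillsD(4)[OF g] y cellsB' by blast
        moreover have "y \<noteq> a" "y \<noteq> b" using y ab by auto
        ultimately show ?thesis by simp
      qed
      moreover have "A y \<in> cells B'" if "y \<in> cells B'" for y using AD(1) that .
      moreover have "g (s, False) = g (p s, True)" if "s \<in> B'" for s
        using fillsD(3)[OF g] that BB by blast
      moreover have "g y < h (snd (fst y))" if "y \<in> cells B'" for y
        using fillsD(1)[OF g] that cellsB' by blast
      moreover have "restrict g (cells B') \<in> fills h B' p A"
        by (rule fillsI) (use calculation inB' in \<open>simp_all add: mem_cells\<close>)
      ultimately show "(g a, restrict g (cells B')) \<in> {..<h j} \<times> fills h B' p A"
        by blast
    qed
    show "(\<lambda>(v, g) y. if y = a \<or> y = b then v else g y) ` ({..<h j} \<times> fills h B' p A) \<subseteq> fills h B p ?E"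
    proof (intro image_subsetI)
      fix vg assume "vg \<in> {..<h j} \<times> fills h B' p A"
      then obtain v g where vg: "vg = (v, g)" "v < h j" "g \<in> fills h B' p A" by auto
      let ?g = "\<lambda>y. if y = a \<or> y = b then v else g y"
      have g1: "?g y < h (snd (fst y))" if "y \<in> cells B" for y
        using fillsD(1)[OF vg(3), of y] vg(2) hab cellsB'[of y] that by auto
      have g0: "?g y = undefined" if "y \<notin> cells B" for y
        using fillsD(2)[OF vg(3), of y] cellsB'[of y] that by auto
      have g2: "?g (s, False) = ?g (p s, True)" if "s \<in> B" for s
      proof (cases "s = s0")
        case True
        thus ?thesis using ps0 by (simp add: a_def b_def)
      next
        case False
        hence "s \<in> B'" using BB that by simp
        thus ?thesis using nab[of s] nab[OF inB'] fillsD(3)[OF vg(3)] by simp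
      qed
      have g3: "?g (?E y) = ?g y" if "y \<in> cells B" for y
      proof (cases "y = a \<or> y = b")
        case True thus ?thesis using Aab by auto
      next
        case False
        hence "y \<in> cells B'" using that cellsB' by auto
        moreover have "A y \<noteq> a" "A y \<noteq> b" using AD(1)[OF \<open>y \<in> cells B'\<close>] ab by auto
        ultimately show ?thesis using False fillsD(4)[OF vg(3)] by simp
      qed
      show "(\<lambda>(v, g) y. if y = a \<or> y = b then v else g y) vg \<in> fills h B p ?E"
        unfolding vg(1) prod.case by (rule fillsI) (use g0 g1 g2 g3 in blast)+
    qed
  qed
  from bij_betw_same_card[OF this] show ?thesis by (simp add: card_cartesian_product)
qed

text \<open>Common to the cases in which both copies of the box are inserted into an existing loop
  through \<open>e\<close>: their values are forced, and the bound at \<open>e\<close> implies the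
  bound in column \<open>j\<close>.\<close>

lemma card_fills_contract:
  assumes e: "e \<in> cells B'" "h (snd (fst e)) \<le> h j"
    and iff: "\<And>g :: (nat \<times> nat) \<times> bool \<Rightarrow> nat. (\<forall>s\<in>B. g (s, False) = g (p s, True)) \<and> (\<forall>y\<in>cells B. g (A y) = g y) \<longleftrightarrow>
      g a = g e \<and> g b = g e \<and> (\<forall>s\<in>B'. g (s, False) = g (p' s, True)) \<and> (\<forall>y\<in>cells B'. g (A' y) = g y)"
    and p': "p' \<in> col_perms B'" and A': "A' \<in> row_pairings B'"
  shows "card (fills h B p A) = card (fills h B' p' A')"
proof -
  have inB': "s \<in> B' \<Longrightarrow> p' s \<in> B'" for s using permutes_in_image[OF col_permsD(1)[OF p']] by simp
  have inA': "A' y \<in> cells B'" if "y \<in> cells B'" for y using pairingD(1)[OF row_pairingsD(1)[OF A'] that] .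
  have hab: "h (snd (fst a)) = h j" "h (snd (fst b)) = h j" by (simp_all add: a_def b_def s0_def)
  have nab: "y \<noteq> a" "y \<noteq> b" if "y \<in> cells B'" for y using that ab by auto
  have cB: "(s, x) \<in> cells B'" if "s \<in> B'" for s x using that by (simp add: mem_cells)
  have "bij_betw (\<lambda>g. restrict g (cells B')) (fills h B p A) (fills h B' p' A')"
  proof (rule bij_betw_byWitness[where f' = "\<lambda>g y. if y = a \<or> y = b then g e else g y"])
    show "\<forall>g\<in>fills h B p A. (\<lambda>y. if y = a \<or> y = b then restrict g (cells B') e else restrict g (cells B') y) = g"
    proof (intro ballI ext)
      fix g y assume g: "g \<in> fills h B p A"
      have "g a = g e" "g b = g e" using fillsD(3,4)[OF g] iff[of g] by blast+
      moreover have "g y = undefined" if "y \<notin> cells B"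
        using fillsD(2)[OF g that] .
      ultimately show "(if y = a \<or> y = b then restrict g (cells B') e else restrict g (cells B') y) = g y"
        using cellsB'[of y] e(1) by auto
    qed
    show "\<forall>g\<in>fills h B' p' A'. restrict (\<lambda>y. if y = a \<or> y = b then g e else g y) (cells B') = g"
    proof (intro ballI ext)
      fix g y assume g: "g \<in> fills h B' p' A'"
      show "restrict (\<lambda>y. if y = a \<or> y = b then g e else g y) (cells B') y = g y"
        using fillsD(2)[OF g, of y] nab by auto
    qed
    show "(\<lambda>g. restrict g (cells B')) ` fills h B p A \<subseteq> fills h B' p' A'"
    proof (intro image_subsetI)
      fix g assume g: "g \<in> fills h B p A"
      have *: "g (s, False) = g (p' s, True)" if "s \<in> B'" for s
        using fillsD(3,4)[OF g] iff[of g] that by blast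
      have **: "g (A' y) = g y" if "y \<in> cells B'" for y
        using fillsD(3,4)[OF g] iff[of g] that by blast
      show "restrict g (cells B') \<in> fills h B' p' A'"
        by (rule fillsI) (use fillsD(1)[OF g] cellsB' * ** inB' inA' cB in simp_all)
    qed
    show "(\<lambda>g y. if y = a \<or> y = b then g e else g y) ` fills h B' p' A' \<subseteq> fills h B p A"
    proof (intro image_subsetI)
      fix g assume g: "g \<in> fills h B' p' A'"
      define G where "G = (\<lambda>y. if y = a \<or> y = b then g e else g y)"
      have G: "G a = g e" "G b = g e" "\<And>y. y \<in> cells B' \<Longrightarrow> G y = g y" using nab by (auto simp: G_def)
      have "G a = G e" "G b = G e" using G e(1) by auto
      moreover have "G (s, False) = G (p' s, True)" if "s \<in> B'" for s
        using fillsD(3)[OF g that] G(3)[OF cB[OF that]] G(3)[OF cB[OF inB'[OF that]]] by simp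
      moreover have "G (A' y) = G y" if "y \<in> cells B'" for y
        using fillsD(4)[OF g that] G(3)[OF that] G(3)[OF inA'[OF that]] by simp
      ultimately have *: "(\<forall>s\<in>B. G (s, False) = G (p s, True)) \<and> (\<forall>y\<in>cells B. G (A y) = G y)"
        unfolding iff by blast
      have "G \<in> fills h B p A"
      proof (rule fillsI)
        show "G y < h (snd (fst y))" if "y \<in> cells B" for y
          using fillsD(1)[OF g, of y] fillsD(1)[OF g e(1)] e(2) hab cellsB'[of y] that by (auto simp: G_def)
        show "G y = undefined" if "y \<notin> cells B" for y
          using fillsD(2)[OF g, of y] cellsB'[of y] that by (auto simp: G_def)
      qed (use * in blast)+
      thus "(\<lambda>y. if y = a \<or> y = b then g e else g y) \<in> fills h B p A" by (simp add: G_def)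
    qed
  qed
  thus ?thesis by (rule bij_betw_same_card)
qed

text \<open>The path through \<open>b\<close> and \<open>a\<close> subdivides the column edge
  between the first copy of \<open>inv p t\<close> and \<open>(t, True)\<close>, so the invariance
  conditions reduce to those of the smaller diagram.\<close>

lemma card_fills_col:
  assumes p: "p \<in> col_perms B'" and A: "A \<in> row_pairings B'" and t: "t \<in> COL" "t \<noteq> s0"
  shows "card (fills h B (swap s0 t \<circ> p) (A \<circ> swap a b)) = card (fills h B' p A)"
proof (rule card_fills_contract[OF _ _ _ p A, where e = "(t, True)"])
  note pD = col_permsD[OF p]
  have tB: "t \<in> B'" "snd t = j" using t COL_iff by auto
  show "(t, True) \<in> cells B'" "h (snd (fst (t, True))) \<le> h j" using tB by (auto simp: mem_cells)
  fix g :: "(nat \<times> nat) \<times> bool \<Rightarrow> nat"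
  let ?p = "swap s0 t \<circ> p" and ?E = "A \<circ> swap a b"
  have ps0: "p s0 = s0" using permutes_not_in[OF pD(1)] by (simp add: B'_def)
  define u where "u = inv p t"
  have u: "u \<in> B'" "p u = t" "\<And>s. p s = t \<Longrightarrow> s = u"
    using permutes_in_image[OF permutes_inv[OF pD(1)], of t] tB permutes_inverses[OF pD(1)] unfolding u_def by metis+
  have pne: "p s \<noteq> s0" if "s \<in> B'" for s using permutes_in_image[OF pD(1), of s] that by (auto simp: B'_def)
  have P1: "?p s0 = t" "?p u = s0" using ps0 u(2) by simp_all
  have P2: "?p s = p s" if "s \<in> B'" "s \<noteq> u" for s using pne[OF that(1)] u(3)[of s] that by (metis comp_apply swap_simps(3))
  have BB: "s \<in> B \<longleftrightarrow> s = s0 \<or> s \<in> B'" for s using s0_B by (auto simp: B'_def)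
  have Aab: "A a = a" "A b = b" using pairingD(4)[OF row_pairingsD(1)[OF A]] ab by auto
  have E1: "?E a = b" "?E b = a" using Aab by auto
  have E2: "?E y = A y" if "y \<in> cells B'" for y using that ab by (metis comp_apply swap_simps(3))
  have "(\<forall>y\<in>cells B. g (?E y) = g y) \<longleftrightarrow> g a = g b \<and> (\<forall>y\<in>cells B'. g (A y) = g y)"
    unfolding ball_cells_B E1 using E2 by auto
  moreover have "(\<forall>s\<in>B. g (s, False) = g (?p s, True)) \<longleftrightarrow>
     g a = g (t, True) \<and> g (u, False) = g b \<and> (\<forall>s\<in>B' - {u}. g (s, False) = g (p s, True))"
  proof -
    have "(\<forall>s\<in>B. g (s, False) = g (?p s, True)) \<longleftrightarrow> g (s0, False) = g (?p s0, True) \<and>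
        g (u, False) = g (?p u, True) \<and> (\<forall>s\<in>B' - {u}. g (s, False) = g (?p s, True))"
      unfolding ball_B using u(1) by blast
    also have "\<dots> \<longleftrightarrow> g a = g (t, True) \<and> g (u, False) = g b \<and> (\<forall>s\<in>B' - {u}. g (s, False) = g (?p s, True))"
      unfolding P1 by (simp add: a_def b_def)
    finally show ?thesis using P2 by simp
  qed
  moreover have "(\<forall>s\<in>B'. g (s, False) = g (p s, True)) \<longleftrightarrow>
     g (u, False) = g (t, True) \<and> (\<forall>s\<in>B' - {u}. g (s, False) = g (p s, True))"
  proof -
    have "(\<forall>s\<in>B'. g (s, False) = g (p s, True)) \<longleftrightarrow>
      g (u, False) = g (p u, True) \<and> (\<forall>s\<in>B' - {u}. g (s, False) = g (p s, True))"
      using u(1) by blast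
    thus ?thesis unfolding u(2) .
  qed
  ultimately show "(\<forall>s\<in>B. g (s, False) = g (?p s, True)) \<and> (\<forall>y\<in>cells B. g (?E y) = g y) \<longleftrightarrow>
      g a = g (t, True) \<and> g b = g (t, True) \<and> (\<forall>s\<in>B'. g (s, False) = g (p s, True)) \<and> (\<forall>y\<in>cells B'. g (A y) = g y)"
    by auto
qed

text \<open>The path through \<open>a\<close> and \<open>b\<close> subdivides the row edge between
  \<open>c\<close> and its partner. The value at \<open>c\<close> may be copied to the new box
  because \<open>h j\<close> is the largest bound in row \<open>k\<close>.\<close>

lemma card_fills_row:
  assumes p: "p \<in> col_perms B'" and A: "A \<in> row_pairings B'" and c: "c \<in> ROW" "c \<noteq> b"
  shows "card (fills h B p (glue c A)) = card (fills h B' p A)"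
proof (rule card_fills_contract[OF _ _ _ p A, where e = c])
  note pD = col_permsD[OF p] and AD = pairingD[OF row_pairingsD(1)[OF A]]
  have cB: "c \<in> cells B'" "fst (fst c) = k" using c ROW_iff by auto
  show "c \<in> cells B'" by fact
  show "h (snd (fst c)) \<le> h j" using row[of "fst c"] cB by (auto simp: mem_cells B'_def)
  fix g :: "(nat \<times> nat) \<times> bool \<Rightarrow> nat"
  have ps0: "p s0 = s0" using permutes_not_in[OF pD(1)] by (simp add: B'_def)
  have BB: "s \<in> B \<longleftrightarrow> s = s0 \<or> s \<in> B'" for s using s0_B by (auto simp: B'_def)
  define d where "d = A c"
  have d: "d \<in> cells B'" "d \<noteq> c" "A d = c" using AD(1-3) cB(1) by (auto simp: d_def)
  have ne: "c \<noteq> a" "c \<noteq> b" "d \<noteq> a" "d \<noteq> b" using cB d ab by auto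
  have Aab: "A a = a" "A b = b" using AD(4) ab by auto
  have G1: "glue c A a = c" "glue c A b = d" "glue c A c = a" "glue c A d = b"
    using ab(3) ne Aab d by (simp_all add: d_def)
  have G2: "glue c A y = A y" if "y \<in> cells B'" "y \<noteq> c" "y \<noteq> d" for y
  proof -
    have "y \<noteq> a" "y \<noteq> b" using that ab by auto
    moreover have "A y \<noteq> b" using AD(1)[OF that(1)] ab by auto
    moreover have "A y \<noteq> c" using that AD(3)[of y] by (auto simp: d_def)
    ultimately show ?thesis using that by simp
  qed
  have "(\<forall>y\<in>cells B. g (glue c A y) = g y) \<longleftrightarrow> g (glue c A a) = g a \<and> g (glue c A b) = g b \<and> g (glue c A c) = g c \<and>
      g (glue c A d) = g d \<and> (\<forall>y\<in>cells B' - {c, d}. g (glue c A y) = g y)"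
    unfolding ball_cells_B using cB(1) d(1) by blast
  hence 1: "(\<forall>y\<in>cells B. g (glue c A y) = g y) \<longleftrightarrow> g c = g a \<and> g d = g b \<and> (\<forall>y\<in>cells B' - {c, d}. g (A y) = g y)"
    unfolding G1 using G2 by auto
  have "(\<forall>y\<in>cells B'. g (A y) = g y) \<longleftrightarrow> g (A c) = g c \<and> g (A d) = g d \<and> (\<forall>y\<in>cells B' - {c, d}. g (A y) = g y)"
    using cB(1) d(1) by blast
  hence 2: "(\<forall>y\<in>cells B'. g (A y) = g y) \<longleftrightarrow> g d = g c \<and> (\<forall>y\<in>cells B' - {c, d}. g (A y) = g y)"
    using d by (auto simp: d_def)
  have 3: "(\<forall>s\<in>B. g (s, False) = g (p s, True)) \<longleftrightarrow> g a = g b \<and> (\<forall>s\<in>B'. g (s, False) = g (p s, True))"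
  proof -
    have "(\<forall>s\<in>B. g (s, False) = g (p s, True)) \<longleftrightarrow> g (s0, False) = g (p s0, True) \<and> (\<forall>s\<in>B'. g (s, False) = g (p s, True))"
      by (rule ball_B)
    thus ?thesis unfolding ps0 by (simp add: a_def b_def)
  qed
  show "(\<forall>s\<in>B. g (s, False) = g (p s, True)) \<and> (\<forall>y\<in>cells B. g (glue c A y) = g y) \<longleftrightarrow>
      g a = g c \<and> g b = g c \<and> (\<forall>s\<in>B'. g (s, False) = g (p s, True)) \<and> (\<forall>y\<in>cells B'. g (A y) = g y)"
    unfolding 1 2 3 by auto
qed

end

section \<open>The cancelling terms in the removal of a box\<close>

context box_removal
begin

text \<open>If \<open>a\<close> is joined to \<open>(t, True) \<noteq> b\<close> by the column pairing and to \<open>c \<noteq> b\<close> by the row pairing, then \<open>a\<close> only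
  passes a value on, and \<open>c\<close> behaves like a cell in the row of \<open>t\<close>. Exchanging it with the cell \<open>c2\<close> of
  that row in the same copy of the same column reverses the sign.\<close>
definition shift_perm where
  "shift_perm c s2 p = (if snd c then swap (fst c) s2 \<circ> p else p \<circ> swap (fst c) s2)"

text \<open>A filling is constant on the chain \<open>b'\<close>, \<open>a\<close>,
  \<open>c\<close>. In \<open>G\<close> this chain receives the value of \<open>c2\<close>, and
  \<open>c2\<close> receives the old value of the chain; the column partners of \<open>c\<close> and
  \<open>c2\<close> and the row partners of \<open>b'\<close> and \<open>c2\<close> are exchanged to
  match. The new value is admissible at \<open>a\<close> and \<open>b'\<close> because the column of
  \<open>c\<close> has a bound of at most \<open>h j\<close>. The second claim says that the same
  rule undoes the change.\<close>

lemma fills_shift: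
  assumes p: "p \<in> col_perms B" and A: "A \<in> row_pairings B"
    and t: "p s0 = t" "t \<in> COL" "t \<noteq> s0" and c: "A a = c" "c \<in> ROW" "c \<noteq> b"
    and s2: "s2 = (fst t, snd (fst c))" and c2: "c2 = (s2, snd c)" and b': "b' = (t, True)"
    and g: "g \<in> fills h B p A"
    and G: "G = (\<lambda>y. if y = c then g c2 else if y = c2 then g c else if y = a \<or> y = b' then g c2 else g y)"
  shows "G \<in> fills h B (shift_perm c s2 p) (swap b' c2 \<circ> A \<circ> swap b' c2)"
    and "g = (\<lambda>y. if y = c then G c2 else if y = c2 then G c else if y = a \<or> y = b' then G c2 else G y)"
proof -
  note pD = col_permsD[OF p] and AD = pairingD[OF row_pairingsD(1)[OF A]]
  have cB: "c \<in> cells B'" "fst (fst c) = k" using c ROW_iff by auto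
  have sc: "fst c \<in> B" "fst c \<noteq> s0" using cB by (auto simp: mem_cells B'_def)
  have tk: "fst t < k" using COL_lt t by blast
  have tB: "t \<in> B" "snd t = j" using t by (auto simp: COL_def)
  have s2B: "s2 \<in> B" using down[OF sc(1) cB(2) tk] s2 by simp
  have scj: "snd (fst c) \<noteq> j" using sc(2) cB(2) by (cases "fst c") (auto simp: s0_def)
  have ne: "t \<noteq> s2" "t \<noteq> fst c" "s2 \<noteq> fst c" "s2 \<noteq> s0" "fst c \<noteq> s0" "s0 \<noteq> t"
    using scj tB tk cB(2) sc t(3) by (auto simp: s2 s0_def prod_eq_iff)
  have ceq: "c = (fst c, snd c)" by simp
  have cellB: "(s, x) \<in> cells B \<longleftrightarrow> s \<in> B" for s x by (simp add: mem_cells)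
  have cne: "c \<noteq> a" "c \<noteq> b'" "c \<noteq> c2" "c2 \<noteq> a" "c2 \<noteq> b'" "a \<noteq> b'"
  proof -
    have "fst a = s0" "fst b' = t" "fst c2 = s2" by (simp_all add: a_def b' c2)
    thus "c \<noteq> a" "c \<noteq> b'" "c \<noteq> c2" "c2 \<noteq> a" "c2 \<noteq> b'" "a \<noteq> b'"
      using ne by metis+
  qed
  have mem: "a \<in> cells B" "b' \<in> cells B" "c \<in> cells B" "c2 \<in> cells B"
    using ab(1) cB(1) cellsB'[of c] tB(1) s2B by (simp_all add: b' c2 cellB)
  have ga: "g a = g b'" using fillsD(3)[OF g s0_B] t(1) by (simp add: a_def b')
  have gc: "g c = g a" using fillsD(4)[OF g mem(1)] c(1) by simp
  have Ac: "A c = a" using AD(3)[of a] c(1) by simp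
  have GV: "G c = g c2" "G c2 = g c" "G a = g c2" "G b' = g c2"
    using cne by (auto simp: G)
  have GO: "G y = g y" if "y \<noteq> c" "y \<noteq> c2" "y \<noteq> a" "y \<noteq> b'" for y using that by (simp add: G)
  have hs: "h (snd (fst c)) \<le> h j" using row[OF sc(1) cB(2)] .
  have pinj: "p s = p u \<longleftrightarrow> s = u" for s u using permutes_inj[OF pD(1)] by (auto dest: injD)
  let ?p = "shift_perm c s2 p"
  let ?A = "swap b' c2 \<circ> A \<circ> swap b' c2"
  show "g = (\<lambda>y. if y = c then G c2 else if y = c2 then G c else if y = a \<or> y = b' then G c2 else G y)"
    using GV GO ga gc by (auto simp: fun_eq_iff)
  show "G \<in> fills h B ?p ?A"
  proof (rule fillsI)
    fix y assume y: "y \<in> cells B"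
    have l: "g c2 < h (snd (fst c))" "g c < h (snd (fst c))"
      using fillsD(1)[OF g mem(4)] fillsD(1)[OF g mem(3)] by (simp_all add: c2 s2)
    have "snd (fst c2) = snd (fst c)" "snd (fst a) = j" "snd (fst b') = j" using tB by (auto simp: c2 s2 a_def b' s0_def)
    thus "G y < h (snd (fst y))"
      using l hs GV GO[of y] fillsD(1)[OF g y] by (cases "y = c"; cases "y = c2"; cases "y = a"; cases "y = b'") auto
  next
    fix y assume "y \<notin> cells B"
    thus "G y = undefined" using fillsD(2)[OF g, of y] GO[of y] mem by metis
  next
    fix s assume s: "s \<in> B"
    note gs = fillsD(3)[OF g s]
    show "G (s, False) = G (?p s, True)"
    proof (cases "snd c")
      case True
      have ct: "c = (fst c, True)" "c2 = (s2, True)" using True ceq c2 by auto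
      have Gs: "G (s, False) = (if s = s0 then g c2 else g (s, False))"
        using GV(3) GO[of "(s, False)"] ct by (auto simp: a_def b')
      have ps: "?p s = swap (fst c) s2 (p s)" using True by (simp add: shift_perm_def)
      show ?thesis
      proof (cases "s = s0")
        case True
        hence "?p s = t" using ps t ne by simp
        thus ?thesis using True Gs GV(4) by (simp add: b')
      next
        case False
        hence pt: "p s \<noteq> t" using t(1) pinj by metis
        consider "p s = fst c" | "p s = s2" | "p s \<noteq> fst c" "p s \<noteq> s2" by blast
        thus ?thesis
        proof cases
          case 1
          hence "G (?p s, True) = g c" using ps GV(2) ct by simp
          thus ?thesis using Gs False gs 1 ct by simp
        next
          case 2
          hence "G (?p s, True) = g c2" using ps GV(1) ct by simp
          thus ?thesis using Gs False gs 2 ct by simp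
        next
          case 3
          hence "?p s = p s" using ps by simp
          moreover have "G (p s, True) = g (p s, True)"
            by (rule GO) (use 3 pt ct in \<open>auto simp: a_def b'\<close>)
          ultimately show ?thesis using Gs False gs by simp
        qed
      qed
    next
      case False
      have ct: "c = (fst c, False)" "c2 = (s2, False)" using False ceq c2 by auto
      have ps: "?p s = p (swap (fst c) s2 s)" using False by (simp add: shift_perm_def)
      have GT: "G (p u, True) = g (p u, True)" if "u \<noteq> s0" for u
      proof (rule GO)
        have "p u \<noteq> t" using t(1) pinj that by metis
        thus "(p u, True) \<noteq> b'" by (simp add: b')
      qed (use ct in \<open>auto simp: a_def\<close>)
      consider "s = s0" | "s = fst c" | "s = s2" | "s \<noteq> s0" "s \<noteq> fst c" "s \<noteq> s2" by blast
      thus ?thesis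
      proof cases
        case 1
        hence "?p s = t" using ps ne t(1) by simp
        thus ?thesis using 1 GV by (simp add: a_def b')
      next
        case 2
        hence "?p s = p s2" using ps by simp
        moreover have "g (p s2, True) = g c2" using fillsD(3)[OF g s2B] ct by simp
        ultimately show ?thesis using 2 GV(1) GT[of s2] ne ct by simp
      next
        case 3
        hence "?p s = p (fst c)" using ps by simp
        moreover have "g (p (fst c), True) = g c" using fillsD(3)[OF g sc(1)] ct by simp
        ultimately show ?thesis using 3 GV(2) GT[of "fst c"] ne ct by simp
      next
        case 4
        hence "?p s = p s" using ps by simp
        moreover have "G (s, False) = g (s, False)"
          by (rule GO) (use 4 ct in \<open>auto simp: a_def b'\<close>)
        ultimately show ?thesis using gs GT[of s] 4 by simp
      qed
    qed
  next
    fix y assume y: "y \<in> cells B"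
    have gA: "g (A y) = g y" if "y \<in> cells B" for y using fillsD(4)[OF g that] .
    let ?tr = "swap b' c2"
    have A_ac: "A y \<noteq> a" "A y \<noteq> c" if "y \<noteq> a" "y \<noteq> c" for y
      using that Ac c(1) AD(3)[of y] by metis+
    consider "y = a" | "y = c" | "y = b'" | "y = c2" | "y \<noteq> a" "y \<noteq> c" "y \<noteq> b'" "y \<noteq> c2" by blast
    thus "G (?A y) = G y"
    proof cases
      case 1
      hence "?A y = c" using cne c(1) by simp
      thus ?thesis using 1 GV by simp
    next
      case 2
      hence "?A y = a" using cne Ac by simp
      thus ?thesis using 2 GV by simp
    next
      case 3
      have e: "?A y = ?tr (A c2)" using 3 by simp
      show ?thesis
      \<comment> \<open>If \<open>b'\<close> and \<open>c2\<close> are partners, the conjugation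
        keeps this pair, and the values at \<open>a\<close>, \<open>b'\<close>, \<open>c\<close> and
        \<open>c2\<close> all coincide.\<close>
      proof (cases "A c2 = b'")
        case True
        hence "g c2 = g b'" using gA[OF mem(4)] by simp
        thus ?thesis using e True 3 GV ga gc by simp
      next
        case False
        have ne2: "A c2 \<noteq> c2" "A c2 \<noteq> a" "A c2 \<noteq> c" using AD(2)[OF mem(4)] A_ac cne by auto
        hence "?A y = A c2" using e False by simp
        thus ?thesis using GO[OF ne2(3,1,2) False] gA[OF mem(4)] GV 3 by simp
      qed
    next
      case 4
      have e: "?A y = ?tr (A b')" using 4 by simp
      show ?thesis
      proof (cases "A b' = c2")
        case True
        hence "g c2 = g b'" using gA[OF mem(2)] by simp
        thus ?thesis using e True 4 GV ga gc by simp
      next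
        case False
        have ne2: "A b' \<noteq> b'" "A b' \<noteq> a" "A b' \<noteq> c" using AD(2)[OF mem(2)] A_ac[of b'] cne by auto
        hence "?A y = A b'" using e False by simp
        thus ?thesis using GO[OF ne2(3) False ne2(2,1)] gA[OF mem(2)] GV 4 ga gc by simp
      qed
    next
      case 5
      have e: "?A y = ?tr (A y)" using 5 by simp
      note ac = A_ac[OF 5(1,2)]
      have Gy: "G y = g y" using GO 5 by blast
      consider "A y = b'" | "A y = c2" | "A y \<noteq> b'" "A y \<noteq> c2" by blast
      thus ?thesis
      proof cases
        case 1 thus ?thesis using e GV Gy gA[OF y] ga gc by simp
      next
        case 2 thus ?thesis using e GV Gy gA[OF y] by simp
      next
        case 3
        hence "?A y = A y" using e by simp
        thus ?thesis using GO[OF ac(2) 3(2) ac(1) 3(1)] Gy gA[OF y] by simp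
      qed
    qed
  qed
qed

lemma signed_fills_cancel:
  assumes t: "t \<in> COL" "t \<noteq> s0" and c: "c \<in> ROW" "c \<noteq> b"
  shows "(\<Sum>(p, A)\<in>{p \<in> col_perms B. p s0 = t} \<times> {A \<in> row_pairings B. A a = c}.
     sgnr p * real (card (fills h B p A))) = 0"
proof -
  define s2 where "s2 = (fst t, snd (fst c))"
  define c2 where "c2 = (s2, snd c)"
  define b' where "b' = (t, True)"
  let ?tr = "swap b' c2"
  let ?i = "\<lambda>(p, A). (shift_perm c s2 p, ?tr \<circ> A \<circ> ?tr)"
  have cB: "c \<in> cells B'" "fst (fst c) = k" using c ROW_iff by auto
  have sc: "fst c \<in> B" "fst c \<noteq> s0" using cB by (auto simp: mem_cells B'_def)
  have tk: "fst t < k" using COL_lt t by blast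
  have tB: "t \<in> B" "snd t = j" using t by (auto simp: COL_def)
  have s2B: "s2 \<in> B" using down[OF sc(1) cB(2) tk] by (simp add: s2_def)
  have scj: "snd (fst c) \<noteq> j" using sc(2) cB(2) by (cases "fst c") (auto simp: s0_def)
  have ne: "t \<noteq> s2" "t \<noteq> fst c" "s2 \<noteq> fst c" "s2 \<noteq> s0"
    using scj tB tk cB(2) sc t(2) by (auto simp: s2_def s0_def prod_eq_iff)
  have ane: "a \<noteq> b'" "a \<noteq> c2" "c \<noteq> b'" "c \<noteq> c2"
  proof -
    have "fst a = s0" "fst b' = t" "fst c2 = s2" by (simp_all add: a_def b'_def c2_def)
    thus "a \<noteq> b'" "a \<noteq> c2" "c \<noteq> b'" "c \<noteq> c2" using ne t(2) by metis+
  qed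
  have shift: "shift_perm c s2 p \<in> col_perms B" "shift_perm c s2 p s0 = t" "sgnr (shift_perm c s2 p) = - sgnr p"
    "shift_perm c s2 (shift_perm c s2 p) = p"
    if p: "p \<in> col_perms B" "p s0 = t" for p
  proof -
    note pD = col_permsD[OF p(1)]
    let ?t = "swap (fst c) s2"
    have tr: "?t permutes B" using sc(1) s2B by (rule permutes_swap_id)
    have snd_tr: "snd (?t s) = snd s" for s
      using s2_def by (cases "s = fst c"; cases "s = s2") auto
    show "shift_perm c s2 p \<in> col_perms B"
      using permutes_compose[OF pD(1) tr] permutes_compose[OF tr pD(1)] snd_tr pD(2)
      by (simp add: shift_perm_def col_perms_def)
    show "shift_perm c s2 p s0 = t" using p(2) ne sc(2) by (simp add: shift_perm_def)
    show "sgnr (shift_perm c s2 p) = - sgnr p"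
      using sgnr_compose_transpose[OF pD(1) fin] ne(3) by (simp add: shift_perm_def)
    show "shift_perm c s2 (shift_perm c s2 p) = p" by (simp add: shift_perm_def fun_eq_iff)
  qed
  have conj: "?tr \<circ> A \<circ> ?tr \<in> row_pairings B" "(?tr \<circ> A \<circ> ?tr) a = c" "?tr \<circ> (?tr \<circ> A \<circ> ?tr) \<circ> ?tr = A"
    if A: "A \<in> row_pairings B" "A a = c" for A
  proof -
    show "?tr \<circ> A \<circ> ?tr \<in> row_pairings B"
      by (rule transpose_conj_row_pairing[OF A(1)]) (use tB s2B in \<open>auto simp: mem_cells b'_def c2_def s2_def\<close>)
    show "(?tr \<circ> A \<circ> ?tr) a = c" using ane A(2) by simp
    show "?tr \<circ> (?tr \<circ> A \<circ> ?tr) \<circ> ?tr = A" by (simp add: fun_eq_iff)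
  qed
  have card_le: "card (fills h B p A) \<le> card (fills h B (shift_perm c s2 p) (?tr \<circ> A \<circ> ?tr))"
    if p: "p \<in> col_perms B" "p s0 = t" and A: "A \<in> row_pairings B" "A a = c" for p A
  proof (rule card_inj_on_le)
    let ?f = "\<lambda>(g :: (nat \<times> nat) \<times> bool \<Rightarrow> nat) y. if y = c then g c2 else if y = c2 then g c else if y = a \<or> y = b' then g c2 else g y"
    note F = fills_shift[OF p(1) A(1) p(2) t A(2) c s2_def c2_def b'_def _ refl]
    show "inj_on ?f (fills h B p A)"
      by (rule inj_on_inverseI[where g = ?f]) (rule F(2)[symmetric])
    show "?f ` fills h B p A \<subseteq> fills h B (shift_perm c s2 p) (?tr \<circ> A \<circ> ?tr)"
      using F(1) by blast
    show "finite (fills h B (shift_perm c s2 p) (?tr \<circ> A \<circ> ?tr))" by (rule finite_fills[OF fin])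
  qed
  \<comment> \<open>The modification of \<open>(p, A)\<close> is an involution, so the inequality
    applied to the modified pair is the converse one.\<close>
  have card_eq: "card (fills h B (shift_perm c s2 p) (?tr \<circ> A \<circ> ?tr)) = card (fills h B p A)"
    if p: "p \<in> col_perms B" "p s0 = t" and A: "A \<in> row_pairings B" "A a = c" for p A
    using card_le[OF p A] card_le[OF shift(1,2)[OF p] conj(1,2)[OF A]]
    unfolding shift(4)[OF p] conj(3)[OF A] by (rule antisym[rotated])
  show ?thesis
  proof (rule sum_sign_reversing[where i = ?i])
    fix pA assume "pA \<in> {p \<in> col_perms B. p s0 = t} \<times> {A \<in> row_pairings B. A a = c}"
    then obtain p A where pA: "pA = (p, A)" "p \<in> col_perms B" "p s0 = t" "A \<in> row_pairings B" "A a = c" by auto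
    note sh = shift[OF pA(2,3)] and cj = conj[OF pA(4,5)]
    show "?i pA \<in> {p \<in> col_perms B. p s0 = t} \<times> {A \<in> row_pairings B. A a = c}"
      unfolding pA(1) prod.case using sh(1,2) cj(1,2) by blast
    show "?i (?i pA) = pA" unfolding pA(1) prod.case using sh(4) cj(3) by simp
    show "(case ?i pA of (p, A) \<Rightarrow> sgnr p * real (card (fills h B p A))) =
       - (case pA of (p, A) \<Rightarrow> sgnr p * real (card (fills h B p A)))"
      unfolding pA(1) prod.case using sh(3) card_eq[OF pA(2-5)] by simp
  qed
qed

end

context box_removal
begin

lemma col_perms_select:
  assumes "t \<in> COL"
  shows "(\<Sum>p\<in>col_perms B'. f (swap s0 t \<circ> p)) = (\<Sum>p\<in>{p \<in> col_perms B. p s0 = t}. f p :: real)"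
proof -
  have "(\<Sum>p\<in>{p \<in> col_perms B. p s0 = t}. f p) = (\<Sum>p\<in>col_perms B. if p s0 = t then f p else 0)"
    using finite_col_perms[OF fin] by (rule sum.inter_filter)
  also have "\<dots> = (\<Sum>t'\<in>COL. \<Sum>p\<in>col_perms B'. if (swap s0 t' \<circ> p) s0 = t then f (swap s0 t' \<circ> p) else 0)"
    by (rule col_perms_reindex)
  also have "\<dots> = (\<Sum>t'\<in>COL. if t' = t then \<Sum>p\<in>col_perms B'. f (swap s0 t \<circ> p) else 0)"
  proof (rule sum.cong[OF refl])
    fix t'
    have "(swap s0 t' \<circ> p) s0 = t'" if "p \<in> col_perms B'" for p
      using permutes_not_in[OF col_permsD(1)[OF that], of s0] by (simp add: B'_def)
    thus "(\<Sum>p\<in>col_perms B'. if (swap s0 t' \<circ> p) s0 = t then f (swap s0 t' \<circ> p) else 0) =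
      (if t' = t then \<Sum>p\<in>col_perms B'. f (swap s0 t \<circ> p) else 0)"
      by (cases "t' = t") (auto intro!: sum.cong sum.neutral)
  qed
  also have "\<dots> = (\<Sum>p\<in>col_perms B'. f (swap s0 t \<circ> p))"
    using assms fin by (simp add: COL_def)
  finally show ?thesis by simp
qed

lemma row_pairings_select:
  assumes "c \<in> ROW"
  shows "(\<Sum>A\<in>row_pairings B'. f (glue c A)) = (\<Sum>A\<in>{A \<in> row_pairings B. A a = c}. f A :: real)"
proof -
  have "(\<Sum>A\<in>{A \<in> row_pairings B. A a = c}. f A) = (\<Sum>A\<in>row_pairings B. if A a = c then f A else 0)"
    using finite_row_pairings[OF fin] by (rule sum.inter_filter)
  also have "\<dots> = (\<Sum>c'\<in>ROW. \<Sum>A\<in>row_pairings B'. if glue c' A a = c then f (glue c' A) else 0)"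
    by (rule row_pairings_reindex)
  also have "\<dots> = (\<Sum>c'\<in>ROW. if c' = c then \<Sum>A\<in>row_pairings B'. f (glue c A) else 0)"
  proof (rule sum.cong[OF refl])
    fix c' assume "c' \<in> ROW"
    hence "c' \<noteq> a" by (simp add: ROW_def)
    have "glue c' A a = c'" if "A \<in> row_pairings B'" for A
      using pairingD(4)[OF row_pairingsD(1)[OF that], of b] ab \<open>c' \<noteq> a\<close> by simp
    thus "(\<Sum>A\<in>row_pairings B'. if glue c' A a = c then f (glue c' A) else 0) =
      (if c' = c then \<Sum>A\<in>row_pairings B'. f (glue c A) else 0)"
      by (cases "c' = c") (auto intro!: sum.cong sum.neutral)
  qed
  also have "\<dots> = (\<Sum>A\<in>row_pairings B'. f (glue c A))"
    using assms finite_cells[OF fin] by (simp add: ROW_def)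
  finally show ?thesis by simp
qed

text \<open>Let \<open>t\<close> be the image of the box and \<open>c\<close> the partner of
  \<open>a\<close>. The case \<open>t = s0\<close>, \<open>c = b\<close> contributes
  \<open>h j\<close>; \<open>t = s0\<close>, \<open>c \<noteq> b\<close> contributes one for each
  copy of each other box in row \<open>k\<close>; \<open>t \<noteq> s0\<close>, \<open>c = b\<close>
  contributes \<open>- 1\<close> for each of the \<open>k\<close> boxes above, by the sign of the
  transposition; all other terms cancel for fixed \<open>t\<close> and \<open>c\<close>.\<close>

lemma signed_fills_step:
  "signed_fills h B = (real (h j) - real k + 2 * real (card {s \<in> B'. fst s = k})) * signed_fills h B'"
proof -
  let ?X = "\<lambda>p A. sgnr p * real (card (fills h B p A))"
  let ?F = "signed_fills h B'"
  define I where "I t c = (\<Sum>p\<in>col_perms B'. \<Sum>A\<in>row_pairings B'. ?X (swap s0 t \<circ> p) (glue c A))" for t c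
  have finC: "finite COL" and finR: "finite ROW" using fin finite_cells[OF fin] by (simp_all add: COL_def ROW_def)
  have s0C: "s0 \<in> COL" by (simp add: COL_iff)
  have sg: "sgnr (swap s0 t \<circ> p) = - sgnr p" if "p \<in> col_perms B'" "t \<noteq> s0" for t p
  proof -
    have "p permutes B" using permutes_subset[OF col_permsD(1)[OF that(1)]] by (auto simp: B'_def)
    thus ?thesis using sgnr_compose_transpose(2)[OF _ fin] that(2) by metis
  qed
  have "signed_fills h B = (\<Sum>t\<in>COL. \<Sum>p\<in>col_perms B'. \<Sum>c\<in>ROW. \<Sum>A\<in>row_pairings B'.
      ?X (swap s0 t \<circ> p) (glue c A))"
    unfolding signed_fills_def by (subst col_perms_reindex, subst row_pairings_reindex, rule refl)
  also have "\<dots> = (\<Sum>t\<in>COL. \<Sum>c\<in>ROW. I t c)"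
    unfolding I_def by (rule sum.cong[OF refl], rule sum.swap)
  also have "\<dots> = (\<Sum>c\<in>ROW. I s0 c) + (\<Sum>t\<in>COL - {s0}. \<Sum>c\<in>ROW. I t c)"
    using finC s0C by (simp add: sum.remove)
  also have "(\<Sum>c\<in>ROW. I s0 c) = I s0 b + (\<Sum>c\<in>ROW - {b}. I s0 c)"
    using finR ab(8) by (simp add: sum.remove)
  also have "I s0 b = real (h j) * ?F"
    unfolding I_def signed_fills_def sum_distrib_left
    by (intro sum.cong refl) (simp add: card_fills_pair)
  also have "(\<Sum>c\<in>ROW - {b}. I s0 c) = (\<Sum>c\<in>ROW - {b}. ?F)"
    unfolding I_def signed_fills_def
    by (intro sum.cong refl) (simp add: card_fills_row)
  also have "(\<Sum>t\<in>COL - {s0}. \<Sum>c\<in>ROW. I t c) = (\<Sum>t\<in>COL - {s0}. - ?F)"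
  proof (rule sum.cong[OF refl])
    fix t assume "t \<in> COL - {s0}"
    hence t: "t \<in> COL" "t \<noteq> s0" by auto
    have "I t c = 0" if c: "c \<in> ROW" "c \<noteq> b" for c
    proof -
      have "I t c = (\<Sum>p\<in>col_perms B'. \<Sum>A\<in>{A \<in> row_pairings B. A a = c}. ?X (swap s0 t \<circ> p) A)"
        unfolding I_def by (subst row_pairings_select[OF c(1)], rule refl)
      also have "\<dots> = (\<Sum>p\<in>{p \<in> col_perms B. p s0 = t}. \<Sum>A\<in>{A \<in> row_pairings B. A a = c}. ?X p A)"
        by (rule col_perms_select[OF t(1)])
      also have "\<dots> = 0" using signed_fills_cancel[OF t c] by (simp add: sum.cartesian_product)
      finally show ?thesis .
    qed
    hence "(\<Sum>c\<in>ROW - {b}. I t c) = 0" by (intro sum.neutral) auto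
    moreover have "(\<Sum>c\<in>ROW. I t c) = I t b + (\<Sum>c\<in>ROW - {b}. I t c)"
      using finR ab(8) by (simp add: sum.remove)
    moreover have "I t b = - ?F"
      unfolding I_def signed_fills_def sum_negf[symmetric]
    proof (intro sum.cong refl)
      fix p A assume pA: "p \<in> col_perms B'" "A \<in> row_pairings B'"
      show "?X (swap s0 t \<circ> p) (glue b A) = - (sgnr p * real (card (fills h B' p A)))"
        using card_fills_col[OF pA t] sg[OF pA(1) t(2)] by simp
    qed
    ultimately show "(\<Sum>c\<in>ROW. I t c) = - ?F" by simp
  qed
  finally show ?thesis
    using card_ROW card_COL ab(8) s0C by (simp add: algebra_simps)
qed

end

section \<open>The product of the factors over all boxes\<close>

lemma conj_part_antimono: "j \<le> j' \<Longrightarrow> conj_part la j' \<le> conj_part la j"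
  unfolding conj_part_def by (rule card_mono) auto

lemma signed_fills_empty: "signed_fills h {} = 1"
proof -
  have c: "col_perms {} = {id}" by (auto simp: col_perms_def permutes_empty)
  have r: "row_pairings {} = {id}" by (auto simp: row_pairings_def pairing_def cells_def)
  have f: "fills h {} id id = {\<lambda>y. undefined}" by (auto simp: fills_def cells_def)
  show ?thesis by (simp add: signed_fills_def c r f sgnr_def)
qed

text \<open>Read backwards, the removal adds rows from the top and fills each row from its right
  end. For the newest box \<open>(k, j)\<close> the boxes already present in its row number its arm,
  and \<open>conj_part la j - k\<close> is its leg plus one, because the bounds are the column
  lengths of the full diagram.\<close>

lemma signed_fills_hooks:
  assumes la: "is_partition la"
  shows "signed_fills (conj_part la) (boxes la) = jack_c 2 la"
proof -
  let ?w = "\<lambda>s. 2 * real (arm la s) + real (leg la s) + 1"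
  let ?h = "conj_part la"
  have "signed_fills ?h {s \<in> boxes la. fst s < k} = prod ?w {s \<in> boxes la. fst s < k}" for k
  proof (induction k)
    case 0
    show ?case by (simp add: signed_fills_empty)
  next
    case (Suc k)
    show ?case
    proof (cases "k < length la")
      case False
      hence "{s \<in> boxes la. fst s < Suc k} = {s \<in> boxes la. fst s < k}" by (auto simp: boxes_def)
      thus ?thesis using Suc by metis
    next
      case True
      \<comment> \<open>The rows above \<open>k\<close> together with the last \<open>d\<close>
        boxes of row \<open>k\<close>. The box to be removed is the leftmost of its row, so its
        column has the largest bound there.\<close>
      define Q where "Q d = {s \<in> boxes la. fst s < k \<or> fst s = k \<and> la ! k - d \<le> snd s}" for d
      have "signed_fills ?h (Q d) = prod ?w (Q d)" if "d \<le> la ! k" for d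
        using that
      proof (induction d)
        case 0
        have "Q 0 = {s \<in> boxes la. fst s < k}" by (auto simp: Q_def boxes_def)
        thus ?case using Suc by simp
      next
        case (Suc d)
        define j where "j = la ! k - Suc d"
        have sB: "(k, j) \<in> boxes la" using Suc.prems True by (auto simp: boxes_def j_def)
        have kj: "k < ?h j" using sB boxes_iff_conj_part[OF la] by simp
        interpret box_removal "Q (Suc d)" ?h k j
        proof
          show "finite (Q (Suc d))" using finite_boxes by (simp add: Q_def)
          show "?h (snd s) \<le> ?h j" if "s \<in> Q (Suc d)" "fst s = k" for s
            using that by (intro conj_part_antimono) (auto simp: Q_def j_def)
          show "{s \<in> Q (Suc d). snd s = j} = (\<lambda>i. (i, j)) ` {..k}"
            using kj by (auto simp: Q_def j_def boxes_iff_conj_part[OF la] split: if_splits)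
          show "(i, snd s) \<in> Q (Suc d)" if "s \<in> Q (Suc d)" "fst s = k" "i < k" for s i
            using that by (cases s) (auto simp: Q_def boxes_iff_conj_part[OF la])
        qed
        have B': "B' = Q d"
          unfolding B'_def s0_def using Suc.prems by (auto simp: Q_def j_def boxes_def)
        have "{s \<in> Q d. fst s = k} = Pair k ` {la ! k - d..<la ! k}"
          using True by (auto simp: Q_def boxes_def)
        hence cd: "card {s \<in> Q d. fst s = k} = d" using Suc.prems by (simp add: card_image inj_on_def)
        have "?w (k, j) = real (?h j) - real k + 2 * real d"
          using kj Suc.prems by (simp add: arm_def leg_def j_def[symmetric] of_nat_diff) (simp add: j_def)
        hence "signed_fills ?h (Q (Suc d)) = ?w (k, j) * prod ?w (Q d)"
          using signed_fills_step Suc unfolding B' cd by simp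
        also have "\<dots> = prod ?w (Q (Suc d))"
          using prod.remove[OF fin s0_B, of ?w] B' by (simp add: B'_def s0_def)
        finally show ?case .
      qed
      from this[OF order_refl] show ?thesis
      proof -
        have "Q (la ! k) = {s \<in> boxes la. fst s < Suc k}" by (auto simp: Q_def)
        thus ?thesis using \<open>signed_fills ?h (Q (la ! k)) = prod ?w (Q (la ! k))\<close> by simp
      qed
    qed
  qed
  from this[of "length la"] show ?thesis
  proof -
    have "{s \<in> boxes la. fst s < length la} = boxes la" by (auto simp: boxes_def)
    thus ?thesis
      using \<open>signed_fills ?h {s \<in> boxes la. fst s < length la} = prod ?w {s \<in> boxes la. fst s < length la}\<close>
      by (simp add: jack_c_def)
  qed
qed

section \<open>The leading coefficient and the identification with the Jack family\<close>

lemma card_fibre_bij_betw: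
  assumes "bij_betw f C {..<m :: nat}"
  shows "card {s \<in> C. f s = i} = (if i < m then 1 else 0)"
proof (cases "i < m")
  case True
  then obtain s where s: "s \<in> C" "f s = i" using assms by (metis bij_betw_imp_surj_on imageE lessThan_iff)
  hence "{s \<in> C. f s = i} = {s}" using assms by (auto simp: bij_betw_def dest: inj_onD)
  thus ?thesis using True by simp
next
  case False
  hence "{s \<in> C. f s = i} = {}" using assms by (auto simp: bij_betw_def)
  thus ?thesis using False by (simp only: card.empty if_False)
qed

text \<open>Every column contains each value below its length exactly once, so the value
  \<open>i\<close> occurs once for each column that meets row \<open>i\<close>.\<close>

lemma column_bijective_content:
  assumes la: "is_partition la"
    and inj: "\<And>s t. s \<in> boxes la \<Longrightarrow> t \<in> boxes la \<Longrightarrow> snd s = snd t \<Longrightarrow> g s = g t \<Longrightarrow> s = t"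
    and lt: "\<And>s. s \<in> boxes la \<Longrightarrow> g s < conj_part la (snd s)"
    and i: "i < length la"
  shows "card {s \<in> boxes la. g s = i} = la ! i"
proof -
  have col: "card {s \<in> {s \<in> boxes la. g s = i}. snd s = c} = card {s \<in> {s \<in> boxes la. fst s = i}. snd s = c}" for c
  proof -
    let ?C = "{s \<in> boxes la. snd s = c}" and ?m = "conj_part la c"
    have C: "?C = (\<lambda>r. (r, c)) ` {..<?m}" using boxes_iff_conj_part[OF la] by auto
    have cardC: "card ?C = ?m" unfolding C by (simp add: card_image inj_on_def)
    have "inj_on g ?C" using inj by (auto intro!: inj_onI)
    moreover have "g ` ?C = {..<?m}"
    proof (rule card_subset_eq)
      show "card (g ` ?C) = card {..<?m}" using card_image[OF \<open>inj_on g ?C\<close>] cardC by simp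
    qed (use lt in auto)
    ultimately have 1: "bij_betw g ?C {..<?m}" by (simp add: bij_betw_def)
    have 2: "bij_betw fst ?C {..<?m}" unfolding C by (auto simp: bij_betw_def inj_on_def image_image)
    have "{s \<in> {s \<in> boxes la. g s = i}. snd s = c} = {s \<in> ?C. g s = i}"
      "{s \<in> {s \<in> boxes la. fst s = i}. snd s = c} = {s \<in> ?C. fst s = i}" by auto
    thus ?thesis using card_fibre_bij_betw[OF 1, of i] card_fibre_bij_betw[OF 2, of i] by simp
  qed
  have "card {s \<in> boxes la. g s = i} = card {s \<in> boxes la. fst s = i}"
    using card_by_columns[of "boxes la" "{s \<in> boxes la. g s = i}"]
      card_by_columns[of "boxes la" "{s \<in> boxes la. fst s = i}"] col finite_boxes by simp
  also have "{s \<in> boxes la. fst s = i} = Pair i ` {..<la ! i}" using i by (auto simp: boxes_def)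
  also have "card \<dots> = la ! i" by (simp add: card_image inj_on_def)
  finally show ?thesis .
qed

lemma conj_part_le: "conj_part la j \<le> length la"
  unfolding conj_part_def by (rule order_trans[OF card_mono[of "{..<length la}"]]) auto

text \<open>Column injectivity comes from the non-zero alternating sum. Content \<open>la\<close> is
  then the extreme case of the dominance bound, which forces the values in every column below its
  length; conversely, such values fill each column bijectively and produce content
  \<open>la\<close>.\<close>

lemma fill_ranges_agree:
  assumes la: "is_partition la" and nz: "alt_sum (boxes la) g \<noteq> 0"
  shows "g \<in> cells (boxes la) \<rightarrow>\<^sub>E {0..<length la} \<and> (\<forall>j<length la. card {x \<in> cells (boxes la). g x = j} = 2 * la ! j)
    \<longleftrightarrow> g \<in> Pi\<^sub>E (cells (boxes la)) (\<lambda>y. {..<conj_part la (snd (fst y))})" (is "?l \<longleftrightarrow> ?r")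
proof -
  let ?B = "boxes la"
  obtain p where p: "p \<in> col_perms ?B" "\<And>s. s \<in> ?B \<Longrightarrow> g (s, False) = g (p s, True)"
    "\<And>s t. s \<in> ?B \<Longrightarrow> t \<in> ?B \<Longrightarrow> snd s = snd t \<Longrightarrow> g (s, False) = g (t, False) \<Longrightarrow> s = t"
    using alt_sum_nonzero[OF finite_boxes nz] by metis
  note pD = col_permsD[OF p(1)]
  note cp = card_cells_pred[OF finite_boxes pD(1) p(2)]
  show ?thesis
  proof
    assume l: ?l
    have "g ` cells ?B \<subseteq> {0..<length la}" using l by (auto simp: PiE_def Pi_def)
    from card_less_content[OF finite_cells[OF finite_boxes] this, of 2]
    have "card {y \<in> cells ?B. g y < i} = 2 * sum_list (take i la)" for i using l by simp
    hence "card {s \<in> ?B. g (s, False) < i} = sum_list (take i la)" for i using cp[of "\<lambda>v. v < i"] by simp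
    hence lt: "g (s, False) < conj_part la (snd s)" if "s \<in> ?B" for s
      using column_injective_eq[OF la, of "\<lambda>s. g (s, False)"] p(3) that by blast
    show ?r
    proof (rule PiE_I)
      fix y assume y: "y \<in> cells ?B"
      obtain s x where sx: "y = (s, x)" by (cases y)
      have s: "s \<in> ?B" using y sx by (simp add: mem_cells)
      show "g y \<in> {..<conj_part la (snd (fst y))}"
      \<comment> \<open>The value on a second copy equals that on the first copy of
        \<open>inv p s\<close>, a box of the same column.\<close>
      proof (cases x)
        case True
        have u: "inv p s \<in> ?B" "p (inv p s) = s"
          using permutes_in_image[OF permutes_inv[OF pD(1)], of s] s permutes_inverses(1)[OF pD(1)] by auto
        have "snd (inv p s) = snd s" using pD(2)[of "inv p s"] u(2) by simp
        moreover have "g y = g (inv p s, False)" using p(2)[OF u(1)] u(2) sx True by simp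
        ultimately show ?thesis using lt[OF u(1)] sx by simp
      qed (use lt[OF s] sx in simp)
    qed (use l in \<open>blast dest: PiE_arb\<close>)
  next
    assume r: ?r
    have lt: "g y < conj_part la (snd (fst y))" if "y \<in> cells ?B" for y using PiE_mem[OF r that] by simp
    have "card {x \<in> cells ?B. g x = i} = 2 * la ! i" if "i < length la" for i
    proof -
      have "card {s \<in> ?B. g (s, False) = i} = la ! i"
      proof (rule column_bijective_content[OF la _ _ that])
        show "g (s, False) < conj_part la (snd s)" if "s \<in> ?B" for s
          using lt[of "(s, False)"] that by (simp add: mem_cells)
      qed (rule p(3))
      thus ?thesis using cp[of "\<lambda>v. v = i"] by simp
    qed
    moreover have "g \<in> cells ?B \<rightarrow>\<^sub>E {0..<length la}"
    proof (rule PiE_I)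
      show "g y \<in> {0..<length la}" if "y \<in> cells ?B" for y
        using lt[OF that] conj_part_le[of la] by (meson atLeastLessThan_iff le0 less_le_trans)
    qed (use PiE_arb[OF r] in blast)
    ultimately show ?l by blast
  qed
qed

lemma zonal_leading_coeff:
  assumes "la \<in> partitions_of n"
  shows "mcoeff n (zonal (boxes la)) la = jack_c 2 la"
proof -
  let ?B = "boxes la" and ?h = "conj_part la"
  have la: "is_partition la" "card ?B = n" using assms by (simp_all add: partitions_of_def card_boxes)
  let ?G1 = "{g \<in> cells ?B \<rightarrow>\<^sub>E {0..<length la}. \<forall>j<length la. card {x \<in> cells ?B. g x = j} = 2 * la ! j}"
  let ?G2 = "Pi\<^sub>E (cells ?B) (\<lambda>y. {..<?h (snd (fst y))})"
  have fc: "finite (cells ?B)" by (rule finite_cells[OF finite_boxes])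
  have f1: "finite ?G1" by (rule finite_subset[of _ "cells ?B \<rightarrow>\<^sub>E {0..<length la}"]) (auto intro!: finite_PiE fc)
  have f2: "finite ?G2" by (auto intro!: finite_PiE fc)
  have "mcoeff n (zonal ?B) la = (\<Sum>A\<in>row_pairings ?B. \<Sum>g\<in>{g \<in> ?G1. \<forall>y\<in>cells ?B. g (A y) = g y}. alt_sum ?B g)"
    by (rule mcoeff_zonal[OF finite_boxes la(2)])
  also have "\<dots> = (\<Sum>A\<in>row_pairings ?B. \<Sum>g\<in>{g \<in> ?G2. \<forall>y\<in>cells ?B. g (A y) = g y}. alt_sum ?B g)"
  proof (rule sum.cong[OF refl])
    fix A
    show "(\<Sum>g\<in>{g \<in> ?G1. \<forall>y\<in>cells ?B. g (A y) = g y}. alt_sum ?B g) =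
          (\<Sum>g\<in>{g \<in> ?G2. \<forall>y\<in>cells ?B. g (A y) = g y}. alt_sum ?B g)"
    proof (rule sum.mono_neutral_cong)
      show "finite {g \<in> ?G1. \<forall>y\<in>cells ?B. g (A y) = g y}" by (rule finite_subset[OF _ f1]) auto
      show "finite {g \<in> ?G2. \<forall>y\<in>cells ?B. g (A y) = g y}" by (rule finite_subset[OF _ f2]) auto
      fix g
      show "alt_sum ?B g = 0" if "g \<in> {g \<in> ?G2. \<forall>y\<in>cells ?B. g (A y) = g y} - {g \<in> ?G1. \<forall>y\<in>cells ?B. g (A y) = g y}"
        using fill_ranges_agree[OF la(1), of g] that by blast
      show "alt_sum ?B g = 0" if "g \<in> {g \<in> ?G1. \<forall>y\<in>cells ?B. g (A y) = g y} - {g \<in> ?G2. \<forall>y\<in>cells ?B. g (A y) = g y}"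
        using fill_ranges_agree[OF la(1), of g] that by blast
    qed simp
  qed
  also have "\<dots> = (\<Sum>p\<in>col_perms ?B. \<Sum>A\<in>row_pairings ?B. sgnr p *
            real (card {g \<in> ?G2. (\<forall>y\<in>cells ?B. g (col_pairing ?B p y) = g y) \<and> (\<forall>y\<in>cells ?B. g (A y) = g y)}))"
    by (rule signed_fill_sum[OF finite_boxes f2, symmetric])
  also have "\<dots> = signed_fills ?h ?B"
    unfolding signed_fills_def fills_def
    by (intro sum.cong refl) (simp add: col_pairing_invariant_iff)
  finally show ?thesis using signed_fills_hooks[OF la(1)] by simp
qed

lemma jack_c_pos: "jack_c 2 la > 0"
  unfolding jack_c_def by (intro prod_pos) (simp add: add_nonneg_pos)

lemma zonal_is_jack_family:
  "is_jack_family 2 n (\<lambda>la \<rho>. if la \<in> partitions_of n \<and> \<rho> \<in> partitions_of n then zonal (boxes la) \<rho> / jack_c 2 la else 0)"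
    (is "is_jack_family 2 n ?P")
proof -
  have m: "mcoeff n (?P la) \<mu> = mcoeff n (zonal (boxes la)) \<mu> / jack_c 2 la" if "la \<in> partitions_of n" for la \<mu>
    using that by (simp add: mcoeff_def sum_divide_distrib)
  have s: "jack_scalar 2 n (?P la) (?P \<mu>) = jack_scalar 2 n (zonal (boxes la)) (zonal (boxes \<mu>)) / (jack_c 2 la * jack_c 2 \<mu>)"
    if "la \<in> partitions_of n" "\<mu> \<in> partitions_of n" for la \<mu>
    using that by (simp add: jack_scalar_def sum_divide_distrib)
  show ?thesis
    unfolding is_jack_family_def
  proof (intro conjI ballI allI impI)
    fix la \<mu> assume h: "la \<in> partitions_of n" "\<mu> \<in> partitions_of n"
    show "dominated \<mu> la" if "mcoeff n (?P la) \<mu> \<noteq> 0"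
      using that m[OF h(1)] zonal_triangular[OF h] by auto
    show "jack_scalar 2 n (?P la) (?P \<mu>) = 0" if "la \<noteq> \<mu>"
      using s[OF h] zonal_orthogonal[OF h that] by simp
  next
    fix la assume h: "la \<in> partitions_of n"
    show "mcoeff n (?P la) la = 1"
      using m[OF h] zonal_leading_coeff[OF h] jack_c_pos[of la] by simp
  qed auto
qed

text \<open>The factor \<open>jack_c 2 la\<close> of the J-normalization cancels the division that
  made the family monic.\<close>

lemma theta_eq_zonal:
  assumes "is_partition la" "\<rho> \<in> partitions_of (sum_list la)"
  shows "theta 2 \<rho> la = zonal (boxes la) \<rho>"
  using assms jack_c_pos[of la]
  by (simp add: theta_def jack_P_family_eqI[OF _ zonal_is_jack_family] partitions_of_def)

section \<open>From zonal coefficients to pair-partitions\<close>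

text \<open>A loop has length two exactly when both pairings agree on it. For the complement of an
  embedded pair, this turns the ones added to the type into pointwise equality of the two
  pairings.\<close>

lemma ltype_ones_iff:
  assumes "pairings X A B"
  shows "(\<forall>x\<in>X. A x = B x) \<longleftrightarrow> ltype X A B = replicate_mset (card X div 2) 1"
proof -
  interpret p: pairings X A B by fact
  show ?thesis
  proof
    assume e: "\<forall>x\<in>X. A x = B x"
    have "card (cls X A B x) = 2" if x: "x \<in> X" for x
    proof -
      have "cls X A B x \<subseteq> {x, A x}"
      proof
        fix y assume "y \<in> cls X A B x"
        thus "y \<in> {x, A x}"
          by (rule p.cls_least)
             (use e x pairingD(1)[OF p.pA x] pairingD(3)[OF p.pA] pairingD(3)[OF p.pB] in auto)
      qed
      hence "cls X A B x = {x, A x}" using p.cls_refl[of x] p.cls_stepA[OF p.cls_refl[of x]] by auto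
      thus ?thesis using pairingD(2)[OF p.pA x] by simp
    qed
    hence "image_mset (\<lambda>C. card C div 2) (mset_set (lps X A B)) = image_mset (\<lambda>C. 1) (mset_set (lps X A B))"
      using p.finite_lps by (intro image_mset_cong) (auto simp: p.lps_eq)
    hence l: "ltype X A B = replicate_mset (card (lps X A B)) 1"
      by (simp add: ltype_def image_mset_const_eq)
    hence "card (lps X A B) = card X div 2" using p.sum_ltype by simp
    thus "ltype X A B = replicate_mset (card X div 2) 1" using l by simp
  next
    assume l: "ltype X A B = replicate_mset (card X div 2) 1"
    show "\<forall>x\<in>X. A x = B x"
    proof
      fix x assume x: "x \<in> X"
      have "card (cls X A B x) div 2 \<in># ltype X A B"
        using p.finite_lps x by (auto simp: ltype_def p.lps_eq)
      hence "card (cls X A B x) div 2 = 1" using l by (auto split: if_splits)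
      hence c: "card (cls X A B x) = 2" using p.cls_even[OF x] by auto
      have sub: "{x, A x, B x} \<subseteq> cls X A B x"
        using p.cls_refl p.cls_stepA[OF p.cls_refl] p.cls_stepB[OF p.cls_refl] by auto
      have "finite (cls X A B x)" using c by (metis card.infinite zero_neq_numeral)
      from card_mono[OF this sub] c have "card {x, A x, B x} \<le> 2" by simp
      thus "A x = B x" using pairingD(2)[OF p.pA x] pairingD(2)[OF p.pB x]
        by (auto simp: card_insert_if split: if_splits)
    qed
  qed
qed

lemma ltype_embedding:
  assumes "pairings X A B" "pairings Y A' B'" "\<phi> \<in> embs X A B Y A' B'"
  shows "closed_under A' B' (\<phi> ` X)"
    "ltype Y A' B' = ltype X A B + ltype (Y - \<phi> ` X) (restrict_id A' (Y - \<phi> ` X)) (restrict_id B' (Y - \<phi> ` X))"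
proof -
  interpret p: pairings X A B by fact
  interpret q: pairings Y A' B' by fact
  let ?D = "\<phi> ` X"
  have \<phi>: "\<phi> \<in> X \<rightarrow>\<^sub>E Y" "inj_on \<phi> X" "\<And>x. x \<in> X \<Longrightarrow> \<phi> (A x) = A' (\<phi> x) \<and> \<phi> (B x) = B' (\<phi> x)"
    using assms(3) by (auto simp: embs_def)
  have "A' (\<phi> x) \<in> ?D \<and> B' (\<phi> x) \<in> ?D" if "x \<in> X" for x
    using \<phi>(3)[OF that] pairingD(1)[OF p.pA that] pairingD(1)[OF p.pB that] by (metis imageI)
  thus cl: "closed_under A' B' ?D" by (auto simp: closed_under_def)
  have DY: "?D \<subseteq> Y" using \<phi>(1) by auto
  have r: "pairings ?D (restrict_id A' ?D) (restrict_id B' ?D)" using q.pairings_restrict[OF DY cl] .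
  interpret r: pairings ?D "restrict_id A' ?D" "restrict_id B' ?D" by (rule r)
  have img: "\<phi> ` cls X A B x = cls ?D (restrict_id A' ?D) (restrict_id B' ?D) (\<phi> x)" if x: "x \<in> X" for x
    by (rule equivariant_image_cls[OF assms(1) r x]) (use \<phi>(3) p.cls_sub[OF x] in auto)
  have "lps ?D (restrict_id A' ?D) (restrict_id B' ?D) = (image \<phi>) ` lps X A B"
    unfolding r.lps_eq p.lps_eq image_image using img by simp
  moreover have inj: "inj_on (image \<phi>) (lps X A B)"
    using inj_on_image_Pow[OF \<phi>(2)] p.lps_sub by (auto intro: inj_on_subset)
  ultimately have "ltype ?D (restrict_id A' ?D) (restrict_id B' ?D) =
      image_mset (\<lambda>C. card (\<phi> ` C) div 2) (mset_set (lps X A B))"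
    by (simp add: ltype_def image_mset_mset_set[symmetric] multiset.map_comp o_def)
  also have "\<dots> = ltype X A B"
    unfolding ltype_def
  proof (rule image_mset_cong)
    fix C assume "C \<in># mset_set (lps X A B)"
    hence "C \<subseteq> X" using p.finite_lps p.lps_sub by auto
    thus "card (\<phi> ` C) div 2 = card C div 2" using \<phi>(2) by (simp add: card_image inj_on_subset)
  qed
  finally show "ltype Y A' B' = ltype X A B + ltype (Y - ?D) (restrict_id A' (Y - ?D)) (restrict_id B' (Y - ?D))"
    using q.ltype_split[OF DY cl] by simp
qed

definition flip :: "'b \<times> bool \<Rightarrow> 'b \<times> bool" where
  "flip y = (fst y, \<not> snd y)"

lemma flip_simps [simp]: "flip (flip y) = y" "fst (flip y) = fst y" "snd (flip y) = (\<not> snd y)" "flip y \<noteq> y"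
  by (auto simp: flip_def prod_eq_iff)

lemma flip_cells [simp]: "flip y \<in> cells B \<longleftrightarrow> y \<in> cells B"
  by (simp add: mem_cells)

lemma col_pairing_flips:
  assumes "p \<in> col_perms B" "y \<in> cells B"
  shows "snd (col_pairing B p y) = (\<not> snd y)" "snd (fst (col_pairing B p y)) = snd (fst y)"
proof -
  have "snd (inv p s) = snd s" for s
    using col_permsD(2)[OF assms(1), of "inv p s"] permutes_inverses(1)[OF col_permsD(1)[OF assms(1)], of s] by simp
  thus "snd (col_pairing B p y) = (\<not> snd y)" "snd (fst (col_pairing B p y)) = snd (fst y)"
    using assms(2) col_permsD(2)[OF assms(1)] by (simp_all add: col_pairing_def mem_cells)
qed

text \<open>Together with \<open>col_pairing_flips\<close>, identifies column permutations with the
  pairings that switch copies and stay within columns; the permutation is read off from the first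
  copies.\<close>

lemma col_pairing_exists:
  assumes "finite B" "pairing (cells B) q"
    and "\<And>y. y \<in> cells B \<Longrightarrow> snd (q y) = (\<not> snd y) \<and> snd (fst (q y)) = snd (fst y)"
  obtains p where "p \<in> col_perms B" "col_pairing B p = q"
proof -
  note qD = pairingD[OF assms(2)]
  define p where "p s = (if s \<in> B then fst (q (s, False)) else s)" for s
  have q1: "q (s, False) = (p s, True)" "p s \<in> B" if "s \<in> B" for s
  proof -
    have c: "(s, False) \<in> cells B" using that by (simp add: mem_cells)
    show "q (s, False) = (p s, True)" using assms(3)[OF c] that by (simp add: p_def prod_eq_iff)
    show "p s \<in> B" using qD(1)[OF c] that by (simp add: p_def mem_cells)
  qed
  have inj: "inj_on p B"
  proof (rule inj_onI)
    fix s t assume "s \<in> B" "t \<in> B" "p s = p t"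
    hence "q (s, False) = q (t, False)" using q1 by simp
    thus "s = t" using qD(3) by (metis prod.inject)
  qed
  have "p ` B = B" using q1(2) inj assms(1) by (intro endo_inj_surj) auto
  hence perm: "p permutes B" using inj by (intro bij_imp_permutes) (auto simp: bij_betw_def p_def)
  have "snd (p s) = snd s" for s
    using assms(3)[of "(s, False)"] by (auto simp: p_def mem_cells)
  hence p: "p \<in> col_perms B" using perm by (simp add: col_perms_def)
  have "col_pairing B p y = q y" for y
  proof (cases "y \<in> cells B")
    case False
    thus ?thesis using qD(4) by (simp add: col_pairing_def mem_cells)
  next
    case True
    show ?thesis
    proof (cases "snd y")
      case False
      hence "y = (fst y, False)" by (simp add: prod_eq_iff)
      hence "q y = (p (fst y), True)" using q1(1)[of "fst y"] True by (simp add: mem_cells)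
      thus ?thesis using True False by (simp add: col_pairing_def mem_cells)
    next
      case snd: True
      have i: "inv p (fst y) \<in> B" "p (inv p (fst y)) = fst y"
        using permutes_in_image[OF permutes_inv[OF perm], of "fst y"] True permutes_inverses(1)[OF perm]
        by (simp_all add: mem_cells)
      have "q (inv p (fst y), False) = y" using q1(1)[OF i(1)] i(2) snd by (simp add: prod_eq_iff)
      hence "q y = (inv p (fst y), False)" using qD(3) by metis
      thus ?thesis using True snd by (simp add: col_pairing_def mem_cells)
    qed
  qed
  thus ?thesis using that[OF p] by blast
qed

lemma col_pairing_inject:
  assumes "p \<in> col_perms B" "p' \<in> col_perms B" "\<And>y. y \<in> cells B \<Longrightarrow> col_pairing B p y = col_pairing B p' y"
  shows "p = p'"
proof
  fix s
  show "p s = p' s"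
  proof (cases "s \<in> B")
    case True
    thus ?thesis using assms(3)[of "(s, False)"] by (simp add: col_pairing_def mem_cells)
  next
    case False
    thus ?thesis using permutes_not_in col_permsD(1) assms(1,2) by metis
  qed
qed

text \<open>Transports \<open>S\<close> along \<open>\<phi>\<close> and completes it by
  \<open>flip\<close>. Applied to \<open>S1\<close> and \<open>S2\<close>, this produces the column
  and the row pairing that belong to a lift.\<close>

lemma extended_pairing:
  assumes S: "pairing X S" and \<phi>: "inj_on \<phi> X" "\<phi> ` X \<subseteq> cells B" and D: "\<And>y. y \<in> \<phi> ` X \<Longrightarrow> flip y \<in> \<phi> ` X"
  shows "pairing (cells B) (\<lambda>y. if y \<in> \<phi> ` X then \<phi> (S (inv_into X \<phi> y)) else if y \<in> cells B then flip y else y)"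
proof -
  define q where "q = (\<lambda>y. if y \<in> \<phi> ` X then \<phi> (S (inv_into X \<phi> y)) else if y \<in> cells B then flip y else y)"
  note SD = pairingD[OF S]
  have D': "flip y \<in> \<phi> ` X \<longleftrightarrow> y \<in> \<phi> ` X" for y using D[of y] D[of "flip y"] by auto
  have qx: "q (\<phi> x) = \<phi> (S x)" if "x \<in> X" for x using that \<phi>(1) by (simp add: q_def)
  have "pairing (cells B) q" unfolding pairing_def
  proof (intro conjI ballI allI impI)
    fix y assume y: "y \<in> cells B"
    have "q y \<in> cells B \<and> q y \<noteq> y \<and> q (q y) = y"
    proof (cases "y \<in> \<phi> ` X")
      case True
      then obtain x where x: "x \<in> X" "y = \<phi> x" by auto
      have Sx: "S x \<in> X" "S x \<noteq> x" "S (S x) = x" using SD(1-3) x(1) by auto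
      have "q y = \<phi> (S x)" "q (\<phi> (S x)) = y" using qx x Sx by auto
      moreover have "\<phi> (S x) \<noteq> \<phi> x" using \<phi>(1) Sx x(1) by (auto dest: inj_onD)
      moreover have "\<phi> (S x) \<in> cells B" using \<phi>(2) Sx by auto
      ultimately show ?thesis using x by simp
    next
      case False
      hence "q y = flip y" "q (flip y) = y" using y D' by (auto simp: q_def)
      thus ?thesis using y by simp
    qed
    thus "q y \<in> cells B" "q y \<noteq> y" "q (q y) = y" by blast+
  next
    fix y assume "y \<notin> cells B"
    thus "q y = y" using \<phi>(2) by (auto simp: q_def)
  qed
  thus ?thesis by (simp add: q_def)
qed

section \<open>Lifts and images of a map into the cells\<close>

locale couple = pairings X S1 S2 for X :: "'a set" and S1 S2 +
  fixes B :: "(nat \<times> nat) set"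
  assumes finB: "finite B"
begin

text \<open>The part of both kinds of summand conditions that involves neither \<open>S0\<close> nor
  \<open>(p, A)\<close>.\<close>

definition compat :: "('a \<Rightarrow> (nat \<times> nat) \<times> bool) \<Rightarrow> bool" where
  "compat \<phi> \<longleftrightarrow> (\<forall>x\<in>X. snd (\<phi> (S1 x)) = (\<not> snd (\<phi> x)) \<and> snd (fst (\<phi> (S1 x))) = snd (fst (\<phi> x)) \<and>
     fst (fst (\<phi> (S2 x))) = fst (fst (\<phi> x)))"

text \<open>For injective \<open>\<phi>\<close>, both \<open>lifts \<phi>\<close> and \<open>images \<phi>\<close> have at most one element; the first one describes a summand
  of the claimed formula, the second one a summand of the zonal coefficient.\<close>
definition lifts :: "('a \<Rightarrow> (nat \<times> nat) \<times> bool) \<Rightarrow> ('a \<Rightarrow> 'a) set" where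
  "lifts \<phi> = {S0. pairing X S0 \<and> (\<forall>x\<in>X. \<phi> (S0 x) = flip (\<phi> x))}"

definition images :: "('a \<Rightarrow> (nat \<times> nat) \<times> bool) \<Rightarrow>
    ((nat \<times> nat \<Rightarrow> nat \<times> nat) \<times> ((nat \<times> nat) \<times> bool \<Rightarrow> (nat \<times> nat) \<times> bool)) set" where
  "images \<phi> = {(p, A). p \<in> col_perms B \<and> A \<in> row_pairings B \<and>
     (\<forall>x\<in>X. \<phi> (S1 x) = col_pairing B p (\<phi> x) \<and> \<phi> (S2 x) = A (\<phi> x)) \<and>
     (\<forall>y\<in>cells B - \<phi> ` X. col_pairing B p y = A y)}"

lemma XS: "x \<in> X \<Longrightarrow> S1 x \<in> X" "x \<in> X \<Longrightarrow> S2 x \<in> X"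
  using pairingD(1)[OF pA] pairingD(1)[OF pB] by blast+

lemma imagesD:
  assumes "(p, A) \<in> images \<phi>"
  shows "p \<in> col_perms B" "A \<in> row_pairings B"
    "x \<in> X \<Longrightarrow> \<phi> (S1 x) = col_pairing B p (\<phi> x)" "x \<in> X \<Longrightarrow> \<phi> (S2 x) = A (\<phi> x)"
    "y \<in> cells B \<Longrightarrow> y \<notin> \<phi> ` X \<Longrightarrow> col_pairing B p y = A y"
proof -
  have "p \<in> col_perms B \<and> A \<in> row_pairings B \<and>
     (\<forall>x\<in>X. \<phi> (S1 x) = col_pairing B p (\<phi> x) \<and> \<phi> (S2 x) = A (\<phi> x)) \<and>
     (\<forall>y\<in>cells B - \<phi> ` X. col_pairing B p y = A y)"
    using assms unfolding images_def mem_Collect_eq prod.case .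
  thus "p \<in> col_perms B" "A \<in> row_pairings B"
    "x \<in> X \<Longrightarrow> \<phi> (S1 x) = col_pairing B p (\<phi> x)" "x \<in> X \<Longrightarrow> \<phi> (S2 x) = A (\<phi> x)"
    "y \<in> cells B \<Longrightarrow> y \<notin> \<phi> ` X \<Longrightarrow> col_pairing B p y = A y" by blast+
qed

lemma images_compat:
  assumes "(p, A) \<in> images \<phi>" "\<phi> \<in> X \<rightarrow> cells B"
  shows "compat \<phi>"
  unfolding compat_def
proof (intro ballI conjI)
  fix x assume x: "x \<in> X"
  have e: "\<phi> (S1 x) = col_pairing B p (\<phi> x)" "\<phi> (S2 x) = A (\<phi> x)" "p \<in> col_perms B" "A \<in> row_pairings B"
    using imagesD[OF assms(1)] x by blast+
  have m: "\<phi> x \<in> cells B" using assms(2) x by auto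
  show "snd (\<phi> (S1 x)) = (\<not> snd (\<phi> x))" "snd (fst (\<phi> (S1 x))) = snd (fst (\<phi> x))"
    "fst (fst (\<phi> (S2 x))) = fst (fst (\<phi> x))"
    using e col_pairing_flips[OF e(3) m] row_pairingsD(2)[OF e(4)] by simp_all
qed

text \<open>Where the column and the row pairing agree, the partner has the same column, the same
  row and the opposite copy index, so it is the other copy of the same box.\<close>

lemma images_outside:
  assumes "(p, A) \<in> images \<phi>" "y \<in> cells B" "y \<notin> \<phi> ` X"
  shows "col_pairing B p y = flip y" "A y = flip y"
proof -
  have e: "col_pairing B p y = A y" "p \<in> col_perms B" "A \<in> row_pairings B"
    using imagesD[OF assms(1)] assms(2,3) by blast+
  show "col_pairing B p y = flip y"
    using col_pairing_flips[OF e(2) assms(2)] row_pairingsD(2)[OF e(3), of y] e(1)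
    by (simp add: flip_def prod_eq_iff)
  thus "A y = flip y" using e(1) by simp
qed

context
  fixes \<phi> :: "'a \<Rightarrow> (nat \<times> nat) \<times> bool"
  assumes inj: "inj_on \<phi> X" and maps: "\<phi> \<in> X \<rightarrow> cells B" and compat: "compat \<phi>"
begin

lemma lifts_unique:
  assumes "S \<in> lifts \<phi>" "S' \<in> lifts \<phi>"
  shows "S = S'"
proof
  fix x
  have p: "pairing X S" "pairing X S'" using assms by (auto simp: lifts_def)
  show "S x = S' x"
  proof (cases "x \<in> X")
    case True
    hence "\<phi> (S x) = \<phi> (S' x)" using assms by (simp add: lifts_def)
    thus ?thesis using inj pairingD(1)[OF p(1) True] pairingD(1)[OF p(2) True] by (auto dest: inj_onD)
  next
    case False
    thus ?thesis using pairingD(4)[OF p(1)] pairingD(4)[OF p(2)] by simp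
  qed
qed

lemma images_unique:
  assumes "(p, A) \<in> images \<phi>" "(p', A') \<in> images \<phi>"
  shows "p = p'" "A = A'"
proof -
  have e: "p \<in> col_perms B" "p' \<in> col_perms B" "A \<in> row_pairings B" "A' \<in> row_pairings B"
    using imagesD[OF assms(1)] imagesD[OF assms(2)] by blast+
  have eq: "col_pairing B p y = col_pairing B p' y \<and> A y = A' y" if y: "y \<in> cells B" for y
  proof (cases "y \<in> \<phi> ` X")
    case True
    then obtain x where "x \<in> X" "y = \<phi> x" by auto
    thus ?thesis
      using imagesD(3,4)[OF assms(1), of x] imagesD(3,4)[OF assms(2), of x] by simp
  next
    case False
    thus ?thesis using images_outside[OF assms(1) y] images_outside[OF assms(2) y] by simp
  qed
  show "p = p'" using col_pairing_inject[OF e(1,2)] eq by blast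
  show "A = A'"
  proof
    fix y
    show "A y = A' y"
      using eq[of y] pairingD(4)[OF row_pairingsD(1)[OF e(3)], of y] pairingD(4)[OF row_pairingsD(1)[OF e(4)], of y]
      by (cases "y \<in> cells B") auto
  qed
qed

text \<open>If \<open>flip y\<close> were not an image, its column partner would be
  \<open>y\<close>; but the column partner of \<open>y = \<phi> x\<close> is the image of
  \<open>S1 x\<close>.\<close>

lemma image_flip_closed_of_images:
  assumes "(p, A) \<in> images \<phi>" "y \<in> \<phi> ` X"
  shows "flip y \<in> \<phi> ` X"
proof (rule ccontr)
  assume n: "flip y \<notin> \<phi> ` X"
  obtain x where x: "x \<in> X" "y = \<phi> x" using assms(2) by auto
  have yc: "y \<in> cells B" using maps x by auto
  have p: "p \<in> col_perms B" using imagesD(1)[OF assms(1)] .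
  have "col_pairing B p (flip y) = y" using images_outside(1)[OF assms(1) _ n] yc by simp
  hence "flip y = col_pairing B p y" using pairingD(3)[OF pairing_col_pairing[OF p]] by metis
  also have "\<dots> = \<phi> (S1 x)" using imagesD(3)[OF assms(1) x(1)] x(2) by simp
  finally show False using n XS(1)[OF x(1)] by blast
qed

lemma lift_of_image:
  assumes "(p, A) \<in> images \<phi>"
  shows "\<exists>S. S \<in> lifts \<phi>"
proof -
  define S where "S x = (if x \<in> X then inv_into X \<phi> (flip (\<phi> x)) else x)" for x
  have S: "S x \<in> X" "\<phi> (S x) = flip (\<phi> x)" if "x \<in> X" for x
  proof -
    have f: "flip (\<phi> x) \<in> \<phi> ` X" using image_flip_closed_of_images[OF assms] that by blast
    show "S x \<in> X" "\<phi> (S x) = flip (\<phi> x)"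
      using inv_into_into[OF f] f_inv_into_f[OF f] that by (simp_all add: S_def)
  qed
  have "pairing X S" unfolding pairing_def
  proof (intro conjI ballI allI impI)
    fix x assume x: "x \<in> X"
    show "S x \<in> X" by (rule S(1)[OF x])
    show "S x \<noteq> x" using S(2)[OF x] flip_simps(4)[of "\<phi> x"] by metis
    have "\<phi> (S (S x)) = \<phi> x" using S(2)[OF S(1)[OF x]] S(2)[OF x] by simp
    thus "S (S x) = x" by (rule inj_onD[OF inj _ S(1)[OF S(1)[OF x]] x])
  qed (simp add: S_def)
  thus ?thesis using S by (auto simp: lifts_def)
qed

lemma image_of_lift:
  assumes "S \<in> lifts \<phi>"
  shows "\<exists>p A. (p, A) \<in> images \<phi>"
proof -
  have S: "pairing X S" "\<And>x. x \<in> X \<Longrightarrow> \<phi> (S x) = flip (\<phi> x)" using assms by (auto simp: lifts_def)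
  have D: "flip y \<in> \<phi> ` X" if "y \<in> \<phi> ` X" for y
  proof -
    from that obtain x where x: "x \<in> X" "y = \<phi> x" by blast
    hence "flip y = \<phi> (S x)" using S(2) by simp
    thus ?thesis using pairingD(1)[OF S(1) x(1)] by blast
  qed
  have sub: "\<phi> ` X \<subseteq> cells B" using maps by auto
  let ?e = "\<lambda>(S :: 'a \<Rightarrow> 'a) y. if y \<in> \<phi> ` X then \<phi> (S (inv_into X \<phi> y)) else if y \<in> cells B then flip y else y"
  have e: "?e T (\<phi> x) = \<phi> (T x)" if "x \<in> X" for T :: "'a \<Rightarrow> 'a" and x using inj that by simp
  have e': "?e T y = flip y" if "y \<in> cells B" "y \<notin> \<phi> ` X" for T y using that by simp
  note p1 = extended_pairing[OF pA inj sub D] and p2 = extended_pairing[OF pB inj sub D]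
  have col: "snd (?e S1 y) = (\<not> snd y) \<and> snd (fst (?e S1 y)) = snd (fst y)" if "y \<in> cells B" for y
  proof (cases "y \<in> \<phi> ` X")
    case True
    then obtain x where "x \<in> X" "y = \<phi> x" by auto
    thus ?thesis using e compat by (simp add: compat_def)
  qed (use e'[OF that] in simp)
  have row: "fst (fst (?e S2 y)) = fst (fst y)" for y
  proof (cases "y \<in> \<phi> ` X")
    case True
    then obtain x where "x \<in> X" "y = \<phi> x" by auto
    thus ?thesis using e compat by (simp add: compat_def)
  qed auto
  obtain p where p: "p \<in> col_perms B" "col_pairing B p = ?e S1"
    using col_pairing_exists[OF finB p1 col] by blast
  have A: "?e S2 \<in> row_pairings B" using p2 row unfolding row_pairings_def by blast
  have "(p, ?e S2) \<in> images \<phi>"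
    unfolding images_def using p A e by simp
  thus ?thesis by blast
qed

text \<open>Follow the first copy of a box \<open>s\<close> in the image: \<open>S1\<close> leads to
  the second copy of \<open>p s\<close>, and \<open>S\<close> to its first copy. So \<open>p\<close>
  is the half permutation transported to boxes, and it fixes every box whose first copy is not an
  image.\<close>

lemma sign_lift_image:
  assumes S: "S \<in> lifts \<phi>" and pA': "(p, A) \<in> images \<phi>"
  shows "sgnr p = sgnr (halfperm X S1 S (\<lambda>x. snd (\<phi> x)))"
proof -
  let ?E = "{x \<in> X. \<not> snd (\<phi> x)}" and ?t = "halfperm X S1 S (\<lambda>x. snd (\<phi> x))"
  let ?f = "\<lambda>x. fst (\<phi> x)"
  have pS: "pairing X S" and Sf: "\<And>x. x \<in> X \<Longrightarrow> \<phi> (S x) = flip (\<phi> x)" using S by (auto simp: lifts_def)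
  have p: "p \<in> col_perms B" using imagesD(1)[OF pA'] .
  have ps: "pairings X S1 S" using fin pA pS by (simp add: pairings_def)
  have t: "?t permutes ?E"
    by (rule halfperm_permutes[OF ps]) (use compat Sf in \<open>auto simp: compat_def\<close>)
  have injE: "inj_on ?f ?E"
  proof (rule inj_onI)
    fix x y assume "x \<in> ?E" "y \<in> ?E" "?f x = ?f y"
    hence "\<phi> x = \<phi> y" "x \<in> X" "y \<in> X" by (simp_all add: prod_eq_iff)
    thus "x = y" using inj by (auto dest: inj_onD)
  qed
  have "map_permutation ?E ?f ?t s = p s" for s
  proof (cases "s \<in> ?f ` ?E")
    case True
    then obtain x where x: "x \<in> ?E" "s = ?f x" by blast
    have xX: "x \<in> X" using x by simp
    have "\<phi> x = (s, False)" using x by (simp add: prod_eq_iff)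
    moreover have "\<phi> x \<in> cells B" using maps xX by auto
    ultimately have "col_pairing B p (\<phi> x) = (p s, True)" by (simp add: col_pairing_def mem_cells)
    moreover have "\<phi> (S1 x) = col_pairing B p (\<phi> x)" using imagesD(3)[OF pA' xX] .
    ultimately have "?f (S1 x) = p s" by simp
    moreover have "?f (S (S1 x)) = ?f (S1 x)" using Sf[OF XS(1)[OF xX]] by simp
    moreover have "?t x = S (S1 x)" using x by (simp add: halfperm_def)
    moreover have "map_permutation ?E ?f ?t (?f x) = ?f (?t x)"
      by (rule map_permutation_apply[OF injE x(1)])
    ultimately show ?thesis using x(2) by simp
  next
    case False
    have "p s = s"
    proof (cases "s \<in> B")
      case True
      have "(s, False) \<notin> \<phi> ` X"
      proof
        assume "(s, False) \<in> \<phi> ` X"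
        then obtain x where "x \<in> X" "\<phi> x = (s, False)" by (metis imageE)
        hence "s = ?f x" "x \<in> ?E" by simp_all
        thus False using False by blast
      qed
      hence "col_pairing B p (s, False) = flip (s, False)"
        using images_outside(1)[OF pA'] True by (simp add: mem_cells)
      thus ?thesis using True by (simp add: col_pairing_def flip_def)
    qed (use col_permsD(1)[OF p] permutes_not_in in metis)
    thus ?thesis using False by (simp add: map_permutation_def)
  qed
  hence "p = map_permutation ?E ?f ?t" by auto
  moreover have "sign (map_permutation ?E ?f ?t) = sign ?t"
    using sign_map_permutation[OF injE t] fin by simp
  ultimately show ?thesis by (simp add: sgnr_def)
qed

lemma sum_lifts_images:
  "(\<Sum>S\<in>lifts \<phi>. sgnr (halfperm X S1 S (\<lambda>x. snd (\<phi> x)))) = (\<Sum>(p, A)\<in>images \<phi>. sgnr p)"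
proof (cases "lifts \<phi> = {}")
  case True
  have "images \<phi> = {}"
  proof (rule ccontr)
    assume "images \<phi> \<noteq> {}"
    then obtain p A where "(p, A) \<in> images \<phi>" by (metis equals0I surj_pair)
    from lift_of_image[OF this] show False using True by blast
  qed
  thus ?thesis using True by simp
next
  case False
  then obtain S where S: "S \<in> lifts \<phi>" by blast
  then obtain p A where pA': "(p, A) \<in> images \<phi>" using image_of_lift by blast
  have "lifts \<phi> = {S}" using lifts_unique S by blast
  moreover have "images \<phi> = {(p, A)}"
  proof (intro equalityI subsetI)
    fix q assume q: "q \<in> images \<phi>"
    obtain p' A' where pq: "q = (p', A')" by (cases q)
    show "q \<in> {(p, A)}" using images_unique[OF q[unfolded pq] pA'] pq by simp
  qed (use pA' in simp)
  ultimately show ?thesis using sign_lift_image[OF S pA'] by simp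
qed

end

text \<open>For two points with the same image, conjugation by their transposition preserves the set
  of lifts. It multiplies the half permutation by a single transposition, which reverses the
  sign.\<close>

lemma sum_lifts_not_inj:
  assumes ni: "\<not> inj_on \<phi> X" and compat: "compat \<phi>"
  shows "(\<Sum>S\<in>lifts \<phi>. sgnr (halfperm X S1 S (\<lambda>x. snd (\<phi> x)))) = 0"
proof -
  obtain x y where xy: "x \<in> X" "y \<in> X" "x \<noteq> y" "\<phi> x = \<phi> y" using ni by (auto simp: inj_on_def)
  let ?tr = "swap x y" and ?e = "\<lambda>x. snd (\<phi> x)"
  have tr\<phi>: "\<phi> (?tr z) = \<phi> z" for z using xy(4) by (cases "z = x"; cases "z = y") auto
  have trX: "?tr z \<in> X \<longleftrightarrow> z \<in> X" for z
    using permutes_in_image[OF permutes_swap_id[OF xy(1,2)]] .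
  have eS1: "?e (S1 z) = (\<not> ?e z)" if "z \<in> X" for z using compat that by (simp add: compat_def)
  show ?thesis
  proof (rule sum_sign_reversing[where i = "\<lambda>S. ?tr \<circ> S \<circ> ?tr"])
    fix S assume "S \<in> lifts \<phi>"
    hence S: "pairing X S" "\<And>x. x \<in> X \<Longrightarrow> \<phi> (S x) = flip (\<phi> x)" by (auto simp: lifts_def)
    note SD = pairingD[OF S(1)]
    let ?S = "?tr \<circ> S \<circ> ?tr"
    have S': "pairing X ?S" by (rule transpose_conj_pairing[OF S(1) xy(1,2)])
    have S'2: "\<phi> (?S z) = flip (\<phi> z)" if "z \<in> X" for z
      using that S(2)[of "?tr z"] trX[of z] tr\<phi> by simp
    show "?S \<in> lifts \<phi>" using S' S'2 by (simp add: lifts_def)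
    show "?tr \<circ> ?S \<circ> ?tr = S" by (simp add: fun_eq_iff)
    let ?h = "halfperm X S1 S ?e" and ?E = "{z \<in> X. \<not> ?e z}"
    have ps: "pairings X S1 S" using fin pA S(1) by (simp add: pairings_def)
    have h: "?h permutes ?E"
      by (rule halfperm_permutes[OF ps]) (use eS1 S(2) in auto)
    have finE: "finite ?E" using fin by simp
    have eS: "?e (S z) = (\<not> ?e z)" if "z \<in> X" for z using S(2)[OF that] by simp
    have nt: "?tr z = z" if "?e z \<noteq> ?e x" for z
    proof -
      have "z \<noteq> x" "z \<noteq> y" using that xy(4) by auto
      thus ?thesis by simp
    qed
    show "sgnr (halfperm X S1 ?S ?e) = - sgnr ?h"
    \<comment> \<open>Only one of the two factors of the conjugation affects the half permutation:
      on first copies the outer one, on second copies the inner one, which passes through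
      \<open>S1\<close> and becomes the transposition of \<open>S1 x\<close> and
      \<open>S1 y\<close>.\<close>
    proof (cases "?e x")
      case False
      have "halfperm X S1 ?S ?e = ?tr \<circ> ?h"
      proof
        fix z
        show "halfperm X S1 ?S ?e z = (?tr \<circ> ?h) z"
        proof (cases "z \<in> X \<and> \<not> ?e z")
          case True
          hence "?tr (S1 z) = S1 z" using nt eS1 False by simp
          thus ?thesis using True by (simp add: halfperm_def)
        next
          case F: False
          hence "z \<noteq> x" "z \<noteq> y" using xy False by auto
          thus ?thesis using F by (auto simp: halfperm_def)
        qed
      qed
      thus ?thesis using sgnr_compose_transpose(2)[OF h finE xy(3)] by simp
    next
      case True
      let ?u = "S1 x" and ?v = "S1 y"
      have uv: "?u \<noteq> ?v" using xy(3) by (simp add: pairing_eq_iff[OF pA])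
      have uE: "?u \<in> ?E" "?v \<in> ?E" using True xy eS1 XS by auto
      have S1tr: "S1 (swap ?u ?v z) = ?tr (S1 z)" for z
        using pairingD(3)[OF pA] by (metis transpose_apply_other transpose_apply_first transpose_apply_second)
      have "halfperm X S1 ?S ?e = ?h \<circ> swap ?u ?v"
      proof
        fix z
        show "halfperm X S1 ?S ?e z = (?h \<circ> swap ?u ?v) z"
        proof (cases "z \<in> ?E")
          case zE: True
          have "swap ?u ?v z \<in> ?E"
            using permutes_in_image[OF permutes_swap_id[OF uE]] zE by simp
          hence "(?h \<circ> swap ?u ?v) z = S (?tr (S1 z))" by (simp add: halfperm_def S1tr)
          moreover have "?tr (S (?tr (S1 z))) = S (?tr (S1 z))"
          proof (rule nt)
            have "?tr (S1 z) \<in> X" using trX XS(1) zE by simp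
            hence "?e (S (?tr (S1 z))) = (\<not> ?e (?tr (S1 z)))" by (rule eS)
            also have "?e (?tr (S1 z)) = ?e (S1 z)" by (simp only: tr\<phi>)
            finally show "?e (S (?tr (S1 z))) \<noteq> ?e x" using eS1[of z] zE True by simp
          qed
          ultimately show ?thesis using zE by (simp add: halfperm_def)
        next
          case zE: False
          hence "z \<noteq> ?u" "z \<noteq> ?v" using uE by auto
          hence "swap ?u ?v z = z" by simp
          thus ?thesis using zE by (auto simp: halfperm_def)
        qed
      qed
      thus ?thesis using sgnr_compose_transpose(1)[OF h finE uv] by simp
    qed
  qed
qed

end

section \<open>Comparison of the sum over \<open>S0\<close> with the zonal coefficient\<close>

context couple
begin

text \<open>An alternating colouring \<open>e\<close> and a map \<open>f\<close> counted by
  \<open>N1\<close> combine into one map \<open>\<phi>\<close> into the cells: along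
  \<open>S0\<close> the box stays the same while the colour changes, which is the condition
  \<open>\<phi> (S0 x) = flip (\<phi> x)\<close>.\<close>

lemma sum_over_lifts:
  "(\<Sum>S0\<in>{S. pairing X S}. \<Sum>e\<in>alts X S0 S1.
      \<Sum>f\<in>{f \<in> X \<rightarrow>\<^sub>E B. \<forall>l\<in>X. f l = f (S0 l) \<and> snd (f l) = snd (f (S1 l)) \<and> fst (f l) = fst (f (S2 l))}.
        sgnr (halfperm X S1 S0 e)) =
   (\<Sum>\<phi>\<in>X \<rightarrow>\<^sub>E cells B. if compat \<phi> then \<Sum>S0\<in>lifts \<phi>. sgnr (halfperm X S1 S0 (\<lambda>x. snd (\<phi> x))) else 0)"
    (is "?l = ?r")
proof -
  let ?N = "\<lambda>S0. {f \<in> X \<rightarrow>\<^sub>E B. \<forall>l\<in>X. f l = f (S0 l) \<and> snd (f l) = snd (f (S1 l)) \<and> fst (f l) = fst (f (S2 l))}"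
  let ?h = "\<lambda>S0 \<phi>. sgnr (halfperm X S1 S0 (\<lambda>x. snd (\<phi> x)))"
  let ?\<Phi> = "X \<rightarrow>\<^sub>E cells B"
  have fin\<Phi>: "finite ?\<Phi>" by (intro finite_PiE fin finite_cells finB)
  have finP: "finite {S. pairing X S}" by (rule finite_pairings[OF fin])
  have "?l = (\<Sum>S0\<in>{S. pairing X S}. \<Sum>\<phi>\<in>{\<phi> \<in> ?\<Phi>. compat \<phi> \<and> (\<forall>x\<in>X. \<phi> (S0 x) = flip (\<phi> x))}. ?h S0 \<phi>)"
  proof (rule sum.cong[OF refl])
    fix S0 assume "S0 \<in> {S. pairing X S}"
    hence S0: "S0 x \<in> X" if "x \<in> X" for x using that pairingD(1) by fast
    have "(\<Sum>e\<in>alts X S0 S1. \<Sum>f\<in>?N S0. sgnr (halfperm X S1 S0 e)) =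
        (\<Sum>(e, f)\<in>alts X S0 S1 \<times> ?N S0. sgnr (halfperm X S1 S0 e))"
      by (rule sum.cartesian_product)
    also have "\<dots> = (\<Sum>\<phi>\<in>{\<phi> \<in> ?\<Phi>. compat \<phi> \<and> (\<forall>x\<in>X. \<phi> (S0 x) = flip (\<phi> x))}. ?h S0 \<phi>)"
    proof (rule sum.reindex_bij_witness[where i = "\<lambda>\<phi>. (\<lambda>x\<in>X. snd (\<phi> x), \<lambda>x\<in>X. fst (\<phi> x))"
          and j = "\<lambda>(e, f). \<lambda>x\<in>X. (f x, e x)"])
      fix ef assume "ef \<in> alts X S0 S1 \<times> ?N S0"
      then obtain e f where ef: "ef = (e, f)" "e \<in> alts X S0 S1" "f \<in> ?N S0" by blast
      have e: "e \<in> X \<rightarrow>\<^sub>E UNIV" "\<And>x. x \<in> X \<Longrightarrow> e (S0 x) = (\<not> e x) \<and> e (S1 x) = (\<not> e x)"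
        using ef(2) unfolding alts_def by blast+
      have f: "f \<in> X \<rightarrow>\<^sub>E B" "\<And>x. x \<in> X \<Longrightarrow> f (S0 x) = f x \<and> snd (f (S1 x)) = snd (f x) \<and> fst (f (S2 x)) = fst (f x)"
        using ef(3) by auto
      have r: "restrict e X = e" "restrict f X = f" using e(1) f(1) by (auto simp: PiE_def extensional_restrict)
      show "(\<lambda>\<phi>. (\<lambda>x\<in>X. snd (\<phi> x), \<lambda>x\<in>X. fst (\<phi> x))) (case ef of (e, f) \<Rightarrow> \<lambda>x\<in>X. (f x, e x)) = ef"
        using r by (simp add: ef(1) cong: restrict_cong)
      have c: "(\<lambda>x\<in>X. (f x, e x)) \<in> ?\<Phi>" using f(1) by (auto simp: mem_cells)
      moreover have "compat (\<lambda>x\<in>X. (f x, e x))"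
        unfolding compat_def using e(2) f(2) XS by simp
      moreover have "(\<lambda>x\<in>X. (f x, e x)) (S0 x) = flip ((\<lambda>x\<in>X. (f x, e x)) x)" if "x \<in> X" for x
        using that S0[OF that] e(2)[OF that] f(2)[OF that] by (simp add: flip_def)
      ultimately show "(case ef of (e, f) \<Rightarrow> \<lambda>x\<in>X. (f x, e x)) \<in> {\<phi> \<in> ?\<Phi>. compat \<phi> \<and> (\<forall>x\<in>X. \<phi> (S0 x) = flip (\<phi> x))}"
        unfolding ef(1) by simp
      have "halfperm X S1 S0 (\<lambda>x. snd ((\<lambda>x\<in>X. (f x, e x)) x)) = halfperm X S1 S0 e"
        by (auto simp: halfperm_def)
      thus "?h S0 (case ef of (e, f) \<Rightarrow> \<lambda>x\<in>X. (f x, e x)) = (case ef of (e, f) \<Rightarrow> sgnr (halfperm X S1 S0 e))"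
        unfolding ef(1) by simp
    next
      fix \<phi> assume \<phi>: "\<phi> \<in> {\<phi> \<in> ?\<Phi>. compat \<phi> \<and> (\<forall>x\<in>X. \<phi> (S0 x) = flip (\<phi> x))}"
      have ph: "\<phi> \<in> ?\<Phi>" "compat \<phi>" "\<And>x. x \<in> X \<Longrightarrow> \<phi> (S0 x) = flip (\<phi> x)" using \<phi> by auto
      have "(\<lambda>x\<in>X. snd (\<phi> x)) \<in> alts X S0 S1"
        unfolding alts_def using ph(2,3) S0 XS by (simp add: compat_def)
      moreover have "fst (\<phi> x) \<in> B" if "x \<in> X" for x using ph(1) that by (auto simp: mem_cells)
      hence "(\<lambda>x\<in>X. fst (\<phi> x)) \<in> ?N S0"
        using ph(2,3) S0 XS by (simp add: compat_def)
      ultimately show "(\<lambda>x\<in>X. snd (\<phi> x), \<lambda>x\<in>X. fst (\<phi> x)) \<in> alts X S0 S1 \<times> ?N S0" by blast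
      show "(case (\<lambda>x\<in>X. snd (\<phi> x), \<lambda>x\<in>X. fst (\<phi> x)) of (e, f) \<Rightarrow> \<lambda>x\<in>X. (f x, e x)) = \<phi>"
        using PiE_arb[OF ph(1)] by (auto simp: fun_eq_iff)
    qed
    finally show "(\<Sum>e\<in>alts X S0 S1. \<Sum>f\<in>?N S0. sgnr (halfperm X S1 S0 e)) =
        (\<Sum>\<phi>\<in>{\<phi> \<in> ?\<Phi>. compat \<phi> \<and> (\<forall>x\<in>X. \<phi> (S0 x) = flip (\<phi> x))}. ?h S0 \<phi>)" .
  qed
  also have "\<dots> = (\<Sum>S0\<in>{S. pairing X S}. \<Sum>\<phi>\<in>?\<Phi>. if compat \<phi> \<and> (\<forall>x\<in>X. \<phi> (S0 x) = flip (\<phi> x)) then ?h S0 \<phi> else 0)"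
    by (rule sum.cong[OF refl], rule sum.inter_filter[OF fin\<Phi>])
  also have "\<dots> = (\<Sum>\<phi>\<in>?\<Phi>. \<Sum>S0\<in>{S. pairing X S}. if compat \<phi> \<and> (\<forall>x\<in>X. \<phi> (S0 x) = flip (\<phi> x)) then ?h S0 \<phi> else 0)"
    by (rule sum.swap)
  also have "\<dots> = ?r"
  proof (rule sum.cong[OF refl])
    fix \<phi>
    have "lifts \<phi> = {S0 \<in> {S. pairing X S}. \<forall>x\<in>X. \<phi> (S0 x) = flip (\<phi> x)}" by (auto simp: lifts_def)
    hence "(\<Sum>S0\<in>lifts \<phi>. ?h S0 \<phi>) = (\<Sum>S0\<in>{S. pairing X S}. if \<forall>x\<in>X. \<phi> (S0 x) = flip (\<phi> x) then ?h S0 \<phi> else 0)"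
      using sum.inter_filter[OF finP] by simp
    thus "(\<Sum>S0\<in>{S. pairing X S}. if compat \<phi> \<and> (\<forall>x\<in>X. \<phi> (S0 x) = flip (\<phi> x)) then ?h S0 \<phi> else 0) =
      (if compat \<phi> then \<Sum>S0\<in>lifts \<phi>. ?h S0 \<phi> else 0)"
      by (cases "compat \<phi>") simp_all
  qed
  finally show ?thesis .
qed

lemma sum_over_lifts_inj:
  assumes "\<phi> \<in> X \<rightarrow>\<^sub>E cells B"
  shows "(if compat \<phi> then \<Sum>S0\<in>lifts \<phi>. sgnr (halfperm X S1 S0 (\<lambda>x. snd (\<phi> x))) else 0) =
    (if inj_on \<phi> X then \<Sum>(p, A)\<in>images \<phi>. sgnr p else 0)"
proof -
  have m: "\<phi> \<in> X \<rightarrow> cells B" using assms by (simp add: PiE_def)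
  show ?thesis
  proof (cases "compat \<phi>")
    case True
    thus ?thesis using sum_lifts_images[OF _ m True] sum_lifts_not_inj[OF _ True] by simp
  next
    case False
    hence "images \<phi> = {}" using images_compat[OF _ m] by fast
    thus ?thesis using False by simp
  qed
qed

text \<open>An embedding accounts for the part \<open>M\<close> of the type; what is left consists
  of ones exactly if the two pairings agree outside the image.\<close>

lemma images_iff_type:
  assumes lt: "ltype X S1 S2 = M" and c: "card (cells B) = card X + 2 * m"
    and \<phi>: "\<phi> \<in> X \<rightarrow>\<^sub>E cells B" "inj_on \<phi> X"
  shows "(p, A) \<in> images \<phi> \<longleftrightarrow> p \<in> col_perms B \<and> A \<in> row_pairings B \<and>
     \<phi> \<in> embs X S1 S2 (cells B) (col_pairing B p) A \<and> ltype (cells B) (col_pairing B p) A = M + replicate_mset m 1"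
proof -
  let ?D = "\<phi> ` X" let ?C = "cells B - \<phi> ` X"
  have DY: "?D \<subseteq> cells B" using \<phi>(1) by auto
  have "card ?D = card X" using \<phi>(2) by (rule card_image)
  hence cC: "card ?C div 2 = m" using c DY fin by (simp add: card_Diff_subset)
  have key: "(\<forall>y\<in>?C. col_pairing B p y = A y) \<longleftrightarrow> ltype (cells B) (col_pairing B p) A = M + replicate_mset m 1"
    if pA': "p \<in> col_perms B" "A \<in> row_pairings B" and e: "\<phi> \<in> embs X S1 S2 (cells B) (col_pairing B p) A"
  proof -
    have ps: "pairings (cells B) (col_pairing B p) A" using pairings_cells[OF finB pA'] .
    interpret q: pairings "cells B" "col_pairing B p" A by (rule ps)
    note E = ltype_embedding[OF pairings_axioms ps e]
    have r: "pairings ?C (restrict_id (col_pairing B p) ?C) (restrict_id A ?C)"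
      using q.closed_Diff[OF E(1)] by (intro q.pairings_restrict) auto
    have "(\<forall>y\<in>?C. col_pairing B p y = A y) \<longleftrightarrow> (\<forall>y\<in>?C. restrict_id (col_pairing B p) ?C y = restrict_id A ?C y)"
      by (simp add: restrict_id_apply)
    also have "\<dots> \<longleftrightarrow> ltype ?C (restrict_id (col_pairing B p) ?C) (restrict_id A ?C) = replicate_mset m 1"
      using ltype_ones_iff[OF r] cC by simp
    also have "\<dots> \<longleftrightarrow> ltype (cells B) (col_pairing B p) A = M + replicate_mset m 1"
      unfolding E(2) lt by simp
    finally show ?thesis .
  qed
  have "\<phi> \<in> embs X S1 S2 (cells B) (col_pairing B p) A \<longleftrightarrow>
      (\<forall>x\<in>X. \<phi> (S1 x) = col_pairing B p (\<phi> x) \<and> \<phi> (S2 x) = A (\<phi> x))"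
    using \<phi> by (simp add: embs_def)
  thus ?thesis using key unfolding images_def mem_Collect_eq prod.case by blast
qed

lemma sum_type_embs:
  assumes lt: "ltype X S1 S2 = M" and c: "card (cells B) = card X + 2 * m"
  shows "(\<Sum>p\<in>col_perms B. \<Sum>A\<in>row_pairings B.
      (if ltype (cells B) (col_pairing B p) A = M + replicate_mset m 1 then sgnr p else 0) *
        real (card (embs X S1 S2 (cells B) (col_pairing B p) A))) =
    (\<Sum>\<phi>\<in>X \<rightarrow>\<^sub>E cells B. if inj_on \<phi> X then \<Sum>(p, A)\<in>images \<phi>. sgnr p else 0)"
    (is "?l = ?r")
proof -
  let ?\<Phi> = "X \<rightarrow>\<^sub>E cells B"
  have fin\<Phi>: "finite ?\<Phi>" by (intro finite_PiE fin finite_cells finB)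
  have finPA: "finite (col_perms B \<times> row_pairings B)"
    using finite_col_perms[OF finB] finite_row_pairings[OF finB] by simp
  have "?l = (\<Sum>p\<in>col_perms B. \<Sum>A\<in>row_pairings B. \<Sum>\<phi>\<in>?\<Phi>. if inj_on \<phi> X \<and> (p, A) \<in> images \<phi> then sgnr p else 0)"
  proof (intro sum.cong refl)
    fix p A assume pA': "p \<in> col_perms B" "A \<in> row_pairings B"
    let ?E = "embs X S1 S2 (cells B) (col_pairing B p) A"
    have "?E = {\<phi> \<in> ?\<Phi>. \<phi> \<in> ?E}" by (auto simp: embs_def)
    hence "real (card ?E) = (\<Sum>\<phi>\<in>?\<Phi>. if \<phi> \<in> ?E then 1 else 0)"
      using real_card_sum_indicator[OF fin\<Phi>, of "\<lambda>\<phi>. \<phi> \<in> ?E"] by simp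
    also have "(if ltype (cells B) (col_pairing B p) A = M + replicate_mset m 1 then sgnr p else 0) * \<dots> =
      (\<Sum>\<phi>\<in>?\<Phi>. if inj_on \<phi> X \<and> (p, A) \<in> images \<phi> then sgnr p else 0)"
      unfolding sum_distrib_left
    proof (rule sum.cong[OF refl])
      fix \<phi> assume \<phi>: "\<phi> \<in> ?\<Phi>"
      have "\<phi> \<in> ?E \<Longrightarrow> inj_on \<phi> X" by (simp add: embs_def)
      thus "(if ltype (cells B) (col_pairing B p) A = M + replicate_mset m 1 then sgnr p else 0) * (if \<phi> \<in> ?E then 1 else 0) =
          (if inj_on \<phi> X \<and> (p, A) \<in> images \<phi> then sgnr p else 0)"
        using images_iff_type[OF lt c \<phi>, of p A] pA' by auto
    qed
    finally show "(if ltype (cells B) (col_pairing B p) A = M + replicate_mset m 1 then sgnr p else 0) * real (card ?E) =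
      (\<Sum>\<phi>\<in>?\<Phi>. if inj_on \<phi> X \<and> (p, A) \<in> images \<phi> then sgnr p else 0)" .
  qed
  also have "\<dots> = (\<Sum>(p, A)\<in>col_perms B \<times> row_pairings B. \<Sum>\<phi>\<in>?\<Phi>. if inj_on \<phi> X \<and> (p, A) \<in> images \<phi> then sgnr p else 0)"
    by (rule sum.cartesian_product)
  also have "\<dots> = (\<Sum>q\<in>col_perms B \<times> row_pairings B. \<Sum>\<phi>\<in>?\<Phi>. if inj_on \<phi> X \<and> q \<in> images \<phi> then sgnr (fst q) else 0)"
    by (rule sum.cong[OF refl]) (simp only: case_prod_unfold prod.collapse)
  also have "\<dots> = (\<Sum>\<phi>\<in>?\<Phi>. \<Sum>q\<in>col_perms B \<times> row_pairings B. if inj_on \<phi> X \<and> q \<in> images \<phi> then sgnr (fst q) else 0)"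
    by (rule sum.swap)
  also have "\<dots> = ?r"
  proof (rule sum.cong[OF refl])
    fix \<phi>
    have "images \<phi> = {q \<in> col_perms B \<times> row_pairings B. q \<in> images \<phi>}"
      using imagesD(1,2) by fast
    hence "(\<Sum>q\<in>images \<phi>. sgnr (fst q)) = (\<Sum>q\<in>col_perms B \<times> row_pairings B. if q \<in> images \<phi> then sgnr (fst q) else 0)"
      using sum.inter_filter[OF finPA, of "\<lambda>q. sgnr (fst q)" "\<lambda>q. q \<in> images \<phi>"] by simp
    thus "(\<Sum>q\<in>col_perms B \<times> row_pairings B. if inj_on \<phi> X \<and> q \<in> images \<phi> then sgnr (fst q) else 0) =
      (if inj_on \<phi> X then \<Sum>(p, A)\<in>images \<phi>. sgnr p else 0)"
      by (cases "inj_on \<phi> X") (simp_all add: case_prod_unfold)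
  qed
  finally show ?thesis .
qed

end

lemma prod_falling_binomial: "(\<Prod>j<c. N - j) = fact c * (N choose c)" for N :: nat
proof (induction N arbitrary: c)
  case 0
  show ?case by (cases c) (simp_all only: prod_falling_Suc, simp_all)
next
  case (Suc N)
  show ?case
  proof (cases c)
    case (Suc c')
    have "(\<Prod>j<c. Suc N - j) = Suc N * (fact c' * (N choose c'))"
      unfolding Suc prod_falling_Suc using Suc.IH by simp
    also have "\<dots> = fact c' * (Suc N * (N choose c'))" by (rule mult.left_commute)
    also have "Suc N * (N choose c') = Suc c' * (Suc N choose Suc c')" by (rule Suc_times_binomial[symmetric])
    finally show ?thesis using Suc by (simp add: algebra_simps)
  qed simp
qed

text \<open>Only the part 1 can have a larger multiplicity in the target, so the falling products
  are factorials except for one, which yields the binomial coefficient. The result is the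
  normalization of \<open>Sigma_char\<close> times \<open>2 ^ length \<mu>\<close>.\<close>

lemma card_embs_binomial:
  assumes "pairings X A B" "pairings Y A' B'" "ltype X A B = mset \<mu>" "ltype Y A' B' = mset \<mu> + replicate_mset m 1"
  shows "real (card (embs X A B Y A' B')) = 2 ^ length \<mu> * (zee \<mu> * real ((m + mult \<mu> 1) choose (mult \<mu> 1)))"
proof -
  let ?c = "count (mset \<mu>)" and ?M = "mset \<mu> + replicate_mset m 1"
  have "(\<Prod>i\<in>set \<mu>. count ?M i choose ?c i) = (m + ?c 1) choose ?c 1"
  proof (cases "1 \<in> set \<mu>")
    case True
    have "(\<Prod>i\<in>set \<mu>. count ?M i choose ?c i) = (count ?M 1 choose ?c 1) * (\<Prod>i\<in>set \<mu> - {1}. count ?M i choose ?c i)"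
      using True by (intro prod.remove) auto
    also have "(\<Prod>i\<in>set \<mu> - {1}. count ?M i choose ?c i) = 1" by (rule prod.neutral) auto
    finally show ?thesis by (simp add: add.commute)
  next
    case False
    hence c0: "?c 1 = 0" by (simp add: count_mset_0_iff)
    have "(\<Prod>i\<in>set \<mu>. count ?M i choose ?c i) = 1"
      using False by (intro prod.neutral) auto
    thus ?thesis unfolding c0 by (simp only: binomial_n_0)
  qed
  moreover have "card (embs X A B Y A' B') = (\<Prod>i\<in>set \<mu>. (2 * i) ^ ?c i * (fact (?c i) * (count ?M i choose ?c i)))"
    using card_embs[OF assms(1,2) finite_set[of \<mu>]] unfolding assms(3,4) prod_falling_binomial by simp
  ultimately have "card (embs X A B Y A' B') = (\<Prod>i\<in>set \<mu>. (2 * i) ^ ?c i * fact (?c i)) * ((m + ?c 1) choose ?c 1)"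
    by (simp add: mult.assoc[symmetric] prod.distrib)
  hence "real (card (embs X A B Y A' B')) = (zee \<mu> * 2 ^ length \<mu>) * real ((m + ?c 1) choose ?c 1)"
    unfolding zee_pow2 by simp
  thus ?thesis by (simp add: mult_def)
qed

lemma append_ones_partition:
  assumes "\<mu> \<in> partitions_of k"
  shows "\<mu> @ replicate m 1 \<in> partitions_of (k + m)"
proof -
  have "x \<ge> 1" if "x \<in> set \<mu>" for x
    using assms that by (cases x) (auto simp: partitions_of_def is_partition_def)
  moreover have "sorted_wrt (\<ge>) (replicate m (1 :: nat))" by (induction m) auto
  ultimately show ?thesis
    using assms by (auto simp: partitions_of_def is_partition_def sorted_wrt_append sum_list_replicate)
qed

theorem theorem1p6:
  fixes k :: nat and \<mu> :: "nat list" and S1 S2 :: "nat \<Rightarrow> nat"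
  assumes "\<mu> \<in> partitions_of k"
    and "pair_partition k S1" and "pair_partition k S2"
    and "loop_type k S1 S2 = mset \<mu>"
  shows "\<forall>la. is_partition la \<longrightarrow>
    Sigma_char 2 \<mu> la =
      (1 / 2 ^ length \<mu>) *
      (\<Sum>S0\<in>pair_partitions k.
         loop_sign k S0 S1 * 2 ^ num_loops k S0 S1 * real (N1 k S0 S1 S2 la))"
proof (intro allI impI)
  fix la assume la: "is_partition la"
  define n where "n = sum_list la"
  define X where "X = {1..2 * k}"
  let ?B = "boxes la"
  have pp: "pair_partition k S \<longleftrightarrow> pairing X S" for S
    unfolding pair_partition_def pairing_def X_def by blast
  have lp: "loops k A B = lps X A B" for A B
    unfolding loops_def lps_def loop_rel_def adj_def X_def ..
  have P: "pairings X S1 S2" using assms(2,3) pp by (simp add: pairings_def X_def)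
  interpret couple X S1 S2 ?B
    using P finite_boxes by (simp add: couple_def couple_axioms_def)
  have lt: "ltype X S1 S2 = mset \<mu>" using assms(4) by (simp add: loop_type_def ltype_def lp)
  have cX: "card X = 2 * k" by (simp add: X_def)
  have cY: "card (cells ?B) = 2 * n" by (simp add: card_cells finite_boxes card_boxes n_def)
  have k: "sum_list \<mu> = k" using assms(1) by (simp add: partitions_of_def)
  let ?N = "\<lambda>S0. {f \<in> X \<rightarrow>\<^sub>E ?B. \<forall>l\<in>X. f l = f (S0 l) \<and> snd (f l) = snd (f (S1 l)) \<and> fst (f l) = fst (f (S2 l))}"
  let ?R = "\<Sum>\<phi>\<in>X \<rightarrow>\<^sub>E cells ?B. if inj_on \<phi> X then \<Sum>(p, A)\<in>images \<phi>. sgnr p else 0"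
  have "(\<Sum>S0\<in>pair_partitions k. loop_sign k S0 S1 * 2 ^ num_loops k S0 S1 * real (N1 k S0 S1 S2 la)) =
      (\<Sum>S0\<in>{S. pairing X S}. \<Sum>e\<in>alts X S0 S1. \<Sum>f\<in>?N S0. sgnr (halfperm X S1 S0 e))"
  proof (rule sum.cong)
    show "pair_partitions k = {S. pairing X S}" by (simp add: pair_partitions_def pp)
    fix S0 assume "S0 \<in> {S. pairing X S}"
    hence ps: "pairings X S1 S0" "pairings X S0 S1" using fin pA by (simp_all add: pairings_def)
    \<comment> \<open>The sign of the half permutation is the same for all alternating colourings,
      so summing over them merely yields the factor \<open>2 ^ num_loops k S0 S1\<close>.\<close>
    have sg: "sgnr (halfperm X S1 S0 e) = loop_sign k S0 S1" if "e \<in> alts X S0 S1" for e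
    proof -
      have "e (S1 x) = (\<not> e x) \<and> e (S0 x) = (\<not> e x)" if "x \<in> X" for x
        using \<open>e \<in> alts X S0 S1\<close> that by (simp add: alts_def)
      from sign_halfperm[OF ps(1) this] show ?thesis
        by (simp add: sgnr_def loop_sign_def num_loops_def lp cX lps_commute[of X S0 S1])
    qed
    have "(\<Sum>e\<in>alts X S0 S1. \<Sum>f\<in>?N S0. sgnr (halfperm X S1 S0 e)) =
        real (card (alts X S0 S1)) * (real (card (?N S0)) * loop_sign k S0 S1)"
      using sg by simp
    also have "card (?N S0) = N1 k S0 S1 S2 la" by (simp add: N1_def X_def)
    also have "card (alts X S0 S1) = 2 ^ num_loops k S0 S1"
      using card_alts[OF ps(2)] by (simp add: num_loops_def lp)
    finally show "loop_sign k S0 S1 * 2 ^ num_loops k S0 S1 * real (N1 k S0 S1 S2 la) =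
      (\<Sum>e\<in>alts X S0 S1. \<Sum>f\<in>?N S0. sgnr (halfperm X S1 S0 e))" by simp
  qed
  also have "\<dots> = ?R"
    unfolding sum_over_lifts using sum_over_lifts_inj by (intro sum.cong refl)
  also have "?R = 2 ^ length \<mu> * Sigma_char 2 \<mu> la"
  proof (cases "k \<le> n")
    \<comment> \<open>For a diagram with fewer than \<open>k\<close> boxes no map from
      \<open>2 * k\<close> points to the cells is injective, so the sum vanishes, in accordance with
      the convention in \<open>Sigma_char\<close>.\<close>
    case False
    have "\<not> inj_on \<phi> X" if "\<phi> \<in> X \<rightarrow>\<^sub>E cells ?B" for \<phi>
    proof
      assume "inj_on \<phi> X"
      hence "card X \<le> card (cells ?B)"
        using that by (intro card_inj_on_le[of \<phi>]) (auto simp: finite_cells finite_boxes)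
      thus False using False cX cY by simp
    qed
    hence "?R = 0" by (intro sum.neutral) simp
    moreover have "Sigma_char 2 \<mu> la = 0" using False by (simp add: Sigma_char_def k n_def)
    ultimately show ?thesis by simp
  next
    case True
    define m where "m = n - k"
    define \<rho> where "\<rho> = \<mu> @ replicate m 1"
    have \<rho>: "\<rho> \<in> partitions_of n" using append_ones_partition[OF assms(1), of m] True by (simp add: \<rho>_def m_def)
    have m\<rho>: "mset \<rho> = mset \<mu> + replicate_mset m 1" by (simp add: \<rho>_def)
    let ?c = "real ((m + mult \<mu> 1) choose (mult \<mu> 1))"
    have "?R = (\<Sum>p\<in>col_perms ?B. \<Sum>A\<in>row_pairings ?B.
      (if ltype (cells ?B) (col_pairing ?B p) A = mset \<mu> + replicate_mset m 1 then sgnr p else 0) *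
        real (card (embs X S1 S2 (cells ?B) (col_pairing ?B p) A)))"
      by (rule sum_type_embs[OF lt, symmetric]) (use cX cY True in \<open>simp add: m_def\<close>)
    \<comment> \<open>All pairs of type \<open>\<rho>\<close> admit the same number of embeddings,
      so this number comes out of the signed sum.\<close>
    also have "\<dots> = (\<Sum>p\<in>col_perms ?B. \<Sum>A\<in>row_pairings ?B.
      (if ltype (cells ?B) (col_pairing ?B p) A = mset \<rho> then sgnr p else 0) * (2 ^ length \<mu> * (zee \<mu> * ?c)))"
      unfolding m\<rho>
      by (intro sum.cong refl) (simp add: card_embs_binomial[OF P pairings_cells[OF finite_boxes] lt])
    also have "\<dots> = zonal ?B \<rho> * (2 ^ length \<mu> * (zee \<mu> * ?c))"
      by (simp only: zonal_def sum_distrib_right)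
    also have "zonal ?B \<rho> = theta 2 \<rho> la" using theta_eq_zonal[OF la] \<rho> by (simp add: n_def)
    also have "theta 2 \<rho> la * (2 ^ length \<mu> * (zee \<mu> * ?c)) = 2 ^ length \<mu> * Sigma_char 2 \<mu> la"
      using True unfolding Sigma_char_def k n_def[symmetric] m_def[symmetric] \<rho>_def by simp
    finally show ?thesis .
  qed
  finally show "Sigma_char 2 \<mu> la = (1 / 2 ^ length \<mu>) *
      (\<Sum>S0\<in>pair_partitions k. loop_sign k S0 S1 * 2 ^ num_loops k S0 S1 * real (N1 k S0 S1 S2 la))"
    by simp
qed

end
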